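(* There exists an almost disjoint family $\mathcal{A}$ of countable sets such that $C(K_{\mathcal{A}})$ has the controlled separable complementation property and the continuous separable complementation property, but $C(K_{\mathcal{A}})$ has neither a projectional resolution of the identity nor a projectional skeleton.
   Context: A family $\mathcal{A}$ of infinite sets is almost disjoint if $A\cap B$ is finite for all distinct $A,B\in\mathcal{A}$; "countable sets" means that all its members are countably infinite. Put $X=\bigcup\mathcal{A}$. The compact Hausdorff space $K_{\mathcal{A}}$ has underlying set $X\cup\{l_A: A\in\mathcal{A}\}\cup\{\infty\}$ (the points $l_A$ and $\infty$ being new and distinct); each point of $X$ is isolated, basic neighborhoods of $l_A$ are $\{l_A\}\cup(A\setminus F)$ with $F$ finite, and basic neighborhoods of $\infty$ are $K_{\mathcal{A}}\setminus\bigcup_{i<n}(\{l_{A_i}\}\cup A_i)$ with $A_0,\dots,A_{n-1}\in\mathcal{A}$. $C(K)$ is the Banach space of real-valued continuous functions on $K$ with the supremum norm. A projection on a Banach space $E$ is a bounded linear operator $P:E\to E$ with $P^2=P$; a subspace is complemented if it is the image of a projection. Controlled separable complementation property of $E$: for every separable subspace $F\subseteq E$ and every (norm-)separable subspace $G\subseteq E^*$ there is a projection $P:E\to E$ with $F\subseteq\operatorname{im}P$, $G\subseteq\operatorname{im}P^*$ and $\operatorname{im}P$ separable. Continuous separable complementation property of $E$: there is a family $\mathcal{F}$ of separable complemented subspaces of $E$ (a skeleton) such that $E=\bigcup\mathcal{F}$, $\mathcal{F}$ is up-directed by inclusion, and for every sequence $F_0\subseteq F_1\subseteq\cdots$ in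 $\mathcal{F}$ the closure of $\bigcup_nF_n$ belongs to $\mathcal{F}$. $E$ has a projectional skeleton if there is such a skeleton $\mathcal{F}$ together with projections $P_F$ of $E$ onto $F$ ($F\in\mathcal{F}$) satisfying $P_F\circ P_G=P_G\circ P_F=P_F$ whenever $F\subseteq G$, $F,G\in\mathcal{F}$. A projectional resolution of the identity (PRI) on a Banach space $E$ of density $\kappa$ is (standard notion) a family $\{P_\alpha\}_{\alpha\le\kappa}$ of norm-one projections on $E$ with $P_\kappa=\mathrm{id}_E$ such that $P_\alpha P_\beta=P_\beta P_\alpha=P_{\min(\alpha,\beta)}$, the density of $\operatorname{im}P_\alpha$ is at most $|\alpha|+\omega$ for $\alpha<\kappa$, and $\operatorname{im}P_\lambda$ is the closure of $\bigcup_{\alpha<\lambda}\operatorname{im}P_\alpha$ for each limit $\lambda\le\kappa$. *)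

theory Defs
  imports "HOL-Probability.Discrete_Topology"
begin

unbundle cardinal_syntax

section \<open>Almost disjoint families and the space \<open>K\<^sub>\<A>\<close>\<close>

definition almost_disjoint :: "'a set set \<Rightarrow> bool" where
  "almost_disjoint \<A> \<longleftrightarrow> (\<forall>A\<in>\<A>. infinite A) \<and> pairwise (\<lambda>A B. finite (A \<inter> B)) \<A>"

datatype 'a kpoint = Pt 'a | Lim "'a set" | Infty

definition kspace :: "'a set set \<Rightarrow> 'a kpoint set" where
  "kspace \<A> = Pt ` \<Union>\<A> \<union> Lim ` \<A> \<union> {Infty}"

fun basic_nbhds :: "'a set set \<Rightarrow> 'a kpoint \<Rightarrow> 'a kpoint set set" where
  "basic_nbhds \<A> (Pt x) = {{Pt x}}"
| "basic_nbhds \<A> (Lim A) = {{Lim A} \<union> Pt ` (A - F) | F. finite F}"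
| "basic_nbhds \<A> Infty = {kspace \<A> - (\<Union>A\<in>\<B>. {Lim A} \<union> Pt ` A) | \<B>. finite \<B> \<and> \<B> \<subseteq> \<A>}"

definition ktopology :: "'a set set \<Rightarrow> 'a kpoint topology" where
  "ktopology \<A> = topology (\<lambda>U. U \<subseteq> kspace \<A> \<and> (\<forall>p\<in>U. \<exists>N\<in>basic_nbhds \<A> p. N \<subseteq> U))"

lemma basic_nbhds_Int:
  assumes "N \<in> basic_nbhds \<A> p" and "M \<in> basic_nbhds \<A> p"
  shows "N \<inter> M \<in> basic_nbhds \<A> p"
proof (cases p)
  case (Pt x)
  with assms show ?thesis by simp
next
  case (Lim A)
  with assms obtain F G where "finite F" "finite G"
    "N = {Lim A} \<union> Pt ` (A - F)" "M = {Lim A} \<union> Pt ` (A - G)" by auto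
  then have "finite (F \<union> G)" "N \<inter> M = {Lim A} \<union> Pt ` (A - (F \<union> G))" by auto
  then show ?thesis unfolding Lim by (simp only: basic_nbhds.simps) blast
next
  case Infty
  with assms obtain \<B> \<C> where "finite \<B>" "\<B> \<subseteq> \<A>" "finite \<C>" "\<C> \<subseteq> \<A>"
    "N = kspace \<A> - (\<Union>A\<in>\<B>. {Lim A} \<union> Pt ` A)" "M = kspace \<A> - (\<Union>A\<in>\<C>. {Lim A} \<union> Pt ` A)"
    by auto
  then have "finite (\<B> \<union> \<C>) \<and> \<B> \<union> \<C> \<subseteq> \<A>"
    "N \<inter> M = kspace \<A> - (\<Union>A\<in>\<B> \<union> \<C>. {Lim A} \<union> Pt ` A)" by auto
  then show ?thesis unfolding Infty by (simp only: basic_nbhds.simps) blast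
qed

lemma openin_ktopology:
  "openin (ktopology \<A>) U \<longleftrightarrow> U \<subseteq> kspace \<A> \<and> (\<forall>p\<in>U. \<exists>N\<in>basic_nbhds \<A> p. N \<subseteq> U)"
proof -
  let ?O = "\<lambda>U. U \<subseteq> kspace \<A> \<and> (\<forall>p\<in>U. \<exists>N\<in>basic_nbhds \<A> p. N \<subseteq> U)"
  have Int: "?O (S \<inter> T)" if "?O S" "?O T" for S T
  proof (intro conjI ballI)
    show "S \<inter> T \<subseteq> kspace \<A>" using that by blast
    fix p assume "p \<in> S \<inter> T"
    with that obtain N M where N: "N \<in> basic_nbhds \<A> p" "N \<subseteq> S"
      and M: "M \<in> basic_nbhds \<A> p" "M \<subseteq> T" by blast
    show "\<exists>N\<in>basic_nbhds \<A> p. N \<subseteq> S \<inter> T"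
      by (rule bexI[OF _ basic_nbhds_Int[OF N(1) M(1)]]) (use N(2) M(2) in blast)
  qed
  have Un: "?O (\<Union>\<U>)" if "\<forall>U\<in>\<U>. ?O U" for \<U>
  proof (intro conjI ballI)
    show "\<Union>\<U> \<subseteq> kspace \<A>" using that by blast
    fix p assume "p \<in> \<Union>\<U>"
    then obtain U where U: "U \<in> \<U>" "p \<in> U" by blast
    with that obtain N where N: "N \<in> basic_nbhds \<A> p" "N \<subseteq> U" by blast
    show "\<exists>N\<in>basic_nbhds \<A> p. N \<subseteq> \<Union>\<U>"
      by (rule bexI[OF _ N(1)]) (use N(2) U(1) in blast)
  qed
  have "\<forall>S T. ?O S \<longrightarrow> ?O T \<longrightarrow> ?O (S \<inter> T)"
    by (intro allI impI, rule Int)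
  moreover have "\<forall>\<U>. (\<forall>U\<in>\<U>. ?O U) \<longrightarrow> ?O (\<Union>\<U>)"
    by (intro allI impI, rule Un)
  ultimately have "istopology ?O" unfolding istopology_def by (rule conjI)
  then show ?thesis unfolding ktopology_def by (simp only: topology_inverse')
qed

lemma topspace_ktopology [simp]: "topspace (ktopology \<A>) = kspace \<A>"
proof -
  have "\<exists>N\<in>basic_nbhds \<A> p. N \<subseteq> kspace \<A>" if "p \<in> kspace \<A>" for p
  proof (cases p)
    case (Pt x)
    then show ?thesis using that by simp
  next
    case (Lim A)
    then have "{Lim A} \<union> Pt ` (A - {}) \<subseteq> kspace \<A>" using that by (auto simp: kspace_def)
    then show ?thesis unfolding Lim basic_nbhds.simps by blast
  next
    case Infty
    have "kspace \<A> - (\<Union>A\<in>{}. {Lim A} \<union> Pt ` A) \<in> basic_nbhds \<A> p"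
      unfolding Infty basic_nbhds.simps by blast
    then show ?thesis by blast
  qed
  then have "openin (ktopology \<A>) (kspace \<A>)" unfolding openin_ktopology by blast
  then show ?thesis
    by (metis openin_ktopology openin_subset openin_topspace subset_antisym)
qed


section \<open>The Banach space \<open>C(K)\<close>\<close>

text \<open>
  Since the space depends on the family, \<open>C(K)\<close> cannot be the type of bounded continuous functions
  on a topological type. It is instead a closed subspace of the Banach space of all bounded
  real functions (bounded continuous functions on the discrete copy of the underlying type), whose
  norm is the supremum norm. Functions are made 0 outside \<open>K\<close>, so that an element is
  determined by its restriction to \<open>K\<close> and its norm is the supremum over \<open>K\<close>.
  For compact \<open>K\<close> boundedness is no restriction.
\<close>

definition C_space :: "'k topology \<Rightarrow> ('k discrete \<Rightarrow>\<^sub>C real) set" where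
  "C_space K = {f. continuous_map K euclideanreal (\<lambda>x. apply_bcontfun f (discrete x)) \<and>
                   (\<forall>x. x \<notin> topspace K \<longrightarrow> apply_bcontfun f (discrete x) = 0)}"

lemma subspace_C_space: "subspace (C_space K)"
  unfolding subspace_def C_space_def
  by (auto intro!: continuous_map_add continuous_map_real_mult)

lemma closed_C_space: "closed (C_space K)"
  unfolding closed_sequential_limits
proof (intro allI impI, elim conjE)
  fix f :: "nat \<Rightarrow> ('a discrete \<Rightarrow>\<^sub>C real)" and g
  assume f: "\<forall>n. f n \<in> C_space K" and lim: "f \<longlonglongrightarrow> g"
  have pt: "\<bar>f n (discrete x) - g (discrete x)\<bar> \<le> dist (f n) g" for n x
    using dist_bounded[of "f n" "discrete x" g] by (simp add: dist_real_def)
  have "continuous_map K euclideanreal (\<lambda>x. g (discrete x))"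
  proof (rule Met_TC.continuous_map_uniform_limit[where F = sequentially and
        f = "\<lambda>n x. f n (discrete x)", unfolded mtopology_is_euclidean])
    show "\<forall>\<^sub>F n in sequentially. continuous_map K euclidean (\<lambda>x. f n (discrete x))"
      using f by (simp add: C_space_def)
    show "\<forall>\<^sub>F n in sequentially. \<forall>x\<in>topspace K. g (discrete x) \<in> UNIV \<and>
        dist (f n (discrete x)) (g (discrete x)) < e" if "0 < e" for e
      using tendstoD[OF lim that] pt
      by (auto elim!: eventually_mono simp: dist_real_def intro: le_less_trans)
  qed auto
  moreover have "g (discrete x) = 0" if "x \<notin> topspace K" for x
  proof -
    have "(\<lambda>n. dist (f n) g) \<longlonglongrightarrow> 0" using lim tendsto_dist_iff by blast
    then have "\<bar>g (discrete x)\<bar> \<le> 0"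
      using pt[of _ x] f that by (intro LIMSEQ_le_const) (auto simp: C_space_def)
    then show ?thesis by simp
  qed
  ultimately show "g \<in> C_space K" by (simp add: C_space_def)
qed


section \<open>Operators and functionals on a Banach space\<close>

text \<open>
  Throughout, \<open>E\<close> is a closed linear subspace of a Banach space given as a type, regarded
  as a Banach space in its own right: operators on \<open>E\<close> and the dual of \<open>E\<close> only see vectors
  of \<open>E\<close>.
\<close>

definition bounded_linear_on ::
    "'e::real_normed_vector set \<Rightarrow> ('e \<Rightarrow> 'f::real_normed_vector) \<Rightarrow> bool" where
  "bounded_linear_on E T \<longleftrightarrow>
     (\<forall>x\<in>E. \<forall>y\<in>E. T (x + y) = T x + T y) \<and>
     (\<forall>c. \<forall>x\<in>E. T (c *\<^sub>R x) = c *\<^sub>R T x) \<and>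
     (\<exists>B. \<forall>x\<in>E. norm (T x) \<le> norm x * B)"

definition onorm_on ::
    "'e::real_normed_vector set \<Rightarrow> ('e \<Rightarrow> 'f::real_normed_vector) \<Rightarrow> real" where
  "onorm_on E T = (SUP x\<in>E. norm (T x) / norm x)"

definition projection_on :: "'e::real_normed_vector set \<Rightarrow> ('e \<Rightarrow> 'e) \<Rightarrow> bool" where
  "projection_on E P \<longleftrightarrow> bounded_linear_on E P \<and> P ` E \<subseteq> E \<and> (\<forall>x\<in>E. P (P x) = P x)"

definition complemented_in :: "'e::real_normed_vector set \<Rightarrow> 'e set \<Rightarrow> bool" where
  "complemented_in E F \<longleftrightarrow> (\<exists>P. projection_on E P \<and> P ` E = F)"

text \<open>Functionals are made 0 outside \<open>E\<close>, so that equal functionals on \<open>E\<close> are equal functions.\<close>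

definition dual_space :: "'e::real_normed_vector set \<Rightarrow> ('e \<Rightarrow> real) set" where
  "dual_space E = {\<phi>. bounded_linear_on E \<phi> \<and> (\<forall>x. x \<notin> E \<longrightarrow> \<phi> x = 0)}"

definition dual_subspace :: "'e::real_normed_vector set \<Rightarrow> ('e \<Rightarrow> real) set \<Rightarrow> bool" where
  "dual_subspace E G \<longleftrightarrow> G \<subseteq> dual_space E \<and> (\<lambda>x. 0) \<in> G \<and>
     (\<forall>\<phi>\<in>G. \<forall>\<psi>\<in>G. (\<lambda>x. \<phi> x + \<psi> x) \<in> G) \<and> (\<forall>c. \<forall>\<phi>\<in>G. (\<lambda>x. c * \<phi> x) \<in> G)"

definition dual_dist ::
    "'e::real_normed_vector set \<Rightarrow> ('e \<Rightarrow> real) \<Rightarrow> ('e \<Rightarrow> real) \<Rightarrow> real" where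
  "dual_dist E \<phi> \<psi> = onorm_on E (\<lambda>x. \<phi> x - \<psi> x)"

definition dual_separable :: "'e::real_normed_vector set \<Rightarrow> ('e \<Rightarrow> real) set \<Rightarrow> bool" where
  "dual_separable E G \<longleftrightarrow>
     (\<exists>D. countable D \<and> D \<subseteq> G \<and> (\<forall>\<phi>\<in>G. \<forall>e>0. \<exists>\<psi>\<in>D. dual_dist E \<phi> \<psi> < e))"

definition adjoint_on ::
    "'e::real_normed_vector set \<Rightarrow> ('e \<Rightarrow> 'e) \<Rightarrow> ('e \<Rightarrow> real) \<Rightarrow> ('e \<Rightarrow> real)" where
  "adjoint_on E P \<phi> = (\<lambda>x. if x \<in> E then \<phi> (P x) else 0)"


section \<open>Separable complementation properties\<close>

definition controlled_SCP :: "'e::real_normed_vector set \<Rightarrow> bool" where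
  "controlled_SCP E \<longleftrightarrow>
     (\<forall>F G. subspace F \<and> F \<subseteq> E \<and> separable_space (top_of_set F) \<and>
            dual_subspace E G \<and> dual_separable E G \<longrightarrow>
        (\<exists>P. projection_on E P \<and> F \<subseteq> P ` E \<and> G \<subseteq> adjoint_on E P ` dual_space E \<and>
             separable_space (top_of_set (P ` E))))"

definition skeleton :: "'e::real_normed_vector set \<Rightarrow> 'e set set \<Rightarrow> bool" where
  "skeleton E \<F> \<longleftrightarrow>
     (\<forall>F\<in>\<F>. separable_space (top_of_set F) \<and> complemented_in E F) \<and>
     E = \<Union>\<F> \<and>
     (\<forall>F\<in>\<F>. \<forall>G\<in>\<F>. \<exists>H\<in>\<F>. F \<subseteq> H \<and> G \<subseteq> H) \<and>
     (\<forall>S :: nat \<Rightarrow> 'e set. (\<forall>n. S n \<in> \<F> \<and> S n \<subseteq> S (Suc n)) \<longrightarrow> closure (\<Union>n. S n) \<in> \<F>)"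

definition continuous_SCP :: "'e::real_normed_vector set \<Rightarrow> bool" where
  "continuous_SCP E \<longleftrightarrow> (\<exists>\<F>. skeleton E \<F>)"

definition has_projectional_skeleton :: "'e::real_normed_vector set \<Rightarrow> bool" where
  "has_projectional_skeleton E \<longleftrightarrow>
     (\<exists>\<F> P. skeleton E \<F> \<and>
        (\<forall>F\<in>\<F>. projection_on E (P F) \<and> P F ` E = F) \<and>
        (\<forall>F\<in>\<F>. \<forall>G\<in>\<F>. F \<subseteq> G \<longrightarrow>
           (\<forall>x\<in>E. P F (P G x) = P F x \<and> P G (P F x) = P F x)))"


section \<open>Projectional resolutions of the identity\<close>

definition dense_subset :: "'e::topological_space set \<Rightarrow> 'e set \<Rightarrow> bool" where
  "dense_subset S D \<longleftrightarrow> D \<subseteq> S \<and> S \<subseteq> closure D"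

definition density_le :: "'e::topological_space set \<Rightarrow> 'b rel \<Rightarrow> bool" where
  "density_le S r \<longleftrightarrow> (\<exists>D. dense_subset S D \<and> |D| \<le>o r)"

text \<open>
  Cardinals are initial well-orders, as in the cardinal library; \<open>has_density S \<kappa>\<close> says that
  \<open>\<kappa>\<close> is the least cardinality of a dense subset of \<open>S\<close>.
\<close>

definition has_density :: "'e::topological_space set \<Rightarrow> 'e rel \<Rightarrow> bool" where
  "has_density S \<kappa> \<longleftrightarrow> Card_order \<kappa> \<and>
     density_le S \<kappa> \<and> (\<forall>D. dense_subset S D \<longrightarrow> \<kappa> \<le>o |D| )"

lemma has_density_exists: "\<exists>\<kappa>. has_density S \<kappa>"
proof -
  let ?R = "{|D| | D. dense_subset S D}"
  have "dense_subset S S" by (simp add: dense_subset_def closure_subset)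
  then have "?R \<noteq> {}" by blast
  moreover have "\<forall>r\<in>?R. Card_order r" using card_of_Card_order by blast
  ultimately obtain r where "r \<in> ?R" "\<forall>r'\<in>?R. r \<le>o r'"
    using exists_minim_Card_order[of ?R] by blast
  then obtain D where "dense_subset S D" "\<forall>D'. dense_subset S D' \<longrightarrow> |D| \<le>o |D'|"
    by auto
  then have "has_density S |D|"
    unfolding has_density_def density_le_def using card_of_Card_order by fast
  then show ?thesis ..
qed

text \<open>
  An ordinal \<open>\<alpha> \<le> \<kappa>\<close> is represented, in the manner of von Neumann, by the initial segment of the
  well-order \<open>\<kappa>\<close> of type \<open>\<alpha>\<close>, i.e. by an order filter in the sense of \<open>ofilter\<close> (a
  downward closed subset of the field). Thus \<open>\<kappa>\<close> itself is \<open>Field \<kappa>\<close>, \<open>\<le>\<close> is inclusion,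
  \<open>min(\<alpha>,\<beta>)\<close> is the intersection, and limit ordinals are the nonempty segments without
  a greatest element.
\<close>

definition limit_segment :: "'i rel \<Rightarrow> 'i set \<Rightarrow> bool" where
  "limit_segment r I \<longleftrightarrow> ofilter r I \<and> I \<noteq> {} \<and> (\<forall>a\<in>I. \<exists>b\<in>I. a \<noteq> b \<and> (a, b) \<in> r)"

definition PRI :: "'e::real_normed_vector set \<Rightarrow> 'i rel \<Rightarrow> ('i set \<Rightarrow> 'e \<Rightarrow> 'e) \<Rightarrow> bool" where
  "PRI E \<kappa> P \<longleftrightarrow>
     (\<forall>\<alpha>. ofilter \<kappa> \<alpha> \<longrightarrow> projection_on E (P \<alpha>) \<and> onorm_on E (P \<alpha>) = 1) \<and>
     (\<forall>x\<in>E. P (Field \<kappa>) x = x) \<and>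
     (\<forall>\<alpha> \<beta>. ofilter \<kappa> \<alpha> \<and> ofilter \<kappa> \<beta> \<longrightarrow>
        (\<forall>x\<in>E. P \<alpha> (P \<beta> x) = P (\<alpha> \<inter> \<beta>) x \<and> P \<beta> (P \<alpha> x) = P (\<alpha> \<inter> \<beta>) x)) \<and>
     (\<forall>\<alpha>. ofilter \<kappa> \<alpha> \<and> \<alpha> \<noteq> Field \<kappa> \<longrightarrow> density_le (P \<alpha> ` E) ( |\<alpha>| +c natLeq)) \<and>
     (\<forall>\<mu>. limit_segment \<kappa> \<mu> \<longrightarrow>
        P \<mu> ` E = closure (\<Union>\<alpha>\<in>{\<alpha>. ofilter \<kappa> \<alpha> \<and> \<alpha> \<subset> \<mu>}. P \<alpha> ` E))"

definition has_PRI :: "'e::real_normed_vector set \<Rightarrow> bool" where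
  "has_PRI E \<longleftrightarrow> (\<exists>\<kappa> P. has_density E \<kappa> \<and> PRI E \<kappa> P)"

end

theory Submission
  imports Defs "HOL-Library.Countable_Set_Type"
begin

text \<open>
  The family is a ladder system on \<open>\<omega>\<^sub>1\<close>: every limit ordinal \<open>\<delta> < \<omega>\<^sub>1\<close> carries an infinite set
  \<open>L\<^sub>\<delta> \<subseteq> \<delta>\<close> that meets each \<open>\<beta> < \<delta>\<close> in a finite set, and \<open>\<A>\<close> consists of all the \<open>L\<^sub>\<delta>\<close>. Let
  \<open>l\<^sub>\<delta>\<close> be the limit point of \<open>L\<^sub>\<delta>\<close> and let \<open>G\<^sub>\<alpha>\<close> be the space of all \<open>f \<in> C(K\<^sub>\<A>)\<close> that equal the
  constant \<open>f(\<infinity>)\<close> off the countable set \<open>U\<^sub>\<alpha> = \<alpha> \<union> {l\<^sub>\<delta> | \<delta> < \<alpha>}\<close>. Each \<open>G\<^sub>\<alpha>\<close> is separable, the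
  \<open>G\<^sub>\<alpha>\<close> increase continuously, and they exhaust \<open>C(K\<^sub>\<A>)\<close>. In the formal text \<open>l\<^sub>\<delta>\<close>, \<open>U\<^sub>\<alpha>\<close> and \<open>G\<^sub>\<alpha>\<close> are
  \<open>limit_of \<delta>\<close>, \<open>below \<alpha>\<close> and \<open>C_below \<alpha>\<close>.

  Continuous property. The chain \<open>(G\<^sub>\<alpha>)\<close> is itself a skeleton, because every \<open>G\<^sub>\<alpha>\<close> is
  complemented. The set \<open>U\<^sub>\<alpha> \<union> {l\<^sub>\<alpha>}\<close> is open and \<open>\<infinity>\<close> is its only possible boundary point, so replacing \<open>f\<close>
  by \<open>f(\<infinity>)\<close> off this set gives a continuous function; subtracting the multiple
  \<open>(f(l\<^sub>\<alpha>) - f(\<infinity>))\<close> of the indicator \<open>h\<^sub>\<alpha>\<close> of \<open>L\<^sub>\<alpha> \<union> {l\<^sub>\<alpha>}\<close> then moves it into \<open>G\<^sub>\<alpha>\<close>. These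
  projections need not be compatible: for \<open>\<alpha> < \<beta>\<close>, subtracting a multiple of \<open>h\<^sub>\<beta>\<close> also changes values at
  the finitely many points of \<open>L\<^sub>\<beta> \<inter> \<alpha>\<close>.

  Controlled property. A bounded functional lives on countably many points, hence on
  \<open>U\<^sub>\<alpha> \<union> {\<infinity>}\<close> for some \<open>\<alpha>\<close>, and so does a separable set of functionals
  (\<open>functional_supported\<close>). A separable subspace lies in some \<open>G\<^sub>\<alpha>\<close>. If moreover \<open>\<alpha>\<close> is chosen not
  to be a limit, then there is no \<open>l\<^sub>\<alpha>\<close> and plain truncation is the required projection.

  No projectional skeleton. Given one, a back-and-forth argument shows that \<open>G\<^sub>\<alpha>\<close> belongs to it for
  an unbounded set of \<open>\<alpha>\<close> closed under suprema of sequences, and for a smaller set of this kind the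
  projections \<open>P\<^sub>\<alpha>\<close> onto \<open>G\<^sub>\<alpha>\<close> are uniformly bounded; then \<open>P\<^sub>\<alpha> f \<longlonglongrightarrow> P\<^sub>\<sigma> f\<close> as \<open>\<alpha>\<close> increases to \<open>\<sigma>\<close> along a
  sequence. Since each \<open>P\<^sub>\<alpha>\<close> sees only countably many points, for unboundedly many \<open>\<alpha>\<close> the operator
  \<open>P\<^sub>\<alpha>\<close> ignores functions that vanish on \<open>U\<^sub>\<alpha> \<union> {l\<^sub>\<alpha>, \<infinity>}\<close>. For such \<open>\<alpha>\<close> the values \<open>P\<^sub>\<alpha> f\<close> and
  \<open>f\<close> differ on \<open>\<alpha>\<close> by at most a constant times \<open>|f(l\<^sub>\<alpha>) - f(\<infinity>)|\<close> (\<open>local_stage_deviation\<close>). Along a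
  strictly increasing sequence of such \<open>\<alpha>\<close> the points \<open>l\<^sub>\<alpha>\<close> converge to \<open>\<infinity>\<close>, so for its supremum
  \<open>\<sigma>\<close> the projection satisfies \<open>P\<^sub>\<sigma> f = f\<close> on all of \<open>\<sigma>\<close>. Apply this to \<open>h\<^sub>\<sigma>\<close>: the function
  \<open>P\<^sub>\<sigma> h\<^sub>\<sigma> \<in> G\<^sub>\<sigma>\<close> is \<open>1\<close> on \<open>L\<^sub>\<sigma>\<close>, hence at \<open>l\<^sub>\<sigma>\<close>, hence at \<open>\<infinity>\<close>; but it is \<open>0\<close> at the points
  \<open>l\<^sub>\<alpha>\<close> of the sequence, which converge to \<open>\<infinity>\<close>. The argument needs a ladder at the ordinal \<open>\<sigma>\<close>,
  and this is guaranteed because every limit ordinal carries one.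

  No projectional resolution. The density of \<open>C(K\<^sub>\<A>)\<close> is \<open>\<omega>\<^sub>1\<close>, and over \<open>\<omega>\<^sub>1\<close> the images of a
  projectional resolution form a projectional skeleton (\<open>PRI_imp_projectional_skeleton\<close>).
\<close>

section \<open>Separability, projections and skeletons in Banach spaces\<close>

lemma separable_top_of_set_iff:
  "separable_space (top_of_set S) \<longleftrightarrow> (\<exists>D. countable D \<and> D \<subseteq> S \<and> S \<subseteq> closure D)"
proof -
  have "top_of_set S closure_of D = S \<longleftrightarrow> S \<subseteq> closure D" if "D \<subseteq> S" for D
    using that by (auto simp: closure_of_subtopology Int_absorb1)
  then show ?thesis unfolding separable_space_def by auto
qed

text \<open>
  The rational combinations of \<open>B\<close> form a countable set whose closure is a subspace. They are indexed
  by lists over \<open>\<rat> \<times> B\<close>, with repetitions allowed, so that concatenation of lists gives sums.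
\<close>

lemma separable_closure_span:
  fixes B :: "'e::real_normed_vector set"
  assumes "countable B"
  shows "separable_space (top_of_set (closure (span B)))"
proof -
  define D where "D = {\<Sum>i<length xs. of_rat (fst (xs ! i)) *\<^sub>R snd (xs ! i) | xs. set xs \<subseteq> UNIV \<times> B}"
  have D: "D = (\<lambda>xs. \<Sum>i<length xs. of_rat (fst (xs ! i)) *\<^sub>R snd (xs ! i)) ` lists (UNIV \<times> B)"
    unfolding D_def by (auto simp: lists_eq_set)
  have cD: "countable D" unfolding D using assms by auto
  have Dsub: "D \<subseteq> span B"
  proof
    fix d assume "d \<in> D"
    then obtain xs :: "(rat \<times> 'e) list" where xs: "set xs \<subseteq> UNIV \<times> B"
      "d = (\<Sum>i<length xs. of_rat (fst (xs ! i)) *\<^sub>R snd (xs ! i))" unfolding D_def by blast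
    have "snd (xs ! i) \<in> B" if "i < length xs" for i
      using xs(1) nth_mem[OF that] by (metis mem_Times_iff subsetD)
    then show "d \<in> span B" unfolding xs(2)
      by (intro span_sum span_scale span_base) auto
  qed
  have D0: "0 \<in> D" unfolding D_def by (intro CollectI exI[of _ "[]"]) auto
  have Dadd: "x + y \<in> D" if "x \<in> D" "y \<in> D" for x y
  proof -
    from that obtain xs ys :: "(rat \<times> 'e) list" where xs: "set xs \<subseteq> UNIV \<times> B" "set ys \<subseteq> UNIV \<times> B"
      "x = (\<Sum>i<length xs. of_rat (fst (xs ! i)) *\<^sub>R snd (xs ! i))"
      "y = (\<Sum>i<length ys. of_rat (fst (ys ! i)) *\<^sub>R snd (ys ! i))" unfolding D_def by blast
    have split: "{..<length xs + length ys} = {..<length xs} \<union> (\<lambda>i. length xs + i) ` {..<length ys}"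
      using image_add_atLeastLessThan[of "length xs" 0 "length ys"]
        ivl_disj_un_two(3)[of 0 "length xs" "length xs + length ys"] by (simp add: lessThan_atLeast0 add.commute)
    have "(\<Sum>i<length (xs @ ys). of_rat (fst ((xs @ ys) ! i)) *\<^sub>R snd ((xs @ ys) ! i)) = x + y"
      unfolding length_append split
      by (subst sum.union_disjoint) (auto simp: sum.reindex nth_append xs(3,4))
    then show ?thesis unfolding D_def using xs(1,2)
      by (intro CollectI exI[of _ "xs @ ys"]) auto
  qed
  have Dsc: "of_rat q *\<^sub>R x \<in> D" if "x \<in> D" for x q
  proof -
    from that obtain xs :: "(rat \<times> 'e) list" where xs: "set xs \<subseteq> UNIV \<times> B"
      "x = (\<Sum>i<length xs. of_rat (fst (xs ! i)) *\<^sub>R snd (xs ! i))" unfolding D_def by blast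
    have "(\<Sum>i<length (map (apfst ((*) q)) xs). of_rat (fst (map (apfst ((*) q)) xs ! i)) *\<^sub>R
        snd (map (apfst ((*) q)) xs ! i)) = of_rat q *\<^sub>R x"
      by (simp add: xs(2) scaleR_sum_right of_rat_mult)
    then show ?thesis unfolding D_def using xs(1)
      by (intro CollectI exI[of _ "map (apfst ((*) q)) xs"]) auto
  qed
  have "subspace (closure D)"
    unfolding subspace_def
  proof (intro conjI ballI allI)
    show "0 \<in> closure D" using D0 closure_subset by blast
    fix x y assume "x \<in> closure D" "y \<in> closure D"
    then obtain f g where fg: "\<And>n::nat. f n \<in> D" "f \<longlonglongrightarrow> x" "\<And>n::nat. g n \<in> D" "g \<longlonglongrightarrow> y"
      unfolding closure_sequential by blast
    then show "x + y \<in> closure D"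
      unfolding closure_sequential using Dadd by (intro exI[of _ "\<lambda>n. f n + g n"]) (auto intro: tendsto_add)
  next
    fix c :: real and x assume "x \<in> closure D"
    then obtain f where f: "\<And>n::nat. f n \<in> D" "f \<longlonglongrightarrow> x"
      unfolding closure_sequential by blast
    have "c \<in> closure \<rat>" by (simp add: Rats_closure_real)
    then obtain q where q: "\<And>n::nat. q n \<in> \<rat>" "q \<longlonglongrightarrow> c" unfolding closure_sequential by blast
    have "\<forall>n. \<exists>z. q n = of_rat z" using q(1) unfolding Rats_def by blast
    then obtain r where r: "\<And>n. q n = of_rat (r n)" using choice by meson
    show "c *\<^sub>R x \<in> closure D"
      unfolding closure_sequential
    proof (intro exI[of _ "\<lambda>n. q n *\<^sub>R f n"] conjI allI)
      show "q n *\<^sub>R f n \<in> D" for n unfolding r using Dsc[OF f(1)] .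
      show "(\<lambda>n. q n *\<^sub>R f n) \<longlonglongrightarrow> c *\<^sub>R x" using q(2) f(2) by (rule tendsto_scaleR)
    qed
  qed
  moreover have "B \<subseteq> D"
  proof
    fix b assume "b \<in> B"
    then have "set [(1::rat, b)] \<subseteq> UNIV \<times> B" by simp
    moreover have "b = (\<Sum>i<length [(1::rat, b)]. of_rat (fst ([(1, b)] ! i)) *\<^sub>R snd ([(1, b)] ! i))"
      by simp
    ultimately show "b \<in> D" unfolding D_def by blast
  qed
  ultimately have "span B \<subseteq> closure D"
    using closure_subset by (intro span_minimal) auto
  then have "closure (span B) \<subseteq> closure D" by (simp add: closure_minimal)
  then show ?thesis unfolding separable_top_of_set_iff
    using cD Dsub closure_subset by blast
qed

lemma bounded_linear_onD:
  assumes "bounded_linear_on E T"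
  shows "\<And>x y. x \<in> E \<Longrightarrow> y \<in> E \<Longrightarrow> T (x + y) = T x + T y"
    and "\<And>x c. x \<in> E \<Longrightarrow> T (c *\<^sub>R x) = c *\<^sub>R T x"
  using assms unfolding bounded_linear_on_def by auto

lemma bounded_linear_on_diff:
  assumes "bounded_linear_on E T" "subspace E" "x \<in> E" "y \<in> E"
  shows "T (x - y) = T x - T y"
proof -
  have "T (x + (-1) *\<^sub>R y) = T x + (-1) *\<^sub>R T y"
    using assms bounded_linear_onD[OF assms(1)] by (metis subspace_scale)
  then show ?thesis by simp
qed

lemma bounded_linear_on_bound:
  assumes "bounded_linear_on E T"
  obtains B where "0 \<le> B" "\<And>x. x \<in> E \<Longrightarrow> norm (T x) \<le> B * norm x"
proof -
  obtain B where B: "\<And>x. x \<in> E \<Longrightarrow> norm (T x) \<le> norm x * B"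
    using assms unfolding bounded_linear_on_def by blast
  have "norm (T x) \<le> max 0 B * norm x" if "x \<in> E" for x
    using B[OF that] mult_left_mono[of B "max 0 B" "norm x"] by (simp add: mult.commute)
  then show ?thesis by (intro that[of "max 0 B"]) auto
qed

text \<open>
  The supremum that defines the norm is bounded above, so it is a true operator norm on \<open>E\<close>. At
  \<open>x = 0\<close> the quotient takes the default value 0 and homogeneity of \<open>T\<close> is used instead.
\<close>

lemma norm_le_onorm_on:
  assumes "bounded_linear_on E T" "x \<in> E"
  shows "norm (T x) \<le> onorm_on E T * norm x"
proof (cases "x = 0")
  case True
  have "T (0 *\<^sub>R x) = 0 *\<^sub>R T x" using bounded_linear_onD(2)[OF assms(1,2)] by blast
  then show ?thesis using True by simp
next
  case False
  obtain B where B: "0 \<le> B" "\<And>x. x \<in> E \<Longrightarrow> norm (T x) \<le> B * norm x"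
    using bounded_linear_on_bound[OF assms(1)] by blast
  have "bdd_above ((\<lambda>x. norm (T x) / norm x) ` E)"
  proof (rule bdd_aboveI2[of _ _ B])
    fix x assume "x \<in> E"
    then show "norm (T x) / norm x \<le> B"
      using B by (cases "x = 0") (auto simp: divide_simps)
  qed
  then have "norm (T x) / norm x \<le> onorm_on E T"
    unfolding onorm_on_def using assms(2) by (rule cSUP_upper2) auto
  then show ?thesis using False by (simp add: divide_simps)
qed

lemma projection_on_fixes_image:
  assumes "projection_on E P" "x \<in> P ` E"
  shows "P x = x"
  using assms unfolding projection_on_def by auto

text \<open>
  The image is the fixed point set of a continuous map.
\<close>

lemma closed_projection_image:
  assumes "projection_on E P" "closed E" "subspace E"
  shows "closed (P ` E)"
  unfolding closed_sequential_limits
proof (intro allI impI, elim conjE)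
  fix f x assume f: "\<forall>n. f n \<in> P ` E" and lim: "f \<longlonglongrightarrow> x"
  have bl: "bounded_linear_on E P" and PE: "P ` E \<subseteq> E" using assms(1) by (auto simp: projection_on_def)
  have fE: "f n \<in> E" for n using f PE by auto
  have xE: "x \<in> E" using closed_sequentially[OF assms(2)] fE lim by blast
  obtain B where B: "0 \<le> B" "\<And>x. x \<in> E \<Longrightarrow> norm (P x) \<le> B * norm x"
    using bounded_linear_on_bound[OF bl] by blast
  have "norm (f n - P x) \<le> B * norm (f n - x)" for n
  proof -
    have "P (f n - x) = f n - P x"
      using bounded_linear_on_diff[OF bl assms(3) fE xE] projection_on_fixes_image[OF assms(1) f[rule_format]]
      by simp
    then show ?thesis using B(2)[OF subspace_diff[OF assms(3) fE xE]] by metis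
  qed
  moreover have "(\<lambda>n. B * norm (f n - x)) \<longlonglongrightarrow> 0"
    using tendsto_mult_right_zero[OF tendsto_norm_zero[OF LIM_zero[OF lim]]] .
  ultimately have "(\<lambda>n. f n - P x) \<longlonglongrightarrow> 0"
    by (metis (no_types, lifting) Lim_null_comparison eventually_sequentiallyI)
  then have "f \<longlonglongrightarrow> P x" by (rule LIM_zero_cancel)
  then have "x = P x" using lim LIMSEQ_unique by blast
  then show "x \<in> P ` E" using xE by blast
qed

text \<open>
  A dense sequence is swallowed one term at a time by directedness; the closure of the resulting
  chain lies in the skeleton and contains the whole separable set.
\<close>

lemma skeleton_absorbs:
  assumes sk: "skeleton E \<H>" and H: "H \<in> \<H>" and F: "separable_space (top_of_set F)" "F \<subseteq> E"
  shows "\<exists>H'\<in>\<H>. H \<subseteq> H' \<and> F \<subseteq> H'"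
proof -
  have cov: "E = \<Union>\<H>" and dir: "\<And>A B. A \<in> \<H> \<Longrightarrow> B \<in> \<H> \<Longrightarrow> \<exists>C\<in>\<H>. A \<subseteq> C \<and> B \<subseteq> C"
    and cl: "\<And>S :: nat \<Rightarrow> _. (\<forall>n. S n \<in> \<H> \<and> S n \<subseteq> S (Suc n)) \<Longrightarrow> closure (\<Union>n. S n) \<in> \<H>"
    using sk unfolding skeleton_def by simp_all
  obtain D where D: "countable D" "D \<subseteq> F" "F \<subseteq> closure D"
    using F(1) unfolding separable_top_of_set_iff by blast
  show ?thesis
  proof (cases "D = {}")
    case True
    then have "F = {}" using D(3) by simp
    then show ?thesis using H by blast
  next
    case False
    define d where "d = from_nat_into D"
    have d: "range d = D" unfolding d_def using range_from_nat_into[OF False D(1)] .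
    have "\<exists>S. \<forall>n::nat. (S n \<in> \<H> \<and> H \<subseteq> S n) \<and> (S n \<subseteq> S (Suc n) \<and> d n \<in> S (Suc n))"
    proof (rule dependent_nat_choice)
      show "\<exists>S. S \<in> \<H> \<and> H \<subseteq> S" using H by blast
      fix S and n :: nat assume S: "S \<in> \<H> \<and> H \<subseteq> S"
      have "d n \<in> D" using d by blast
      then have "d n \<in> \<Union>\<H>" using D(2) F(2) cov by blast
      then obtain B where B: "B \<in> \<H>" "d n \<in> B" by blast
      then obtain C where "C \<in> \<H>" "S \<subseteq> C" "B \<subseteq> C" using dir S by blast
      then show "\<exists>C. (C \<in> \<H> \<and> H \<subseteq> C) \<and> (S \<subseteq> C \<and> d n \<in> C)" using S B(2) by blast
    qed
    then obtain S where S: "\<forall>n::nat. (S n \<in> \<H> \<and> H \<subseteq> S n) \<and> (S n \<subseteq> S (Suc n) \<and> d n \<in> S (Suc n))" ..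
    then have "closure (\<Union>n. S n) \<in> \<H>" by (intro cl) simp
    moreover have "H \<subseteq> (\<Union>n. S n)" using S by blast
    then have "H \<subseteq> closure (\<Union>n. S n)" by (rule order_trans[OF _ closure_subset])
    moreover have "D \<subseteq> (\<Union>n. S n)" unfolding d[symmetric] using S by blast
    then have "F \<subseteq> closure (\<Union>n. S n)" by (rule order_trans[OF D(3) closure_mono])
    ultimately show ?thesis by blast
  qed
qed

text \<open>
  When \<open>\<kappa>\<close> has order type \<open>\<omega>\<^sub>1\<close>, the images \<open>P \<alpha> ` E\<close> of the proper initial segments are separable,
  and they are closed under limits of sequences because a countable union of countable segments is
  again proper. Continuity of the resolution at such a union, and at \<open>\<kappa>\<close> itself, gives the closure
  property of a skeleton and the exhaustion of \<open>E\<close>.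
\<close>

lemma PRI_imp_projectional_skeleton:
  fixes \<kappa> :: "'i rel"
  assumes E: "closed E" "subspace E"
    and \<kappa>: "Card_order \<kappa>" "uncountable (Field \<kappa>)"
    and seg: "\<And>\<alpha>. ofilter \<kappa> \<alpha> \<Longrightarrow> \<alpha> \<noteq> Field \<kappa> \<Longrightarrow> countable \<alpha>"
    and PRI: "PRI E \<kappa> P"
  shows "has_projectional_skeleton E"
proof -
  interpret wo_rel \<kappa> using \<kappa>(1) by (simp add: card_order_on_well_order_on wo_rel_def)
  define I where "I = {\<alpha>. ofilter \<alpha> \<and> \<alpha> \<noteq> Field \<kappa>}"
  have proj: "projection_on E (P \<alpha>)" if "ofilter \<alpha>" for \<alpha>
    using PRI that unfolding PRI_def by blast
  have comm: "P \<alpha> (P \<beta> x) = P (\<alpha> \<inter> \<beta>) x" "P \<beta> (P \<alpha> x) = P (\<alpha> \<inter> \<beta>) x"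
    if "ofilter \<alpha>" "ofilter \<beta>" "x \<in> E" for \<alpha> \<beta> x
    using PRI that unfolding PRI_def by blast+
  have lim: "P \<mu> ` E = closure (\<Union>\<alpha>\<in>{\<alpha>. ofilter \<alpha> \<and> \<alpha> \<subset> \<mu>}. P \<alpha> ` E)" if "limit_segment \<kappa> \<mu>" for \<mu>
    using PRI that unfolding PRI_def by blast
  have clos: "closed (P \<alpha> ` E)" if "ofilter \<alpha>" for \<alpha>
    using closed_projection_image[OF proj[OF that] E] .
  have mono: "P \<alpha> ` E \<subseteq> P \<beta> ` E" if "ofilter \<alpha>" "ofilter \<beta>" "\<alpha> \<subseteq> \<beta>" for \<alpha> \<beta>
  proof
    fix y assume "y \<in> P \<alpha> ` E"
    then obtain x where x: "x \<in> E" "y = P \<alpha> x" by blast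
    have "P \<beta> (P \<alpha> x) = P \<alpha> x" using comm(2)[OF that(1,2) x(1)] that(3) by (simp add: Int_absorb2)
    moreover have "P \<alpha> x \<in> E" using proj[OF that(1)] x(1) unfolding projection_on_def by blast
    ultimately show "y \<in> P \<beta> ` E" unfolding x(2) by (metis imageI)
  qed
  have lin: "\<alpha> \<subseteq> \<beta> \<or> \<beta> \<subseteq> \<alpha>" if "ofilter \<alpha>" "ofilter \<beta>" for \<alpha> \<beta>
    using ofilter_linord[OF that] .
  have cun: "(\<Union>n. \<alpha> n) \<in> I" if "\<And>n::nat. \<alpha> n \<in> I" for \<alpha>
  proof -
    have "countable (\<Union>n. \<alpha> n)" using that seg by (auto simp: I_def)
    then show ?thesis using \<kappa>(2) ofilter_UNION[of UNIV \<alpha>] that by (auto simp: I_def)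
  qed
  have sep: "separable_space (top_of_set (P \<alpha> ` E))" if "\<alpha> \<in> I" for \<alpha>
  proof -
    have "density_le (P \<alpha> ` E) ( |\<alpha>| +c natLeq)" using PRI that unfolding PRI_def I_def by blast
    then obtain D where D: "D \<subseteq> P \<alpha> ` E" "P \<alpha> ` E \<subseteq> closure D" "|D| \<le>o |\<alpha>| +c natLeq"
      unfolding density_le_def dense_subset_def by blast
    have "|\<alpha>| \<le>o natLeq" using seg that by (simp add: I_def countable_card_le_natLeq)
    then have "|\<alpha>| +c natLeq \<le>o natLeq"
      using csum_cinfinite_bound[OF _ _ card_of_Card_order natLeq_Card_order natLeq_Cinfinite]
        ordLeq_refl[OF natLeq_Card_order] by blast
    then have "countable D" using D(3) countable_card_le_natLeq ordLeq_transitive by blast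
    then show ?thesis unfolding separable_top_of_set_iff using D by blast
  qed
  have limF: "limit_segment \<kappa> (Field \<kappa>)"
  proof -
    have "\<exists>b\<in>Field \<kappa>. a \<noteq> b \<and> (a, b) \<in> \<kappa>" if "a \<in> Field \<kappa>" for a
      using infinite_Card_order_limit[OF \<kappa>(1) _ that] \<kappa>(2) countable_finite by blast
    moreover have "Field \<kappa> \<noteq> {}" using \<kappa>(2) by auto
    ultimately show ?thesis unfolding limit_segment_def using Field_ofilter by blast
  qed
  define \<F> where "\<F> = (\<lambda>\<alpha>. P \<alpha> ` E) ` I"
  have cov: "E = \<Union>\<F>"
  proof
    show "\<Union>\<F> \<subseteq> E" using proj by (auto simp: \<F>_def I_def projection_on_def)
    show "E \<subseteq> \<Union>\<F>"
    proof
      fix x assume x: "x \<in> E"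
      have "P (Field \<kappa>) x = x" using PRI x unfolding PRI_def by simp
      then have "x \<in> P (Field \<kappa>) ` E" using x by (metis imageI)
      also have "\<dots> = closure (\<Union>\<alpha>\<in>I. P \<alpha> ` E)"
      proof -
        have "{\<alpha>. ofilter \<alpha> \<and> \<alpha> \<subset> Field \<kappa>} = I" unfolding I_def ofilter_def by auto
        then show ?thesis using lim[OF limF] by simp
      qed
      finally obtain f where f: "\<And>n::nat. f n \<in> (\<Union>\<alpha>\<in>I. P \<alpha> ` E)" "f \<longlonglongrightarrow> x"
        unfolding closure_sequential by blast
      then have "\<forall>n. \<exists>\<beta>. \<beta> \<in> I \<and> f n \<in> P \<beta> ` E" by blast
      then obtain \<alpha> where "\<forall>n. \<alpha> n \<in> I \<and> f n \<in> P (\<alpha> n) ` E" by (rule choice[THEN exE])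
      then have \<alpha>: "\<And>n. \<alpha> n \<in> I" "\<And>n. f n \<in> P (\<alpha> n) ` E" by blast+
      have I: "(\<Union>n. \<alpha> n) \<in> I" using cun \<alpha>(1) by blast
      have "f n \<in> P (\<Union>n. \<alpha> n) ` E" for n
        using mono[of "\<alpha> n" "\<Union>n. \<alpha> n"] \<alpha>(1) I \<alpha>(2)[of n] by (auto simp: I_def)
      then have "x \<in> P (\<Union>n. \<alpha> n) ` E"
        using closed_sequentially[OF clos _ f(2)] I unfolding I_def by blast
      then show "x \<in> \<Union>\<F>" using I by (auto simp: \<F>_def)
    qed
  qed
  have chain: "closure (\<Union>n. S n) \<in> \<F>" if S: "\<And>n::nat. S n \<in> \<F>" for S
  proof -
    have "\<forall>n. \<exists>\<beta>. \<beta> \<in> I \<and> S n = P \<beta> ` E" using S unfolding \<F>_def by blast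
    then obtain \<alpha> where "\<forall>n. \<alpha> n \<in> I \<and> S n = P (\<alpha> n) ` E" by (rule choice[THEN exE])
    then have \<alpha>: "\<And>n. \<alpha> n \<in> I" "\<And>n. S n = P (\<alpha> n) ` E" by blast+
    define \<mu> where "\<mu> = (\<Union>n. \<alpha> n)"
    have \<mu>: "\<mu> \<in> I" unfolding \<mu>_def using cun \<alpha>(1) .
    have le: "S n \<subseteq> P \<mu> ` E" for n
      unfolding \<alpha>(2) using mono[of "\<alpha> n" \<mu>] \<alpha>(1) \<mu> by (auto simp: I_def \<mu>_def)
    have "closure (\<Union>n. S n) = P \<mu> ` E"
    \<comment> \<open>Either the union is attained, or it has no greatest element and continuity applies.\<close>
    proof (cases "\<exists>m. \<alpha> m = \<mu>")
      case True
      then obtain m where "S m = P \<mu> ` E" using \<alpha>(2) by metis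
      then have "(\<Union>n. S n) = P \<mu> ` E" using le by blast
      then show ?thesis using clos \<mu> by (simp add: I_def)
    next
      case False
      have below: "\<exists>n. \<beta> \<subseteq> \<alpha> n" if "ofilter \<beta>" "\<beta> \<subset> \<mu>" for \<beta>
      proof (rule ccontr)
        assume "\<not> ?thesis"
        then have "\<alpha> n \<subseteq> \<beta>" for n using lin[OF that(1), of "\<alpha> n"] \<alpha>(1) by (auto simp: I_def)
        then show False using that(2) by (auto simp: \<mu>_def)
      qed
      have "limit_segment \<kappa> \<mu>"
        unfolding limit_segment_def
      proof (intro conjI ballI)
        show "ofilter \<mu>" using \<mu> by (simp add: I_def)
        show "\<mu> \<noteq> {}" using False by (auto simp: \<mu>_def)
        fix a assume "a \<in> \<mu>"
        then obtain n where n: "a \<in> \<alpha> n" by (auto simp: \<mu>_def)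
        have "\<alpha> n \<subset> \<mu>" using False by (auto simp: \<mu>_def)
        then obtain b where b: "b \<in> \<mu>" "b \<notin> \<alpha> n" by blast
        have F: "a \<in> Field \<kappa>" "b \<in> Field \<kappa>"
          using n b(1) \<alpha>(1) \<mu> by (auto simp: I_def ofilter_def)
        have "(b, a) \<notin> \<kappa>" using n b(2) \<alpha>(1) by (auto simp: I_def ofilter_def under_def)
        then have "(a, b) \<in> \<kappa>" using F TOTALS by blast
        moreover have "a \<noteq> b" using n b(2) by auto
        ultimately show "\<exists>b\<in>\<mu>. a \<noteq> b \<and> (a, b) \<in> \<kappa>" using b(1) by auto
      qed
      from lim[OF this] have eq: "P \<mu> ` E = closure (\<Union>\<alpha>\<in>{\<alpha>. ofilter \<alpha> \<and> \<alpha> \<subset> \<mu>}. P \<alpha> ` E)" .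
      have "(\<Union>\<alpha>\<in>{\<alpha>. ofilter \<alpha> \<and> \<alpha> \<subset> \<mu>}. P \<alpha> ` E) \<subseteq> (\<Union>n. S n)"
      proof
        fix x assume "x \<in> (\<Union>\<alpha>\<in>{\<alpha>. ofilter \<alpha> \<and> \<alpha> \<subset> \<mu>}. P \<alpha> ` E)"
        then obtain \<beta> where \<beta>: "ofilter \<beta>" "\<beta> \<subset> \<mu>" "x \<in> P \<beta> ` E" by blast
        then obtain n where "\<beta> \<subseteq> \<alpha> n" using below by blast
        then have "x \<in> S n" unfolding \<alpha>(2) using mono[OF \<beta>(1), of "\<alpha> n"] \<beta>(3) \<alpha>(1) by (auto simp: I_def)
        then show "x \<in> (\<Union>n. S n)" by blast
      qed
      then have "P \<mu> ` E \<subseteq> closure (\<Union>n. S n)" unfolding eq by (rule closure_mono)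
      moreover have "closure (\<Union>n. S n) \<subseteq> P \<mu> ` E"
        using le clos[of \<mu>] \<mu> by (intro closure_minimal) (auto simp: I_def)
      ultimately show ?thesis by blast
    qed
    then show ?thesis using \<mu> by (auto simp: \<F>_def)
  qed
  have skel: "skeleton E \<F>"
    unfolding skeleton_def
  proof (intro conjI ballI allI impI cov)
    fix F assume "F \<in> \<F>"
    then obtain \<alpha> where \<alpha>: "\<alpha> \<in> I" "F = P \<alpha> ` E" by (auto simp: \<F>_def)
    show "separable_space (top_of_set F)" using sep \<alpha> by simp
    show "complemented_in E F" unfolding complemented_in_def \<alpha>(2)
      using proj[of \<alpha>] \<alpha>(1) by (auto simp: I_def)
    fix G assume "G \<in> \<F>"
    then obtain \<beta> where \<beta>: "\<beta> \<in> I" "G = P \<beta> ` E" by (auto simp: \<F>_def)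
    have of: "ofilter \<alpha>" "ofilter \<beta>" using \<alpha>(1) \<beta>(1) by (auto simp: I_def)
    have "F \<subseteq> G \<or> G \<subseteq> F"
      using lin[OF of] mono[OF of] mono[OF of(2,1)] unfolding \<alpha>(2) \<beta>(2) by metis
    then show "\<exists>H\<in>\<F>. F \<subseteq> H \<and> G \<subseteq> H" using \<open>F \<in> \<F>\<close> \<open>G \<in> \<F>\<close> by auto
  qed (use chain in blast)
  \<comment> \<open>Different segments may have the same image, so one segment is selected for each image.\<close>
  define s where "s = (\<lambda>F. SOME \<alpha>. \<alpha> \<in> I \<and> P \<alpha> ` E = F)"
  have s: "s F \<in> I \<and> P (s F) ` E = F" if "F \<in> \<F>" for F
  proof -
    have "\<exists>\<alpha>. \<alpha> \<in> I \<and> P \<alpha> ` E = F" using that by (auto simp: \<F>_def)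
    from someI_ex[OF this] show ?thesis unfolding s_def .
  qed
  have compat: "P (s F) (P (s G) x) = P (s F) x \<and> P (s G) (P (s F) x) = P (s F) x"
    if "F \<in> \<F>" "G \<in> \<F>" "F \<subseteq> G" "x \<in> E" for F G x
  proof (cases "s F \<subseteq> s G")
    case True
    then show ?thesis using comm[of "s F" "s G" x] s that by (simp add: I_def Int_absorb2)
  next
    case False
    then have "s G \<subseteq> s F" using lin s that by (auto simp: I_def)
    then have "G \<subseteq> F" using mono[of "s G" "s F"] s that by (auto simp: I_def)
    then have "F = G" using that(3) by blast
    moreover have "projection_on E (P (s F))" using proj[of "s F"] s[OF that(1)] by (simp add: I_def)
    ultimately show ?thesis using that(4) by (simp add: projection_on_def)
  qed
  show ?thesis unfolding has_projectional_skeleton_def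
  proof (intro exI[of _ \<F>] exI[of _ "\<lambda>F. P (s F)"] conjI ballI impI skel)
    fix F assume F: "F \<in> \<F>"
    show "projection_on E (P (s F))" "P (s F) ` E = F"
      using proj[of "s F"] s[OF F] by (auto simp: I_def)
  qed (use compat in blast)+
qed

section \<open>A well-ordered type of order type \<open>\<omega>\<^sub>1\<close> and its ladders\<close>

text \<open>
  The points of a well-ordered continuum with only countably many predecessors form a copy of
  \<open>\<omega>\<^sub>1\<close>. It is carved out of the reals so that the representation map embeds it into the ground set
  of the family.
\<close>

typedef omega1 = "{x::real. countable (under |UNIV::real set| x)}"
proof -
  interpret wo_rel "|UNIV::real set|" by (simp add: card_of_Well_order wo_rel_def)
  have "under (minim UNIV) \<subseteq> {minim UNIV}"
  proof
    fix x assume "x \<in> under (minim UNIV)"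
    then have "(x, minim UNIV) \<in> |UNIV::real set|" by (simp add: under_def)
    moreover have "(minim UNIV, x) \<in> |UNIV::real set|" using minim_least[of UNIV x] by (simp add: Field_card_of)
    ultimately show "x \<in> {minim UNIV}" using ANTISYM unfolding antisym_def by auto
  qed
  then show ?thesis using countable_subset by fastforce
qed

instantiation omega1 :: wellorder
begin

definition less_eq_omega1 :: "omega1 \<Rightarrow> omega1 \<Rightarrow> bool" where
  "a \<le> b \<longleftrightarrow> (Rep_omega1 a, Rep_omega1 b) \<in> |UNIV::real set|"

definition less_omega1 :: "omega1 \<Rightarrow> omega1 \<Rightarrow> bool" where
  "a < (b :: omega1) \<longleftrightarrow> a \<le> b \<and> a \<noteq> b"

instance
proof
  interpret wo_rel "|UNIV::real set|" by (simp add: card_of_Well_order wo_rel_def)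
  note defs = less_eq_omega1_def less_omega1_def
  fix a b c :: omega1
  show "(a < b) = (a \<le> b \<and> \<not> b \<le> a)"
    using ANTISYM Rep_omega1_inject[of a b] unfolding defs antisym_def by blast
  show "a \<le> a" using REFL by (simp add: defs refl_on_def Field_card_of)
  show "a \<le> b \<Longrightarrow> b \<le> c \<Longrightarrow> a \<le> c" using TRANS unfolding defs trans_def by blast
  show "a \<le> b \<Longrightarrow> b \<le> a \<Longrightarrow> a = b"
    using ANTISYM Rep_omega1_inject[of a b] unfolding defs antisym_def by blast
  show "a \<le> b \<or> b \<le> a" using TOTALS by (simp add: defs Field_card_of)
  fix P :: "omega1 \<Rightarrow> bool"
  assume step: "\<And>x. (\<And>y. y < x \<Longrightarrow> P y) \<Longrightarrow> P x"
  have "wf (inv_image ( |UNIV::real set| - Id) Rep_omega1)" using WF by (rule wf_inv_image)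
  then show "P a"
  proof (induction a rule: wf_induct_rule)
    case (less x)
    show ?case
      by (rule step, rule less) (auto simp: defs Rep_omega1_inject)
  qed
qed

end

lemma countable_atMost_omega1: "countable {..a::omega1}"
proof -
  have "Rep_omega1 ` {..a} \<subseteq> under |UNIV::real set| (Rep_omega1 a)"
    by (auto simp: less_eq_omega1_def under_def)
  then have "countable (Rep_omega1 ` {..a})" using Rep_omega1[of a] countable_subset by blast
  then show ?thesis by (rule countable_image_inj_on) (simp add: Rep_omega1_inject inj_on_def)
qed

lemma countable_lessThan_omega1: "countable {..<a::omega1}"
  by (rule countable_subset[OF _ countable_atMost_omega1[of a]]) auto

text \<open>
  Otherwise the least real outside would have countably many predecessors and so would not be outside.
\<close>

lemma uncountable_omega1: "uncountable (UNIV :: omega1 set)"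
proof
  assume "countable (UNIV :: omega1 set)"
  then have cW: "countable (range Rep_omega1)" by simp
  interpret wo_rel "|UNIV::real set|" by (simp add: card_of_Well_order wo_rel_def)
  let ?N = "- range Rep_omega1"
  have ne: "?N \<noteq> {}" using cW uncountable_UNIV_real by (metis Compl_eq_Diff_UNIV Diff_eq_empty_iff top.extremum_uniqueI)
  let ?m = "minim ?N"
  have m: "?m \<in> ?N" using minim_in[OF _ ne] by (simp add: Field_card_of)
  have "under ?m \<subseteq> insert ?m (range Rep_omega1)"
  proof
    fix x assume x: "x \<in> under ?m"
    show "x \<in> insert ?m (range Rep_omega1)"
    proof (rule ccontr)
      assume *: "x \<notin> insert ?m (range Rep_omega1)"
      then have "(?m, x) \<in> |UNIV::real set|" using minim_least[of ?N x] by (simp add: Field_card_of)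
      then have "x = ?m" using x ANTISYM by (auto simp: under_def antisym_def)
      then show False using * by blast
    qed
  qed
  then have "countable (under ?m)" by (rule countable_subset) (simp add: cW)
  then have "Rep_omega1 (Abs_omega1 ?m) = ?m" by (rule Abs_omega1_inverse[OF CollectI])
  moreover have "Rep_omega1 (Abs_omega1 ?m) \<in> range Rep_omega1" by (rule rangeI)
  ultimately have "?m \<in> range Rep_omega1" by (simp only:)
  then show False using m by blast
qed

lemma countable_bounded_omega1:
  assumes "countable (C :: omega1 set)"
  shows "\<exists>b. \<forall>c\<in>C. c < b"
proof -
  have "countable (\<Union>c\<in>C. {..c})" using assms countable_atMost_omega1 by blast
  then have "(\<Union>c\<in>C. {..c}) \<noteq> UNIV" using uncountable_omega1 by metis
  then obtain b where "b \<notin> (\<Union>c\<in>C. {..c})" by blast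
  then show ?thesis by (auto simp: not_le)
qed

text \<open>
  The supremum may or may not be attained; both cases are covered by saying that everything strictly
  below \<open>s\<close> is exceeded by a member of \<open>C\<close>.
\<close>

lemma countable_lub_omega1:
  assumes "countable (C :: omega1 set)"
  obtains s where "\<And>c. c \<in> C \<Longrightarrow> c \<le> s" "\<And>b. b < s \<Longrightarrow> \<exists>c\<in>C. b < c"
proof -
  define s where "s = (LEAST b. \<forall>c\<in>C. c \<le> b)"
  have ex: "\<exists>b. \<forall>c\<in>C. c \<le> b" using countable_bounded_omega1[OF assms] less_imp_le by blast
  show ?thesis
  proof
    show "c \<le> s" if "c \<in> C" for c using LeastI_ex[OF ex] that unfolding s_def by blast
    show "\<exists>c\<in>C. b < c" if "b < s" for b
      using not_less_Least[OF that[unfolded s_def]] by (auto simp: not_le)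
  qed
qed

text \<open>
  A set of smaller cardinality is in bijection with a proper initial segment.
\<close>

lemma countable_if_card_less_omega1:
  assumes "|X| <o |UNIV :: omega1 set|"
  shows "countable X"
proof -
  define r where "r = {(x, y). x \<le> (y::omega1)}"
  have "x \<in> Field r" for x by (rule FieldI1[of x x]) (simp add: r_def)
  then have F: "Field r = UNIV" by auto
  have wo: "well_order_on UNIV r"
    unfolding well_order_on_def linear_order_on_def partial_order_on_def preorder_on_def
  proof (intro conjI)
    have "r - Id = {(x, y). x < y}" by (auto simp: r_def)
    then show "wf (r - Id)" by (simp add: wf)
  qed (auto simp: r_def refl_on_def trans_def antisym_def total_on_def)
  have "|X| <o r" using assms card_of_least[OF wo] by (rule ordLess_ordLeq_trans)
  moreover have "Well_order r" using wo F by simp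
  ultimately obtain a where "|X| =o Restr r (underS r a)"
    using ordLess_iff_ordIso_Restr[of r "|X|"] card_of_Well_order by blast
  then have "|X| =o |Field (Restr r (underS r a))|"
    using card_of_cong[of "|X|"] by (simp add: Field_card_of)
  then obtain h where "bij_betw h X (Field (Restr r (underS r a)))"
    unfolding card_of_ordIso[symmetric] by blast
  moreover have "Field (Restr r (underS r a)) \<subseteq> {..a}"
    by (auto simp: Field_def underS_def r_def)
  then have "countable (Field (Restr r (underS r a)))"
    using countable_atMost_omega1[of a] countable_subset by blast
  ultimately show ?thesis using countable_iff_bij by blast
qed

definition limit_ordinal :: "omega1 \<Rightarrow> bool" where
  "limit_ordinal \<delta> \<longleftrightarrow> (\<exists>\<beta>. \<beta> < \<delta>) \<and> (\<forall>\<beta><\<delta>. \<exists>\<gamma>>\<beta>. \<gamma> < \<delta>)"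

lemma ex_nonlimit_above: "\<exists>\<alpha>>\<beta>. \<not> limit_ordinal \<alpha>"
proof -
  define \<alpha> where "\<alpha> = (LEAST \<alpha>. \<beta> < \<alpha>)"
  have "\<exists>\<alpha>. \<beta> < \<alpha>" using countable_bounded_omega1[of "{\<beta>}"] by auto
  then have "\<beta> < \<alpha>" unfolding \<alpha>_def by (rule LeastI_ex)
  moreover have "\<not> (\<exists>\<gamma>>\<beta>. \<gamma> < \<alpha>)" unfolding \<alpha>_def using not_less_Least by blast
  ultimately show ?thesis unfolding limit_ordinal_def by blast
qed

lemma strict_mono_lub_omega1:
  assumes "\<And>n::nat. \<alpha> n < \<alpha> (Suc n)"
  obtains s where "\<And>n. \<alpha> n < s" "\<And>b. b < s \<Longrightarrow> \<exists>n. b < \<alpha> n" "limit_ordinal s"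
proof -
  obtain s where s: "\<And>c. c \<in> range \<alpha> \<Longrightarrow> c \<le> s" "\<And>b. b < s \<Longrightarrow> \<exists>c\<in>range \<alpha>. b < c"
    using countable_lub_omega1[of "range \<alpha>"] by auto
  have lt: "\<alpha> n < s" for n using assms[of n] s(1)[of "\<alpha> (Suc n)"] by auto
  moreover have "\<exists>n. b < \<alpha> n" if "b < s" for b using s(2)[OF that] by auto
  moreover have "limit_ordinal s" unfolding limit_ordinal_def using lt calculation(2) by blast
  ultimately show ?thesis using that by blast
qed

text \<open>
  Enumerate the predecessors of \<open>\<delta>\<close> and choose an increasing sequence that exceeds them one after
  the other.
\<close>

lemma ex_ladder:
  assumes "limit_ordinal \<delta>"
  shows "\<exists>L. L \<subseteq> {..<\<delta>} \<and> infinite L \<and> (\<forall>\<beta><\<delta>. finite (L \<inter> {..<\<beta>}))"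
proof -
  have ne: "{..<\<delta>} \<noteq> {}" using assms by (auto simp: limit_ordinal_def)
  define e where "e = from_nat_into {..<\<delta>}"
  have e: "range e = {..<\<delta>}" unfolding e_def
    using range_from_nat_into[OF ne countable_lessThan_omega1] .
  have "\<exists>a. \<forall>n::nat. a n < \<delta> \<and> (a n < a (Suc n) \<and> e n < a (Suc n))"
  proof (rule dependent_nat_choice)
    show "\<exists>x. x < \<delta>" using ne by auto
    fix x and n :: nat assume "x < \<delta>"
    moreover have "e n < \<delta>" using e by blast
    ultimately have "max x (e n) < \<delta>" by simp
    then obtain y where "max x (e n) < y" "y < \<delta>" using assms unfolding limit_ordinal_def by blast
    then show "\<exists>y<\<delta>. x < y \<and> e n < y" by auto
  qed
  then obtain a where a: "\<And>n::nat. a n < \<delta>" "\<And>n. a n < a (Suc n)" "\<And>n. e n < a (Suc n)" by blast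
  have sm: "strict_mono a" using a(2) by (simp add: strict_mono_Suc_iff)
  have "finite (range a \<inter> {..<\<beta>})" if "\<beta> < \<delta>" for \<beta>
  proof -
    have "\<beta> \<in> range e" using that e by simp
    then obtain n where "\<beta> = e n" by blast
    then have n: "\<beta> < a (Suc n)" using a(3) by simp
    have "range a \<inter> {..<\<beta>} \<subseteq> a ` {..Suc n}"
    proof
      fix x assume "x \<in> range a \<inter> {..<\<beta>}"
      then obtain m where m: "x = a m" "a m < \<beta>" by auto
      then have "a m < a (Suc n)" using n by simp
      then have "m < Suc n" using sm by (simp add: strict_mono_less)
      then show "x \<in> a ` {..Suc n}" using m by auto
    qed
    then show ?thesis using finite_subset by blast
  qed
  moreover have "infinite (range a)" using sm strict_mono_imp_inj_on range_inj_infinite by blast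
  moreover have "range a \<subseteq> {..<\<delta>}" using a(1) by auto
  ultimately show ?thesis by blast
qed

definition ladder :: "omega1 \<Rightarrow> omega1 set" where
  "ladder \<delta> = (SOME L. L \<subseteq> {..<\<delta>} \<and> infinite L \<and> (\<forall>\<beta><\<delta>. finite (L \<inter> {..<\<beta>})))"

lemma ladder:
  assumes "limit_ordinal \<delta>"
  shows "ladder \<delta> \<subseteq> {..<\<delta>}" "infinite (ladder \<delta>)" "\<And>\<beta>. \<beta> < \<delta> \<Longrightarrow> finite (ladder \<delta> \<inter> {..<\<beta>})"
  using someI_ex[OF ex_ladder[OF assms]] unfolding ladder_def by blast+

lemma finite_ladder_Int:
  assumes "limit_ordinal \<delta>" "limit_ordinal \<epsilon>" "\<delta> \<noteq> \<epsilon>"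
  shows "finite (ladder \<delta> \<inter> ladder \<epsilon>)"
proof -
  have *: "finite (ladder \<delta> \<inter> ladder \<epsilon>)" if "limit_ordinal \<delta>" "limit_ordinal \<epsilon>" "\<delta> < \<epsilon>" for \<delta> \<epsilon>
    using ladder(1)[OF that(1)] ladder(3)[OF that(2,3)] by (auto elim!: finite_subset[rotated])
  show ?thesis
    using *[of \<delta> \<epsilon>] *[of \<epsilon> \<delta>] assms by (cases "\<delta> < \<epsilon>") (auto simp: Int_commute)
qed

section \<open>Bounded functions and countably supported functionals\<close>

abbreviation val :: "('k discrete \<Rightarrow>\<^sub>C real) \<Rightarrow> 'k \<Rightarrow> real" where
  "val f p \<equiv> apply_bcontfun f (discrete p)"

text \<open>
  Every bounded function is continuous on the discrete copy of the point set; unbounded arguments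
  produce an unspecified value.
\<close>

definition to_bcontfun :: "('k \<Rightarrow> real) \<Rightarrow> ('k discrete \<Rightarrow>\<^sub>C real)" where
  "to_bcontfun g = Bcontfun (\<lambda>d. g (of_discrete d))"

lemma val_to_bcontfun:
  assumes "\<And>p. \<bar>g p\<bar> \<le> b"
  shows "val (to_bcontfun g) p = g p"
proof -
  have "(\<lambda>d. g (of_discrete d)) \<in> bcontfun"
  proof (rule bcontfun_normI[of _ b])
    show "continuous_on UNIV (\<lambda>d. g (of_discrete d))"
      by (simp add: continuous_on_open_vimage open_discrete)
  qed (use assms in simp)
  then show ?thesis unfolding to_bcontfun_def by (simp add: Bcontfun_inverse discrete_inverse)
qed

lemma val_indicator: "val (to_bcontfun (indicator S)) p = indicator S p"
  by (rule val_to_bcontfun[of _ 1]) (simp add: indicator_def)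

lemma val_eqI:
  assumes "\<And>p. val f p = val g p"
  shows "f = g"
  using assms[of "of_discrete x" for x] by (intro bcontfun_eqI) (simp add: of_discrete_inverse)

lemma abs_val_le_norm: "\<bar>val f p\<bar> \<le> norm f"
  using norm_bounded[of f "discrete p"] by simp

lemma norm_le_val:
  assumes "\<And>p. \<bar>val f p\<bar> \<le> b"
  shows "norm f \<le> b"
  using assms[of "of_discrete x" for x] by (intro norm_bound) (simp add: of_discrete_inverse)

lemma val_sum: "val (sum f S) p = (\<Sum>i\<in>S. val (f i) p)"
  by (induction S rule: infinite_finite_induct) auto

text \<open>
  Let \<open>s\<close> be the supremum of \<open>\<phi>\<close> on the unit ball and let \<open>D\<close> consist of unit vectors \<open>f\<^sub>n\<close> with
  \<open>\<phi>(f\<^sub>n) \<longlonglongrightarrow> s\<close>. If \<open>g\<close> is normalised and disjoint from every \<open>f\<^sub>n\<close>, then \<open>f\<^sub>n + g\<close> and \<open>f\<^sub>n - g\<close> stay in the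
  unit ball of the supremum norm, so \<open>\<phi>(f\<^sub>n) + |\<phi>(g)| \<le> s\<close> for all \<open>n\<close>, which forces \<open>\<phi>(g) = 0\<close>. This
  replaces the representation of functionals by measures.
\<close>

lemma functional_countably_supported:
  fixes E :: "('k discrete \<Rightarrow>\<^sub>C real) set" and \<phi> :: "('k discrete \<Rightarrow>\<^sub>C real) \<Rightarrow> real"
  assumes E: "subspace E" and \<phi>: "bounded_linear_on E \<phi>"
  shows "\<exists>D. countable D \<and> D \<subseteq> E \<and>
    (\<forall>g\<in>E. (\<forall>f\<in>D. \<forall>p. val f p = 0 \<or> val g p = 0) \<longrightarrow> \<phi> g = 0)"
proof -
  let ?B = "{f \<in> E. norm f \<le> 1}"
  define s where "s = (SUP f\<in>?B. \<phi> f)"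
  obtain C where C: "0 \<le> C" "\<And>f. f \<in> E \<Longrightarrow> norm (\<phi> f) \<le> C * norm f"
    using bounded_linear_on_bound[OF \<phi>] by blast
  have "\<phi> f \<le> C" if "f \<in> ?B" for f
    using C(2)[of f] mult_left_mono[of "norm f" 1 C] C(1) that by auto
  then have bdd: "bdd_above (\<phi> ` ?B)" by (intro bdd_aboveI2) auto
  have ne: "?B \<noteq> {}" using subspace_0[OF E] by auto
  have "\<exists>f\<in>?B. s - 1 / real (Suc n) < \<phi> f" for n
    using less_cSUP_iff[OF ne bdd, of "s - 1 / real (Suc n)"] unfolding s_def by simp
  then obtain F where F: "\<And>n. F n \<in> ?B" "\<And>n. s - 1 / real (Suc n) < \<phi> (F n)" by metis
  show ?thesis
  proof (intro exI[of _ "range F"] conjI ballI impI)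
    show "range F \<subseteq> E" using F(1) by auto
    fix g assume g: "g \<in> E" and dis: "\<forall>f\<in>range F. \<forall>p. val f p = 0 \<or> val g p = 0"
    define h where "h = (1 / norm g) *\<^sub>R g"
    have h: "h \<in> E" unfolding h_def using subspace_scale[OF E g] .
    have nh: "norm h \<le> 1" unfolding h_def by simp
    have le: "\<phi> (F n) + t * \<phi> h \<le> s" if "\<bar>t\<bar> = 1" for n t
    proof -
      have th: "t *\<^sub>R h \<in> E" using subspace_scale[OF E h] .
      have "norm (F n + t *\<^sub>R h) \<le> 1"
      proof (rule norm_le_val)
        fix p
        have "val (F n) p = 0 \<or> val h p = 0" using dis by (auto simp: h_def)
        moreover have "\<bar>val (F n) p\<bar> \<le> 1" using abs_val_le_norm[of "F n" p] F(1)[of n] by simp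
        moreover have "\<bar>t * val h p\<bar> \<le> 1"
          using abs_val_le_norm[of h p] nh that by (simp add: abs_mult)
        ultimately show "\<bar>val (F n + t *\<^sub>R h) p\<bar> \<le> 1" by auto
      qed
      then have "F n + t *\<^sub>R h \<in> ?B" using subspace_add[OF E _ th] F(1)[of n] by auto
      then have "\<phi> (F n + t *\<^sub>R h) \<le> s" unfolding s_def by (rule cSUP_upper[OF _ bdd])
      moreover have "\<phi> (F n + t *\<^sub>R h) = \<phi> (F n) + t * \<phi> h"
        using bounded_linear_onD[OF \<phi>] F(1)[of n] h th by simp
      ultimately show ?thesis by simp
    qed
    have "\<bar>\<phi> h\<bar> < 1 / real (Suc n)" for n
      using le[of 1 n] le[of "-1" n] F(2)[of n] by (auto simp: abs_less_iff)
    then have "\<bar>\<phi> h\<bar> \<le> 0"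
      by (metis reals_Archimedean inverse_eq_divide not_le order.asym)
    then have "\<phi> h = 0" by simp
    moreover have "g = norm g *\<^sub>R h" by (simp add: h_def)
    ultimately show "\<phi> g = 0" using bounded_linear_onD(2)[OF \<phi> h, of "norm g"] by simp
  qed simp
qed

section \<open>Continuity on \<open>K\<^sub>\<A>\<close>\<close>

text \<open>
  Almost disjointness is what makes the neighbourhoods of \<open>\<infinity>\<close> open: each \<open>A\<close> that is not removed
  meets the removed sets in a finite set only.
\<close>

lemma openin_basic_nbhd:
  assumes "almost_disjoint \<A>" "p \<in> kspace \<A>" "N \<in> basic_nbhds \<A> p"
  shows "openin (ktopology \<A>) N" "p \<in> N"
proof -
  show "p \<in> N"
    using assms(2,3) by (cases p) auto
  have pt: "\<exists>N'\<in>basic_nbhds \<A> (Pt x). N' \<subseteq> N" if "Pt x \<in> N" for x using that by simp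
  have lim: "\<exists>N'\<in>basic_nbhds \<A> (Lim A). N' \<subseteq> N" if "finite F" "{Lim A} \<union> Pt ` (A - F) \<subseteq> N" for A F
    using that by auto
  have "N \<subseteq> kspace \<A> \<and> (\<forall>q\<in>N. \<exists>N'\<in>basic_nbhds \<A> q. N' \<subseteq> N)"
  proof (cases p)
    case (Pt x)
    then show ?thesis using assms(2,3) by auto
  next
    case (Lim A)
    then have A: "A \<in> \<A>" using assms(2) by (auto simp: kspace_def)
    obtain F where F: "finite F" "N = {Lim A} \<union> Pt ` (A - F)" using assms(3) Lim by auto
    have "\<exists>N'\<in>basic_nbhds \<A> q. N' \<subseteq> N" if "q \<in> N" for q
    proof (cases "q = Lim A")
      case True
      show ?thesis unfolding True by (rule lim[OF F(1)]) (simp add: F(2))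
    next
      case False
      then obtain x where "q = Pt x" using \<open>q \<in> N\<close> F(2) by auto
      then show ?thesis using pt \<open>q \<in> N\<close> by simp
    qed
    then show ?thesis using A F(2) by (auto simp: kspace_def)
  next
    case Infty
    then obtain \<B> where B: "finite \<B>" "\<B> \<subseteq> \<A>" "N = kspace \<A> - (\<Union>A\<in>\<B>. {Lim A} \<union> Pt ` A)"
      using assms(3) by auto
    have "\<exists>N'\<in>basic_nbhds \<A> q. N' \<subseteq> N" if q: "q \<in> N" for q
    proof (cases q)
      case (Pt x)
      then show ?thesis using pt q by simp
    next
      case (Lim A)
      have A: "A \<in> \<A>" "A \<notin> \<B>" using q unfolding Lim B(3) by (auto simp: kspace_def)
      have "finite (A \<inter> A')" if "A' \<in> \<B>" for A'
      proof -
        have "pairwise (\<lambda>A B. finite (A \<inter> B)) \<A>" using assms(1) by (simp add: almost_disjoint_def)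
        moreover have "A \<in> \<A>" "A' \<in> \<A>" "A \<noteq> A'" using A B(2) that by auto
        ultimately show ?thesis by (simp add: pairwise_def)
      qed
      then have "finite (\<Union>A'\<in>\<B>. A \<inter> A')" using B(1) by blast
      moreover have "{Lim A} \<union> Pt ` (A - (\<Union>A'\<in>\<B>. A \<inter> A')) \<subseteq> N"
        unfolding B(3) using A by (auto simp: kspace_def)
      ultimately show ?thesis using lim Lim by blast
    next
      case q': Infty
      then show ?thesis using assms(3) Infty by blast
    qed
    then show ?thesis unfolding B(3) by blast
  qed
  then show "openin (ktopology \<A>) N" unfolding openin_ktopology .
qed

text \<open>
  Continuity is a condition at the points \<open>Lim A\<close>, where \<open>f\<close> must converge along \<open>A\<close>, and at \<open>\<infinity>\<close>,
  where \<open>f\<close> must be within \<open>e\<close> of \<open>f(\<infinity>)\<close> off finitely many members of the family.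
\<close>

lemma C_space_ktopology_iff:
  assumes "almost_disjoint \<A>"
  shows "f \<in> C_space (ktopology \<A>) \<longleftrightarrow>
    (\<forall>p. p \<notin> kspace \<A> \<longrightarrow> val f p = 0) \<and>
    (\<forall>A\<in>\<A>. \<forall>e>0. finite {x\<in>A. e \<le> \<bar>val f (Pt x) - val f (Lim A)\<bar>}) \<and>
    (\<forall>e>0. \<exists>\<B>. finite \<B> \<and> \<B> \<subseteq> \<A> \<and>
      (\<forall>p\<in>kspace \<A>. e \<le> \<bar>val f p - val f Infty\<bar> \<longrightarrow> (\<exists>A\<in>\<B>. p = Lim A \<or> p \<in> Pt ` A)))"
    (is "?L \<longleftrightarrow> ?Z \<and> ?A \<and> ?I")
proof -
  have cont: "continuous_map (ktopology \<A>) euclideanreal (val f) \<longleftrightarrow>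
    (\<forall>p\<in>kspace \<A>. \<forall>e>0. \<exists>N\<in>basic_nbhds \<A> p. \<forall>q\<in>N. \<bar>val f q - val f p\<bar> < e)"
    (is "_ \<longleftrightarrow> ?C")
  proof -
    have "continuous_map (ktopology \<A>) euclideanreal (val f) \<longleftrightarrow>
      (\<forall>p\<in>kspace \<A>. \<forall>e>0. \<exists>U. openin (ktopology \<A>) U \<and> p \<in> U \<and> (\<forall>q\<in>U. \<bar>val f q - val f p\<bar> < e))"
      using Met_TC.continuous_map_to_metric[of "ktopology \<A>" "val f"]
      by (simp add: dist_real_def abs_minus_commute)
    also have "\<dots> \<longleftrightarrow> ?C"
    proof (intro ball_cong refl all_cong1 imp_cong iffI)
      fix p :: "'a kpoint" and e :: real assume p: "p \<in> kspace \<A>"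
      {
        assume "\<exists>U. openin (ktopology \<A>) U \<and> p \<in> U \<and> (\<forall>q\<in>U. \<bar>val f q - val f p\<bar> < e)"
        then obtain U where U: "openin (ktopology \<A>) U" "p \<in> U" "\<forall>q\<in>U. \<bar>val f q - val f p\<bar> < e" by blast
        then obtain N where "N \<in> basic_nbhds \<A> p" "N \<subseteq> U" unfolding openin_ktopology by blast
        then show "\<exists>N\<in>basic_nbhds \<A> p. \<forall>q\<in>N. \<bar>val f q - val f p\<bar> < e" using U(3) by blast
      next
        assume "\<exists>N\<in>basic_nbhds \<A> p. \<forall>q\<in>N. \<bar>val f q - val f p\<bar> < e"
        then show "\<exists>U. openin (ktopology \<A>) U \<and> p \<in> U \<and> (\<forall>q\<in>U. \<bar>val f q - val f p\<bar> < e)"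
          using openin_basic_nbhd[OF assms p] by blast
      }
    qed
    finally show ?thesis .
  qed
  have lim: "(\<exists>N\<in>basic_nbhds \<A> (Lim A). \<forall>q\<in>N. \<bar>val f q - val f (Lim A)\<bar> < e) \<longleftrightarrow>
      finite {x\<in>A. e \<le> \<bar>val f (Pt x) - val f (Lim A)\<bar>}" (is "?l \<longleftrightarrow> finite ?F") if "e > 0" for A e
  proof
    assume ?l
    then obtain F where "finite F" "\<forall>q\<in>{Lim A} \<union> Pt ` (A - F). \<bar>val f q - val f (Lim A)\<bar> < e" by auto
    then have "?F \<subseteq> F" by force
    then show "finite ?F" using \<open>finite F\<close> finite_subset by blast
  next
    assume "finite ?F"
    then have "{Lim A} \<union> Pt ` (A - ?F) \<in> basic_nbhds \<A> (Lim A)" by auto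
    moreover have "\<forall>q\<in>{Lim A} \<union> Pt ` (A - ?F). \<bar>val f q - val f (Lim A)\<bar> < e" using that by auto
    ultimately show ?l by blast
  qed
  have inf: "(\<exists>N\<in>basic_nbhds \<A> Infty. \<forall>q\<in>N. \<bar>val f q - val f Infty\<bar> < e) \<longleftrightarrow>
     (\<exists>\<B>. finite \<B> \<and> \<B> \<subseteq> \<A> \<and>
      (\<forall>p\<in>kspace \<A>. e \<le> \<bar>val f p - val f Infty\<bar> \<longrightarrow> (\<exists>A\<in>\<B>. p = Lim A \<or> p \<in> Pt ` A)))" for e
  proof -
    have eq: "(\<forall>q\<in>kspace \<A> - (\<Union>A\<in>\<B>. {Lim A} \<union> Pt ` A). \<bar>val f q - val f Infty\<bar> < e) \<longleftrightarrow>
      (\<forall>p\<in>kspace \<A>. e \<le> \<bar>val f p - val f Infty\<bar> \<longrightarrow> (\<exists>A\<in>\<B>. p = Lim A \<or> p \<in> Pt ` A))" for \<B>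
      unfolding not_less[symmetric] by blast
    have "(\<exists>N\<in>basic_nbhds \<A> Infty. R N) \<longleftrightarrow>
      (\<exists>\<B>. finite \<B> \<and> \<B> \<subseteq> \<A> \<and> R (kspace \<A> - (\<Union>A\<in>\<B>. {Lim A} \<union> Pt ` A)))" for R
      unfolding basic_nbhds.simps by blast
    then show ?thesis by (simp only: eq)
  qed
  have "?C \<longleftrightarrow> ?A \<and> ?I"
  proof
    assume C: ?C
    have "finite {x\<in>A. e \<le> \<bar>val f (Pt x) - val f (Lim A)\<bar>}" if "A \<in> \<A>" "e > 0" for A e
    proof -
      have "Lim A \<in> kspace \<A>" using that(1) by (simp add: kspace_def)
      then have "\<exists>N\<in>basic_nbhds \<A> (Lim A). \<forall>q\<in>N. \<bar>val f q - val f (Lim A)\<bar> < e"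
        using C that(2) by blast
      then show ?thesis using lim[OF that(2)] by blast
    qed
    moreover have "\<exists>N\<in>basic_nbhds \<A> Infty. \<forall>q\<in>N. \<bar>val f q - val f Infty\<bar> < e" if "e > 0" for e
    proof -
      have "Infty \<in> kspace \<A>" by (simp add: kspace_def)
      then show ?thesis using C that by blast
    qed
    ultimately show "?A \<and> ?I" unfolding inf by simp
  next
    assume AI: "?A \<and> ?I"
    show ?C
    proof (intro ballI allI impI)
      fix p and e :: real assume p: "p \<in> kspace \<A>" "0 < e"
      show "\<exists>N\<in>basic_nbhds \<A> p. \<forall>q\<in>N. \<bar>val f q - val f p\<bar> < e"
      proof (cases p)
        case (Pt x)
        then show ?thesis using p(2) by simp
      next
        case (Lim A)
        then have "A \<in> \<A>" using p(1) by (auto simp: kspace_def)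
        then show ?thesis unfolding Lim lim[OF p(2)] using AI p(2) by blast
      next
        case Infty
        then show ?thesis unfolding Infty inf using AI p(2) by blast
      qed
    qed
  qed
  then show ?thesis unfolding C_space_def using cont by auto
qed

lemma C_space_ktopologyI:
  assumes "almost_disjoint \<A>"
    and "\<And>p. p \<notin> kspace \<A> \<Longrightarrow> val f p = 0"
    and "\<And>A e. A \<in> \<A> \<Longrightarrow> 0 < e \<Longrightarrow> finite {x\<in>A. e \<le> \<bar>val f (Pt x) - val f (Lim A)\<bar>}"
    and "\<And>e. 0 < e \<Longrightarrow> \<exists>\<B>. finite \<B> \<and> \<B> \<subseteq> \<A> \<and>
      (\<forall>p\<in>kspace \<A>. e \<le> \<bar>val f p - val f Infty\<bar> \<longrightarrow> (\<exists>A\<in>\<B>. p = Lim A \<or> p \<in> Pt ` A))"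
  shows "f \<in> C_space (ktopology \<A>)"
  unfolding C_space_ktopology_iff[OF assms(1)]
proof (intro conjI allI impI ballI)
  show "val f p = 0" if "p \<notin> kspace \<A>" for p using assms(2)[OF that] .
  show "finite {x\<in>A. e \<le> \<bar>val f (Pt x) - val f (Lim A)\<bar>}" if "A \<in> \<A>" "0 < e" for A e
    using assms(3)[OF that] .
  show "\<exists>\<B>. finite \<B> \<and> \<B> \<subseteq> \<A> \<and>
      (\<forall>p\<in>kspace \<A>. e \<le> \<bar>val f p - val f Infty\<bar> \<longrightarrow> (\<exists>A\<in>\<B>. p = Lim A \<or> p \<in> Pt ` A))" if "0 < e" for e
    using assms(4)[OF that] .
qed

lemma val_outside_kspace:
  assumes "f \<in> C_space (ktopology \<A>)" "p \<notin> kspace \<A>"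
  shows "val f p = 0"
  using assms by (simp add: C_space_def)

lemma finite_far_from_Lim:
  assumes "almost_disjoint \<A>" "f \<in> C_space (ktopology \<A>)" "A \<in> \<A>" "0 < e"
  shows "finite {x\<in>A. e \<le> \<bar>val f (Pt x) - val f (Lim A)\<bar>}"
  using assms(2,3,4) unfolding C_space_ktopology_iff[OF assms(1)] by simp

lemma far_from_Infty_covered:
  assumes "almost_disjoint \<A>" "f \<in> C_space (ktopology \<A>)" "0 < e"
  obtains \<B> where "finite \<B>" "\<B> \<subseteq> \<A>"
    "\<forall>p\<in>kspace \<A>. e \<le> \<bar>val f p - val f Infty\<bar> \<longrightarrow> (\<exists>A\<in>\<B>. p = Lim A \<or> p \<in> Pt ` A)"
proof -
  have "\<exists>\<B>. finite \<B> \<and> \<B> \<subseteq> \<A> \<and>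
      (\<forall>p\<in>kspace \<A>. e \<le> \<bar>val f p - val f Infty\<bar> \<longrightarrow> (\<exists>A\<in>\<B>. p = Lim A \<or> p \<in> Pt ` A))"
    using assms(2,3) unfolding C_space_ktopology_iff[OF assms(1)] by simp
  then obtain \<B> where "finite \<B> \<and> \<B> \<subseteq> \<A> \<and>
      (\<forall>p\<in>kspace \<A>. e \<le> \<bar>val f p - val f Infty\<bar> \<longrightarrow> (\<exists>A\<in>\<B>. p = Lim A \<or> p \<in> Pt ` A))" ..
  then show thesis by (intro that[of \<B>]) simp_all
qed

lemma C_space_one: 
  assumes "almost_disjoint \<A>"
  shows "to_bcontfun (indicator (kspace \<A>)) \<in> C_space (ktopology \<A>)"
proof (rule C_space_ktopologyI[OF assms]; unfold val_indicator)
  show "finite {x\<in>A. e \<le> \<bar>indicator (kspace \<A>) (Pt x) - indicator (kspace \<A>) (Lim A) :: real\<bar>}"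
    if "A \<in> \<A>" "0 < e" for A and e :: real
  proof -
    have "Pt x \<in> kspace \<A>" if "x \<in> A" for x using that \<open>A \<in> \<A>\<close> by (auto simp: kspace_def)
    moreover have "Lim A \<in> kspace \<A>" using that by (simp add: kspace_def)
    ultimately have "{x\<in>A. e \<le> \<bar>indicator (kspace \<A>) (Pt x) - indicator (kspace \<A>) (Lim A) :: real\<bar>} = {}"
      using that(2) by auto
    then show ?thesis by (simp only: finite.emptyI)
  qed
  show "\<exists>\<B>. finite \<B> \<and> \<B> \<subseteq> \<A> \<and> (\<forall>p\<in>kspace \<A>. e \<le> \<bar>indicator (kspace \<A>) p - indicator (kspace \<A>) Infty :: real\<bar>
     \<longrightarrow> (\<exists>A\<in>\<B>. p = Lim A \<or> p \<in> Pt ` A))" if "0 < e" for e :: real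
    using that by (intro exI[of _ "{}"]) (auto simp: kspace_def)
qed simp

lemma C_space_Lim_indicator:
  assumes "almost_disjoint \<A>" "A \<in> \<A>"
  shows "to_bcontfun (indicator ({Lim A} \<union> Pt ` A)) \<in> C_space (ktopology \<A>)"
proof (rule C_space_ktopologyI[OF assms(1)]; unfold val_indicator)
  let ?S = "{Lim A} \<union> Pt ` A"
  show "indicator ?S p = (0::real)" if "p \<notin> kspace \<A>" for p
    using that assms(2) by (auto simp: kspace_def indicator_def)
  show "finite {x\<in>B. e \<le> \<bar>indicator ?S (Pt x) - indicator ?S (Lim B) :: real\<bar>}"
    if "B \<in> \<A>" "0 < e" for B and e :: real
  proof (cases "B = A")
    case True
    then have "{x\<in>B. e \<le> \<bar>indicator ?S (Pt x) - indicator ?S (Lim B) :: real\<bar>} = {}"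
      using that(2) by auto
    then show ?thesis by (simp only: finite.emptyI)
  next
    case False
    have "pairwise (\<lambda>A B. finite (A \<inter> B)) \<A>" using assms(1) by (simp add: almost_disjoint_def)
    then have "finite (B \<inter> A)" using False that(1) assms(2) by (simp add: pairwise_def)
    moreover have "{x\<in>B. e \<le> \<bar>indicator ?S (Pt x) - indicator ?S (Lim B) :: real\<bar>} \<subseteq> B \<inter> A"
      using that(2) False by (auto simp: indicator_def split: if_splits)
    ultimately show ?thesis by (rule finite_subset[rotated])
  qed
  show "\<exists>\<B>. finite \<B> \<and> \<B> \<subseteq> \<A> \<and> (\<forall>p\<in>kspace \<A>. e \<le> \<bar>indicator ?S p - indicator ?S Infty :: real\<bar>
     \<longrightarrow> (\<exists>A\<in>\<B>. p = Lim A \<or> p \<in> Pt ` A))" if "0 < e" for e :: real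
    using that assms(2) by (intro exI[of _ "{A}"]) (auto simp: indicator_def split: if_splits)
qed

lemma C_space_Pt_indicator:
  assumes "almost_disjoint \<A>" "x \<in> \<Union>\<A>"
  shows "to_bcontfun (indicator {Pt x}) \<in> C_space (ktopology \<A>)"
proof (rule C_space_ktopologyI[OF assms(1)]; unfold val_indicator)
  show "indicator {Pt x} p = (0::real)" if "p \<notin> kspace \<A>" for p
    using that assms(2) by (auto simp: kspace_def indicator_def)
  show "finite {y\<in>B. e \<le> \<bar>indicator {Pt x} (Pt y) - indicator {Pt x} (Lim B) :: real\<bar>}"
    if "0 < e" for B and e :: real
  proof (rule finite_subset)
    show "{y\<in>B. e \<le> \<bar>indicator {Pt x} (Pt y) - indicator {Pt x} (Lim B) :: real\<bar>} \<subseteq> {x}"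
      using that by (auto simp: indicator_def split: if_splits)
  qed simp
  obtain A where A: "A \<in> \<A>" "x \<in> A" using assms(2) by blast
  show "\<exists>\<B>. finite \<B> \<and> \<B> \<subseteq> \<A> \<and> (\<forall>p\<in>kspace \<A>. e \<le> \<bar>indicator {Pt x} p - indicator {Pt x} Infty :: real\<bar>
     \<longrightarrow> (\<exists>A\<in>\<B>. p = Lim A \<or> p \<in> Pt ` A))" if "0 < e" for e :: real
    using that A by (intro exI[of _ "{A}"]) (auto simp: indicator_def split: if_splits)
qed

section \<open>Functions that are constant off a subset of \<open>K\<^sub>\<A>\<close>\<close>

definition const_off :: "'a set set \<Rightarrow> 'a kpoint set \<Rightarrow> ('a kpoint discrete \<Rightarrow>\<^sub>C real) set" where
  "const_off \<A> W = {f \<in> C_space (ktopology \<A>). \<forall>p\<in>kspace \<A> - W. val f p = val f Infty}"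

text \<open>
  The constant 1, the indicators of the clopen sets \<open>A \<union> {l\<^sub>A}\<close>, and the indicators of isolated points.
\<close>

definition generators :: "'a set set \<Rightarrow> 'a kpoint set \<Rightarrow> ('a kpoint discrete \<Rightarrow>\<^sub>C real) set" where
  "generators \<A> W = {to_bcontfun (indicator (kspace \<A>))}
    \<union> (\<lambda>A. to_bcontfun (indicator ({Lim A} \<union> Pt ` A))) ` {A\<in>\<A>. Lim A \<in> W}
    \<union> (\<lambda>x. to_bcontfun (indicator {Pt x})) ` {x\<in>\<Union>\<A>. Pt x \<in> W}"

lemma const_offD:
  assumes "f \<in> const_off \<A> W"
  shows "f \<in> C_space (ktopology \<A>)" "\<And>p. p \<in> kspace \<A> \<Longrightarrow> p \<notin> W \<Longrightarrow> val f p = val f Infty"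
  using assms by (auto simp: const_off_def)

lemma const_off_mono: "V \<subseteq> W \<Longrightarrow> const_off \<A> V \<subseteq> const_off \<A> W"
  by (auto simp: const_off_def)

lemma subspace_const_off: "subspace (const_off \<A> W)"
  unfolding subspace_def const_off_def
  using subspace_C_space[of "ktopology \<A>"] by (simp add: subspace_def)

lemma tendsto_val:
  assumes "f \<longlonglongrightarrow> g"
  shows "(\<lambda>n. val (f n) p) \<longlonglongrightarrow> val g p"
  using tendsto_bcontfun_uniform_limit[OF assms] by (rule tendsto_uniform_limitI) simp

lemma closed_const_off: "closed (const_off \<A> W)"
  unfolding closed_sequential_limits
proof (intro allI impI, elim conjE)
  fix f g assume f: "\<forall>n. f n \<in> const_off \<A> W" and lim: "f \<longlonglongrightarrow> g"
  have "g \<in> C_space (ktopology \<A>)"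
    using closed_sequentially[OF closed_C_space _ lim] const_offD(1) f by blast
  moreover have "val g p = val g Infty" if "p \<in> kspace \<A> - W" for p
  proof (rule LIMSEQ_unique)
    show "(\<lambda>n. val (f n) p) \<longlonglongrightarrow> val g p" using tendsto_val[OF lim] .
    have "val (f n) p = val (f n) Infty" for n using const_offD(2) f that by blast
    then show "(\<lambda>n. val (f n) p) \<longlonglongrightarrow> val g Infty" using tendsto_val[OF lim, of Infty] by simp
  qed
  ultimately show "g \<in> const_off \<A> W" by (simp add: const_off_def)
qed

lemma generators_subset_const_off:
  assumes "almost_disjoint \<A>" "\<And>A. A \<in> \<A> \<Longrightarrow> Lim A \<in> W \<Longrightarrow> Pt ` A \<subseteq> W"
  shows "generators \<A> W \<subseteq> const_off \<A> W"
proof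
  fix f assume "f \<in> generators \<A> W"
  then consider "f = to_bcontfun (indicator (kspace \<A>))"
    | A where "A \<in> \<A>" "Lim A \<in> W" "f = to_bcontfun (indicator ({Lim A} \<union> Pt ` A))"
    | x where "x \<in> \<Union>\<A>" "Pt x \<in> W" "f = to_bcontfun (indicator {Pt x})"
    unfolding generators_def by blast
  then show "f \<in> const_off \<A> W"
  proof cases
    case 1
    then show ?thesis using C_space_one[OF assms(1)]
      by (simp add: const_off_def val_indicator) (simp add: kspace_def)
  next
    case 2
    have "p \<notin> {Lim A} \<union> Pt ` A" if "p \<notin> W" for p using assms(2)[OF 2(1,2)] 2(2) that by blast
    then show ?thesis using C_space_Lim_indicator[OF assms(1) 2(1)]
      unfolding const_off_def 2(3) by (simp add: val_indicator indicator_def image_iff)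
  next
    case 3
    have "p \<noteq> Pt x" if "p \<notin> W" for p using 3(2) that by blast
    then show ?thesis using C_space_Pt_indicator[OF assms(1) 3(1)]
      unfolding const_off_def 3(3) by (simp add: val_indicator)
  qed
qed

text \<open>
  Off finitely many \<open>A\<close> the function \<open>f\<close> is nearly \<open>f(\<infinity>)\<close>. Subtracting \<open>f(\<infinity>)\<close> and the multiples
  \<open>f(l\<^sub>A) - f(\<infinity>)\<close> of the indicators of these \<open>A \<union> {l\<^sub>A}\<close> leaves a function that tends to \<open>0\<close> along
  each of them, hence has absolute value at least \<open>e\<close> at finitely many isolated points only; these are
  corrected one by one. Only those \<open>A\<close> with \<open>l\<^sub>A \<in> W\<close>
  have a nonzero coefficient, which keeps all generators within \<open>W\<close>.
\<close>

lemma const_off_eq_closure_span: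
  assumes ad: "almost_disjoint \<A>"
    and W: "\<And>A. A \<in> \<A> \<Longrightarrow> Lim A \<in> W \<Longrightarrow> Pt ` A \<subseteq> W"
  shows "const_off \<A> W = closure (span (generators \<A> W))"
proof -
  have gen: "span (generators \<A> W) \<subseteq> const_off \<A> W"
    using generators_subset_const_off[OF ad W] subspace_const_off by (intro span_minimal) simp_all
  have "const_off \<A> W \<subseteq> closure (span (generators \<A> W))"
  proof
    fix f assume f: "f \<in> const_off \<A> W"
    let ?one = "to_bcontfun (indicator (kspace \<A>))"
    let ?chi = "\<lambda>A. to_bcontfun (indicator ({Lim A} \<union> Pt ` A))"
    let ?pt = "\<lambda>x. to_bcontfun (indicator {Pt x})"
    have "\<exists>g\<in>span (generators \<A> W). dist g f < d" if "d > 0" for d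
    proof -
      define e where "e = d / 2"
      have e: "e > 0" "e < d" using that by (auto simp: e_def)
      obtain \<B> where \<B>: "finite \<B>" "\<B> \<subseteq> \<A>"
        "\<forall>p\<in>kspace \<A>. e \<le> \<bar>val f p - val f Infty\<bar> \<longrightarrow> (\<exists>A\<in>\<B>. p = Lim A \<or> p \<in> Pt ` A)"
        by (rule far_from_Infty_covered[OF ad const_offD(1)[OF f] e(1)])
      define \<B>' where "\<B>' = {A\<in>\<B>. Lim A \<in> W}"
      have fB': "finite \<B>'" using \<B>(1) by (simp add: \<B>'_def)
      define g where "g = val f Infty *\<^sub>R ?one + (\<Sum>A\<in>\<B>'. (val f (Lim A) - val f Infty) *\<^sub>R ?chi A)"
      have g: "g \<in> span (generators \<A> W)"
        unfolding g_def using \<B>(2)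
        by (intro span_add span_scale span_sum span_base) (auto simp: generators_def \<B>'_def)
      define h where "h = f - g"
      have "g \<in> const_off \<A> W"
        using g gen by blast
      then have h: "h \<in> const_off \<A> W"
        unfolding h_def by (rule subspace_diff[OF subspace_const_off f])
      note hE = const_offD(1)[OF h]
      have valh: "val h p = val f p - val f Infty - (\<Sum>A\<in>\<B>'. (val f (Lim A) - val f Infty) * indicator ({Lim A} \<union> Pt ` A) p)"
        if "p \<in> kspace \<A>" for p
        unfolding h_def g_def using that by (simp add: val_sum val_indicator)
      have hInf: "val h Infty = 0"
      proof -
        have "Infty \<in> kspace \<A>" by (simp add: kspace_def)
        moreover have "indicator ({Lim A} \<union> Pt ` A) Infty = (0::real)" for A :: "'a set"
          by (auto simp: indicator_def)
        ultimately show ?thesis using valh by simp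
      qed
      have hLim: "\<bar>val h (Lim A)\<bar> < e" "A \<in> \<B> \<Longrightarrow> val h (Lim A) = 0" if A: "A \<in> \<A>" for A
      proof -
        have K: "Lim A \<in> kspace \<A>" using A by (simp add: kspace_def)
        have "indicator ({Lim B} \<union> Pt ` B) (Lim A) = (if B = A then 1 else (0::real))" for B
          by (auto simp: indicator_def)
        then have *: "val h (Lim A) = val f (Lim A) - val f Infty -
            (if A \<in> \<B>' then val f (Lim A) - val f Infty else 0)"
          using valh[OF K] fB' by (simp add: if_distrib[of "\<lambda>x. _ * x"] sum.delta cong: if_cong)
        have off: "val f (Lim A) = val f Infty" if "Lim A \<notin> W" using const_offD(2)[OF f K that] .
        have far: "\<bar>val f (Lim A) - val f Infty\<bar> < e" if "A \<notin> \<B>"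
        proof (rule ccontr)
          assume "\<not> ?thesis"
          then obtain B where "B \<in> \<B>" "Lim A = Lim B \<or> Lim A \<in> Pt ` B" using \<B>(3) K by auto
          then show False using that by auto
        qed
        show "val h (Lim A) = 0" if "A \<in> \<B>" using * off that by (auto simp: \<B>'_def)
        then show "\<bar>val h (Lim A)\<bar> < e" using * off far e(1) by (cases "A \<in> \<B>") (auto simp: \<B>'_def)
      qed
      \<comment> \<open>The isolated points where the remainder is still large.\<close>
      define Z where "Z = {x\<in>\<Union>\<A>. e \<le> \<bar>val h (Pt x)\<bar>}"
      have "Z \<subseteq> (\<Union>A\<in>\<B>. {x\<in>A. e \<le> \<bar>val h (Pt x) - val h (Lim A)\<bar>})"
      proof
        fix x assume x: "x \<in> Z"
        then have K: "Pt x \<in> kspace \<A>" by (auto simp: kspace_def Z_def)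
        have "\<exists>A\<in>\<B>. x \<in> A"
        proof (rule ccontr)
          assume no: "\<not> ?thesis"
          then have "indicator ({Lim A} \<union> Pt ` A) (Pt x) = (0::real)" if "A \<in> \<B>'" for A
            using that by (auto simp: indicator_def \<B>'_def)
          then have "val h (Pt x) = val f (Pt x) - val f Infty" using valh[OF K] by simp
          then have "e \<le> \<bar>val f (Pt x) - val f Infty\<bar>" using x by (simp add: Z_def)
          then obtain A where "A \<in> \<B>" "Pt x = Lim A \<or> Pt x \<in> Pt ` A" using \<B>(3) K by blast
          then show False using no by auto
        qed
        then obtain A where A: "A \<in> \<B>" "x \<in> A" by blast
        then have "val h (Lim A) = 0" using hLim(2) \<B>(2) by blast
        then have "x \<in> {x\<in>A. e \<le> \<bar>val h (Pt x) - val h (Lim A)\<bar>}" using x A by (simp add: Z_def)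
        then show "x \<in> (\<Union>A\<in>\<B>. {x\<in>A. e \<le> \<bar>val h (Pt x) - val h (Lim A)\<bar>})" using A(1) by blast
      qed
      moreover have "finite (\<Union>A\<in>\<B>. {x\<in>A. e \<le> \<bar>val h (Pt x) - val h (Lim A)\<bar>})"
        using \<B>(1,2) finite_far_from_Lim[OF ad hE _ e(1)] by (intro finite_UN_I) auto
      ultimately have fZ: "finite Z" by (rule finite_subset)
      define k where "k = (\<Sum>x\<in>Z. val h (Pt x) *\<^sub>R ?pt x)"
      have ZW: "Pt x \<in> W" if "x \<in> Z" for x
      proof (rule ccontr)
        assume "Pt x \<notin> W"
        moreover have "Pt x \<in> kspace \<A>" using that by (auto simp: kspace_def Z_def)
        ultimately have "val h (Pt x) = 0" using const_offD(2)[OF h, of "Pt x"] hInf by simp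
        then show False using that e(1) by (simp add: Z_def)
      qed
      have k: "k \<in> span (generators \<A> W)"
        unfolding k_def using ZW
        by (intro span_scale span_sum span_base) (auto simp: generators_def Z_def)
      have valk: "val k p = (\<Sum>x\<in>Z. val h (Pt x) * indicator {Pt x} p)" for p
        unfolding k_def by (simp add: val_sum val_indicator)
      have "norm (h - k) \<le> e"
      proof (rule norm_le_val)
        fix p
        show "\<bar>val (h - k) p\<bar> \<le> e"
        proof (cases p)
          case (Pt y)
          have "val k p = (\<Sum>x\<in>Z. if x = y then val h (Pt y) else 0)"
            unfolding valk Pt by (intro sum.cong) auto
          also have "\<dots> = (if y \<in> Z then val h (Pt y) else 0)" using fZ by (simp add: sum.delta')
          finally have k: "val k p = (if y \<in> Z then val h (Pt y) else 0)" .
          show ?thesis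
          proof (cases "y \<in> \<Union>\<A>")
            case True
            then show ?thesis using k e(1) Pt by (auto simp: Z_def)
          next
            case False
            then have "p \<notin> kspace \<A>" by (auto simp: kspace_def Pt)
            then have "val h p = 0" using val_outside_kspace[OF hE] by blast
            then show ?thesis using k e(1) Pt False by (auto simp: Z_def)
          qed
        next
          case (Lim A)
          have "val k p = 0" unfolding valk Lim by simp
          moreover have "\<bar>val h p\<bar> \<le> e"
          proof (cases "A \<in> \<A>")
            case True
            then show ?thesis using hLim(1) Lim by (simp add: less_imp_le)
          next
            case False
            then have "p \<notin> kspace \<A>" by (auto simp: kspace_def Lim)
            then show ?thesis using val_outside_kspace[OF hE, of p] e(1) by simp
          qed
          ultimately show ?thesis by simp
        next
          case Infty
          have "val k p = 0" unfolding valk Infty by simp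
          then show ?thesis using hInf e(1) Infty by simp
        qed
      qed
      moreover have "norm (f - (g + k)) = norm (h - k)" by (simp add: h_def algebra_simps)
      ultimately have "dist (g + k) f < d" using e(2) by (simp add: dist_norm norm_minus_commute)
      then show ?thesis using span_add[OF g k] by blast
    qed
    then show "f \<in> closure (span (generators \<A> W))" by (simp add: closure_approachable)
  qed
  moreover have "closure (span (generators \<A> W)) \<subseteq> const_off \<A> W"
    using gen closed_const_off by (rule closure_minimal)
  ultimately show ?thesis by (rule subset_antisym)
qed

lemma countable_generators:
  assumes "countable W"
  shows "countable (generators \<A> W)"
proof -
  have "countable (Lim ` {A\<in>\<A>. Lim A \<in> W})" "countable (Pt ` {x\<in>\<Union>\<A>. Pt x \<in> W})"
    by (rule countable_subset[OF _ assms], blast)+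
  then have "countable {A\<in>\<A>. Lim A \<in> W}" "countable {x\<in>\<Union>\<A>. Pt x \<in> W}"
    by (simp_all add: countable_image_inj_eq inj_on_def)
  then show ?thesis unfolding generators_def by simp
qed

text \<open>
  For each \<open>n\<close>, the points where \<open>f\<close> differs from \<open>f(\<infinity>)\<close> by at least \<open>1/(n+1)\<close> lie in finitely many
  sets \<open>A \<union> {l\<^sub>A}\<close>.
\<close>

lemma countable_support:
  assumes ad: "almost_disjoint \<A>" and c: "\<And>A. A \<in> \<A> \<Longrightarrow> countable A"
    and f: "f \<in> C_space (ktopology \<A>)"
  shows "countable {p\<in>kspace \<A>. val f p \<noteq> val f Infty}"
proof -
  have "\<exists>S. countable S \<and> {p\<in>kspace \<A>. 1 / real (Suc n) \<le> \<bar>val f p - val f Infty\<bar>} \<subseteq> S" for n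
  proof -
    have pos: "0 < 1 / real (Suc n)" by simp
    obtain \<B> where \<B>: "finite \<B>" "\<B> \<subseteq> \<A>"
        "\<forall>p\<in>kspace \<A>. 1 / real (Suc n) \<le> \<bar>val f p - val f Infty\<bar> \<longrightarrow> (\<exists>A\<in>\<B>. p = Lim A \<or> p \<in> Pt ` A)"
      by (rule far_from_Infty_covered[OF ad f pos])
    have "countable ({Lim A} \<union> Pt ` A)" if "A \<in> \<B>" for A using c \<B>(2) that by blast
    then have "countable (\<Union>A\<in>\<B>. {Lim A} \<union> Pt ` A)"
      using countable_finite[OF \<B>(1)] by (intro countable_UN)
    moreover have "{p\<in>kspace \<A>. 1 / real (Suc n) \<le> \<bar>val f p - val f Infty\<bar>} \<subseteq> (\<Union>A\<in>\<B>. {Lim A} \<union> Pt ` A)"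
      using \<B>(3) by blast
    ultimately show ?thesis by blast
  qed
  then have "\<forall>n. \<exists>S. countable S \<and> {p\<in>kspace \<A>. 1 / real (Suc n) \<le> \<bar>val f p - val f Infty\<bar>} \<subseteq> S" ..
  then obtain S where
    "\<forall>n. countable (S n) \<and> {p\<in>kspace \<A>. 1 / real (Suc n) \<le> \<bar>val f p - val f Infty\<bar>} \<subseteq> S n"
    by (rule choice[THEN exE])
  then have S: "\<And>n. countable (S n)"
    "\<And>n. {p\<in>kspace \<A>. 1 / real (Suc n) \<le> \<bar>val f p - val f Infty\<bar>} \<subseteq> S n" by simp_all
  have "{p\<in>kspace \<A>. val f p \<noteq> val f Infty} \<subseteq> (\<Union>n. S n)"
  proof
    fix p assume p: "p \<in> {p\<in>kspace \<A>. val f p \<noteq> val f Infty}"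
    then have "0 < \<bar>val f p - val f Infty\<bar>" by simp
    then obtain n where "1 / real (Suc n) < \<bar>val f p - val f Infty\<bar>"
      using nat_approx_posE by blast
    then have "p \<in> S n" using S(2)[of n] p by auto
    then show "p \<in> (\<Union>n. S n)" by blast
  qed
  then show ?thesis using S(1) by (auto elim: countable_subset)
qed

definition truncate :: "'a set set \<Rightarrow> 'a kpoint set \<Rightarrow> ('a kpoint discrete \<Rightarrow>\<^sub>C real) \<Rightarrow> ('a kpoint discrete \<Rightarrow>\<^sub>C real)" where
  "truncate \<A> V f = to_bcontfun (\<lambda>p. if p \<in> kspace \<A> then if p \<in> V then val f p else val f Infty else 0)"

lemma val_truncate: "val (truncate \<A> V f) p = (if p \<in> kspace \<A> then if p \<in> V then val f p else val f Infty else 0)"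
  unfolding truncate_def by (rule val_to_bcontfun[of _ "norm f"]) (simp add: abs_val_le_norm)

text \<open>
  The two finiteness conditions say that no \<open>l\<^sub>A\<close> is a boundary point of \<open>V\<close>; at \<open>\<infinity>\<close> truncation only
  brings values closer to \<open>f(\<infinity>)\<close>.
\<close>

lemma truncate_in_C_space:
  assumes ad: "almost_disjoint \<A>" and f: "f \<in> C_space (ktopology \<A>)"
    and V: "\<And>A. A \<in> \<A> \<Longrightarrow> Lim A \<in> V \<Longrightarrow> finite {x\<in>A. Pt x \<notin> V}"
      "\<And>A. A \<in> \<A> \<Longrightarrow> Lim A \<notin> V \<Longrightarrow> finite {x\<in>A. Pt x \<in> V}"
  shows "truncate \<A> V f \<in> C_space (ktopology \<A>)"
proof (rule C_space_ktopologyI[OF ad])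
  show "finite {x\<in>A. e \<le> \<bar>val (truncate \<A> V f) (Pt x) - val (truncate \<A> V f) (Lim A)\<bar>}"
    if A: "A \<in> \<A>" and e: "0 < e" for A and e :: real
  proof -
    have K: "Lim A \<in> kspace \<A>" "\<And>x. x \<in> A \<Longrightarrow> Pt x \<in> kspace \<A>" using A by (auto simp: kspace_def)
    show ?thesis
    proof (cases "Lim A \<in> V")
      case True
      have "{x\<in>A. e \<le> \<bar>val (truncate \<A> V f) (Pt x) - val (truncate \<A> V f) (Lim A)\<bar>} \<subseteq>
        {x\<in>A. Pt x \<notin> V} \<union> {x\<in>A. e \<le> \<bar>val f (Pt x) - val f (Lim A)\<bar>}"
        using True K by (auto simp: val_truncate)
      moreover have "finite ({x\<in>A. Pt x \<notin> V} \<union> {x\<in>A. e \<le> \<bar>val f (Pt x) - val f (Lim A)\<bar>})"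
        using V(1)[OF A True] finite_far_from_Lim[OF ad f A e] by simp
      ultimately show ?thesis by (rule finite_subset)
    next
      case False
      have "{x\<in>A. e \<le> \<bar>val (truncate \<A> V f) (Pt x) - val (truncate \<A> V f) (Lim A)\<bar>} \<subseteq> {x\<in>A. Pt x \<in> V}"
        using False K e by (auto simp: val_truncate)
      then show ?thesis using V(2)[OF A False] by (rule finite_subset)
    qed
  qed
  show "\<exists>\<B>. finite \<B> \<and> \<B> \<subseteq> \<A> \<and> (\<forall>p\<in>kspace \<A>. e \<le> \<bar>val (truncate \<A> V f) p - val (truncate \<A> V f) Infty\<bar>
     \<longrightarrow> (\<exists>A\<in>\<B>. p = Lim A \<or> p \<in> Pt ` A))" if e: "0 < e" for e :: real
  proof -
    obtain \<B> where \<B>: "finite \<B>" "\<B> \<subseteq> \<A>"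
        "\<forall>p\<in>kspace \<A>. e \<le> \<bar>val f p - val f Infty\<bar> \<longrightarrow> (\<exists>A\<in>\<B>. p = Lim A \<or> p \<in> Pt ` A)"
      by (rule far_from_Infty_covered[OF ad f e])
    have "Infty \<in> kspace \<A>" by (simp add: kspace_def)
    then have "e \<le> \<bar>val f p - val f Infty\<bar>"
      if "p \<in> kspace \<A>" "e \<le> \<bar>val (truncate \<A> V f) p - val (truncate \<A> V f) Infty\<bar>" for p
      using that e by (auto simp: val_truncate split: if_splits)
    then show ?thesis using \<B> by (intro exI[of _ \<B>] conjI ballI impI) simp_all
  qed
qed (simp add: val_truncate)

section \<open>The ladder space and its canonical skeleton\<close>

definition rung :: "omega1 \<Rightarrow> real set" where
  "rung \<delta> = Rep_omega1 ` ladder \<delta>"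

definition ladder_family :: "real set set" where
  "ladder_family = rung ` {\<delta>. limit_ordinal \<delta>}"

abbreviation point :: "omega1 \<Rightarrow> real kpoint" where "point x \<equiv> Pt (Rep_omega1 x)"
abbreviation limit_of :: "omega1 \<Rightarrow> real kpoint" where "limit_of \<delta> \<equiv> Lim (rung \<delta>)"
abbreviation ladder_space :: "real kpoint set" where "ladder_space \<equiv> kspace ladder_family"
abbreviation C_ladder :: "(real kpoint discrete \<Rightarrow>\<^sub>C real) set" where
  "C_ladder \<equiv> C_space (ktopology ladder_family)"

lemma image_Pt_rung: "Pt ` rung \<delta> = point ` ladder \<delta>"
  by (auto simp: rung_def)

lemma infinite_rung:
  assumes "limit_ordinal \<delta>"
  shows "infinite (rung \<delta>)"
proof -
  have "inj_on Rep_omega1 (ladder \<delta>)" by (simp add: inj_on_def Rep_omega1_inject)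
  then show ?thesis unfolding rung_def using ladder(2)[OF assms] finite_image_iff by blast
qed

lemma finite_rung_Int:
  assumes "limit_ordinal \<delta>" "limit_ordinal \<epsilon>" "\<delta> \<noteq> \<epsilon>"
  shows "finite (rung \<delta> \<inter> rung \<epsilon>)"
proof -
  have "rung \<delta> \<inter> rung \<epsilon> = Rep_omega1 ` (ladder \<delta> \<inter> ladder \<epsilon>)"
    by (auto simp: rung_def Rep_omega1_inject)
  then show ?thesis using finite_ladder_Int[OF assms] by simp
qed

lemma rung_inject:
  assumes "limit_ordinal \<delta>" "limit_ordinal \<epsilon>" "rung \<delta> = rung \<epsilon>"
  shows "\<delta> = \<epsilon>"
  using finite_rung_Int[OF assms(1,2)] infinite_rung[OF assms(1)] assms(3) by auto

lemma almost_disjoint_ladder_family: "almost_disjoint ladder_family"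
  unfolding almost_disjoint_def
proof (intro conjI ballI pairwiseI)
  show "infinite A" if "A \<in> ladder_family" for A
    using that infinite_rung by (auto simp: ladder_family_def)
  show "finite (A \<inter> B)" if "A \<in> ladder_family" "B \<in> ladder_family" "A \<noteq> B" for A B
    using that finite_rung_Int by (auto simp: ladder_family_def)
qed

lemma countable_rung:
  assumes "limit_ordinal \<delta>"
  shows "countable (rung \<delta>)"
  unfolding rung_def
  using countable_subset[OF ladder(1)[OF assms] countable_lessThan_omega1] by simp

lemma countable_ladder_family: "A \<in> ladder_family \<Longrightarrow> countable A"
  using countable_rung by (auto simp: ladder_family_def)

lemma Infty_in_ladder_space: "Infty \<in> ladder_space" by (simp add: kspace_def)

lemma limit_of_in_ladder_space: "limit_ordinal \<delta> \<Longrightarrow> limit_of \<delta> \<in> ladder_space"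
  by (simp add: kspace_def ladder_family_def)

lemma ladder_space_cases:
  assumes "p \<in> ladder_space"
  obtains "p = Infty" | \<delta> where "limit_ordinal \<delta>" "p = limit_of \<delta>" | x where "p = point x"
  using assms by (auto simp: kspace_def ladder_family_def rung_def)

text \<open>
  Points of \<open>\<omega>\<^sub>1\<close> that belong to no ladder are included although they are not points of the space:
  functions vanish there, and membership in \<open>below \<alpha>\<close> then depends on the order alone.
\<close>

definition below :: "omega1 \<Rightarrow> real kpoint set" where
  "below \<alpha> = point ` {..<\<alpha>} \<union> limit_of ` {\<delta>. limit_ordinal \<delta> \<and> \<delta> < \<alpha>}"

text \<open>
  The union of \<open>below \<alpha>\<close> and the limit point of the ladder at \<open>\<alpha>\<close>, if there is one. Unlike
  \<open>below \<alpha>\<close>, it has no boundary point except \<open>\<infinity>\<close>.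
\<close>

definition upto :: "omega1 \<Rightarrow> real kpoint set" where
  "upto \<alpha> = point ` {..<\<alpha>} \<union> limit_of ` {\<delta>. limit_ordinal \<delta> \<and> \<delta> \<le> \<alpha>}"

lemma point_in_below [simp]: "point x \<in> below \<alpha> \<longleftrightarrow> x < \<alpha>" and point_in_upto [simp]: "point x \<in> upto \<alpha> \<longleftrightarrow> x < \<alpha>"
  by (auto simp: below_def upto_def Rep_omega1_inject)

lemma Infty_notin_below [simp]: "Infty \<notin> below \<alpha>" and Infty_notin_upto [simp]: "Infty \<notin> upto \<alpha>"
  by (auto simp: below_def upto_def)

lemma limit_of_in_below: "limit_ordinal \<delta> \<Longrightarrow> limit_of \<delta> \<in> below \<alpha> \<longleftrightarrow> \<delta> < \<alpha>"
  by (auto simp: below_def dest: rung_inject)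

lemma limit_of_in_upto: "limit_ordinal \<delta> \<Longrightarrow> limit_of \<delta> \<in> upto \<alpha> \<longleftrightarrow> \<delta> \<le> \<alpha>"
  by (auto simp: upto_def dest: rung_inject)

lemma below_subset_upto: "below \<alpha> \<subseteq> upto \<alpha>" by (auto simp: below_def upto_def)

lemma upto_minus_below:
  assumes "p \<in> upto \<alpha>" "p \<notin> below \<alpha>"
  shows "limit_ordinal \<alpha>" "p = limit_of \<alpha>"
  using assms by (auto simp: below_def upto_def le_less)

lemma below_mono: "\<alpha> \<le> \<beta> \<Longrightarrow> below \<alpha> \<subseteq> below \<beta>" by (force simp: below_def)

lemma upto_mono: "\<alpha> \<le> \<beta> \<Longrightarrow> upto \<alpha> \<subseteq> upto \<beta>" by (force simp: upto_def)

lemma countable_below: "countable (below \<alpha>)"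
proof -
  have "{\<delta>. limit_ordinal \<delta> \<and> \<delta> < \<alpha>} \<subseteq> {..<\<alpha>}" by auto
  then show ?thesis unfolding below_def
    using countable_lessThan_omega1[of \<alpha>] countable_subset by (intro countable_Un countable_image) blast+
qed

lemma below_lub:
  assumes "\<And>c. c \<in> C \<Longrightarrow> c \<le> s" "\<And>b. b < s \<Longrightarrow> \<exists>c\<in>C. b < c"
  shows "below s = (\<Union>c\<in>C. below c)"
proof
  show "(\<Union>c\<in>C. below c) \<subseteq> below s" using below_mono assms(1) by blast
  show "below s \<subseteq> (\<Union>c\<in>C. below c)"
  proof
    fix p assume "p \<in> below s"
    then consider x where "p = point x" "x < s" | \<delta> where "p = limit_of \<delta>" "limit_ordinal \<delta>" "\<delta> < s"
      by (auto simp: below_def)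
    then show "p \<in> (\<Union>c\<in>C. below c)"
    proof cases
      case 1
      then show ?thesis using assms(2)[of x] by auto
    next
      case 2
      then show ?thesis using assms(2)[of \<delta>] limit_of_in_below by auto
    qed
  qed
qed

lemma rung_subset_below:
  assumes "A \<in> ladder_family" "Lim A \<in> below \<alpha>"
  shows "Pt ` A \<subseteq> below \<alpha>"
proof -
  obtain \<delta> where \<delta>: "limit_ordinal \<delta>" "A = rung \<delta>" using assms(1) by (auto simp: ladder_family_def)
  then have "\<delta> < \<alpha>" using assms(2) limit_of_in_below by simp
  then show ?thesis unfolding \<delta>(2) image_Pt_rung using ladder(1)[OF \<delta>(1)] by auto
qed

lemma ladder_space_covered_by_below: 
  assumes "p \<in> ladder_space" "p \<noteq> Infty"
  shows "\<exists>\<alpha>. p \<in> below \<alpha>"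
proof -
  have ex: "\<exists>\<alpha>. x < \<alpha>" for x :: omega1 using ex_nonlimit_above[of x] by blast
  from assms(1) show ?thesis
    by (cases rule: ladder_space_cases) (use assms(2) ex limit_of_in_below in auto)
qed

abbreviation C_below :: "omega1 \<Rightarrow> (real kpoint discrete \<Rightarrow>\<^sub>C real) set" where
  "C_below \<alpha> \<equiv> const_off ladder_family (below \<alpha>)"

lemma C_below_eq_closure_span: "C_below \<alpha> = closure (span (generators ladder_family (below \<alpha>)))"
  using almost_disjoint_ladder_family rung_subset_below by (rule const_off_eq_closure_span)

lemma C_below_mono: "\<alpha> \<le> \<beta> \<Longrightarrow> C_below \<alpha> \<subseteq> C_below \<beta>"
  by (rule const_off_mono[OF below_mono])

lemma separable_C_below: "separable_space (top_of_set (C_below \<alpha>))"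
  unfolding C_below_eq_closure_span by (rule separable_closure_span[OF countable_generators[OF countable_below]])

lemma in_some_C_below:
  assumes "f \<in> C_ladder"
  obtains \<alpha> where "f \<in> C_below \<alpha>"
proof -
  let ?S = "{p\<in>ladder_space. val f p \<noteq> val f Infty}"
  have "countable ?S"
    using almost_disjoint_ladder_family countable_ladder_family assms by (rule countable_support)
  moreover have "\<forall>p. \<exists>\<alpha>. p \<in> ?S \<longrightarrow> p \<in> below \<alpha>" using ladder_space_covered_by_below by auto
  then obtain a where a: "\<And>p. p \<in> ?S \<Longrightarrow> p \<in> below (a p)" by metis
  ultimately obtain b where b: "\<forall>c\<in>a ` ?S. c < b" using countable_bounded_omega1[of "a ` ?S"] by auto
  have "p \<in> below b" if "p \<in> ?S" for p
    using a[OF that] b that below_mono[of "a p" b] by (auto simp: less_imp_le)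
  then have "f \<in> C_below b" using assms by (auto simp: const_off_def)
  then show thesis using that by blast
qed

lemma countable_subset_C_below:
  assumes "countable D" "D \<subseteq> C_ladder"
  obtains \<alpha> where "\<beta> \<le> \<alpha>" "D \<subseteq> C_below \<alpha>"
proof -
  have "\<forall>f\<in>D. \<exists>\<alpha>. f \<in> C_below \<alpha>" using in_some_C_below assms(2) by blast
  then obtain a where a: "\<And>f. f \<in> D \<Longrightarrow> f \<in> C_below (a f)" by metis
  obtain b where b: "\<forall>c\<in>insert \<beta> (a ` D). c < b"
    using countable_bounded_omega1[of "insert \<beta> (a ` D)"] assms(1) by auto
  have "D \<subseteq> C_below b"
  proof
    fix f assume f: "f \<in> D"
    then have "a f \<le> b" using b by (simp add: less_imp_le)
    then show "f \<in> C_below b" using a[OF f] C_below_mono by blast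
  qed
  moreover have "\<beta> \<le> b" using b by (simp add: less_imp_le)
  ultimately show thesis using that by blast
qed

text \<open>
  The parameter \<open>\<beta>\<close> allows the stage to be pushed beyond any given ordinal.
\<close>

lemma separable_subset_C_below:
  assumes "separable_space (top_of_set F)" "F \<subseteq> C_ladder"
  obtains \<alpha> where "\<beta> \<le> \<alpha>" "F \<subseteq> C_below \<alpha>"
proof -
  obtain D where D: "countable D" "D \<subseteq> F" "F \<subseteq> closure D"
    using assms(1) unfolding separable_top_of_set_iff by blast
  obtain \<alpha> where \<alpha>: "\<beta> \<le> \<alpha>" "D \<subseteq> C_below \<alpha>" 
    using D(1) subset_trans[OF D(2) assms(2)] by (rule countable_subset_C_below)
  have "closure D \<subseteq> C_below \<alpha>" using \<alpha>(2) closed_const_off by (rule closure_minimal)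
  then show thesis using that \<alpha>(1) D(3) by blast
qed

text \<open>
  Every generator of the limit stage already occurs at an earlier stage, and a union of a chain of
  subspaces is a subspace.
\<close>

lemma C_below_lub:
  assumes C: "C \<noteq> {}" "\<And>c. c \<in> C \<Longrightarrow> c \<le> s" "\<And>b. b < s \<Longrightarrow> \<exists>c\<in>C. b < c"
  shows "closure (\<Union>c\<in>C. C_below c) = C_below s"
proof
  have "(\<Union>c\<in>C. C_below c) \<subseteq> C_below s" using C_below_mono C(2) by blast
  then show "closure (\<Union>c\<in>C. C_below c) \<subseteq> C_below s" using closed_const_off by (rule closure_minimal)
  have U_eq: "below s = (\<Union>c\<in>C. below c)" using C(2,3) by (rule below_lub)
  have ch: "\<exists>d\<in>C. C_below c \<subseteq> C_below d \<and> C_below c' \<subseteq> C_below d" if "c \<in> C" "c' \<in> C" for c c'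
    using C_below_mono[of c c'] C_below_mono[of c' c] that linear[of c c'] by blast
  have "subspace (\<Union>c\<in>C. C_below c)"
    unfolding subspace_def
  proof (intro conjI ballI allI)
    show "0 \<in> (\<Union>c\<in>C. C_below c)" using C(1) subspace_0[OF subspace_const_off] by blast
    fix f g assume "f \<in> (\<Union>c\<in>C. C_below c)" "g \<in> (\<Union>c\<in>C. C_below c)"
    then obtain d where "d \<in> C" "f \<in> C_below d" "g \<in> C_below d" using ch by blast
    then show "f + g \<in> (\<Union>c\<in>C. C_below c)" using subspace_add[OF subspace_const_off] by blast
  next
    fix r f assume "f \<in> (\<Union>c\<in>C. C_below c)"
    then show "r *\<^sub>R f \<in> (\<Union>c\<in>C. C_below c)" using subspace_scale[OF subspace_const_off] by blast
  qed
  moreover have "generators ladder_family (below s) \<subseteq> (\<Union>c\<in>C. C_below c)"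
  proof
    fix f assume "f \<in> generators ladder_family (below s)"
    then consider "f = to_bcontfun (indicator ladder_space)"
      | A where "A \<in> ladder_family" "Lim A \<in> below s" "f = to_bcontfun (indicator ({Lim A} \<union> Pt ` A))"
      | x where "x \<in> \<Union>ladder_family" "Pt x \<in> below s" "f = to_bcontfun (indicator {Pt x})"
      unfolding generators_def by blast
    then have "\<exists>c\<in>C. f \<in> generators ladder_family (below c)"
    proof cases
      case 1
      then show ?thesis using C(1) by (auto simp: generators_def)
    next
      case 2
      then obtain c where "c \<in> C" "Lim A \<in> below c" using U_eq by blast
      then show ?thesis using 2 unfolding generators_def by blast
    next
      case 3
      then obtain c where "c \<in> C" "Pt x \<in> below c" using U_eq by blast
      then show ?thesis using 3 unfolding generators_def by blast
    qed
    moreover have "generators ladder_family (below c) \<subseteq> C_below c" for c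
      using almost_disjoint_ladder_family rung_subset_below by (rule generators_subset_const_off)
    ultimately show "f \<in> (\<Union>c\<in>C. C_below c)" by blast
  qed
  ultimately have "span (generators ladder_family (below s)) \<subseteq> (\<Union>c\<in>C. C_below c)" by (intro span_minimal)
  then show "C_below s \<subseteq> closure (\<Union>c\<in>C. C_below c)" unfolding C_below_eq_closure_span[of s] by (rule closure_mono)
qed

text \<open>
  Taking 0 at ordinals without a ladder makes the formula for \<open>proj_below\<close> uniform in \<open>\<alpha>\<close>.
\<close>

definition hump :: "omega1 \<Rightarrow> (real kpoint discrete \<Rightarrow>\<^sub>C real)" where
  "hump \<alpha> = (if limit_ordinal \<alpha> then to_bcontfun (indicator ({limit_of \<alpha>} \<union> Pt ` rung \<alpha>)) else 0)"

definition cutoff :: "omega1 \<Rightarrow> (real kpoint discrete \<Rightarrow>\<^sub>C real) \<Rightarrow> (real kpoint discrete \<Rightarrow>\<^sub>C real)" where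
  "cutoff \<alpha> f = truncate ladder_family (upto \<alpha>) f"

text \<open>
  Truncation beyond \<open>\<alpha>\<close>, corrected at the single point of \<open>upto \<alpha> - below \<alpha>\<close>, where functions
  constant off \<open>below \<alpha>\<close> must take the value \<open>f(\<infinity>)\<close>.
\<close>

definition proj_below :: "omega1 \<Rightarrow> (real kpoint discrete \<Rightarrow>\<^sub>C real) \<Rightarrow> (real kpoint discrete \<Rightarrow>\<^sub>C real)" where
  "proj_below \<alpha> f = cutoff \<alpha> f - (val f (limit_of \<alpha>) - val f Infty) *\<^sub>R hump \<alpha>"

text \<open>
  A ladder at \<open>\<delta> \<le> \<alpha>\<close> lies below \<open>\<alpha>\<close>, and a ladder at \<open>\<delta> > \<alpha>\<close> meets \<open>\<alpha>\<close> in a finite set.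
\<close>

lemma cutoff_in_C_ladder:
  assumes "f \<in> C_ladder"
  shows "cutoff \<alpha> f \<in> C_ladder"
  unfolding cutoff_def using almost_disjoint_ladder_family assms
proof (rule truncate_in_C_space)
  fix A assume "A \<in> ladder_family"
  then obtain \<delta> where \<delta>: "limit_ordinal \<delta>" "A = rung \<delta>" by (auto simp: ladder_family_def)
  show "finite {x\<in>A. Pt x \<notin> upto \<alpha>}" if "Lim A \<in> upto \<alpha>"
  proof -
    have "\<delta> \<le> \<alpha>" using that \<delta> limit_of_in_upto by simp
    then have "{x\<in>A. Pt x \<notin> upto \<alpha>} = {}" using ladder(1)[OF \<delta>(1)] by (auto simp: \<delta>(2) rung_def)
    then show ?thesis by (simp only: finite.emptyI)
  qed
  show "finite {x\<in>A. Pt x \<in> upto \<alpha>}" if "Lim A \<notin> upto \<alpha>"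
  proof -
    have "\<alpha> < \<delta>" using that \<delta> limit_of_in_upto by simp
    then have "finite (Rep_omega1 ` (ladder \<delta> \<inter> {..<\<alpha>}))" using ladder(3)[OF \<delta>(1)] by blast
    moreover have "{x\<in>A. Pt x \<in> upto \<alpha>} \<subseteq> Rep_omega1 ` (ladder \<delta> \<inter> {..<\<alpha>})"
      by (auto simp: \<delta>(2) rung_def)
    ultimately show ?thesis by (rule finite_subset[rotated])
  qed
qed

lemma hump_in_C_ladder: "hump \<alpha> \<in> C_ladder"
proof (cases "limit_ordinal \<alpha>")
  case True
  then have "rung \<alpha> \<in> ladder_family" by (simp add: ladder_family_def)
  then show ?thesis using C_space_Lim_indicator[OF almost_disjoint_ladder_family] True by (simp add: hump_def)
next
  case False
  then show ?thesis using subspace_0[OF subspace_C_space] by (simp add: hump_def)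
qed

lemma val_hump_Infty [simp]: "val (hump \<alpha>) Infty = 0"
  by (auto simp: hump_def val_indicator indicator_def)

lemma val_hump_point: "limit_ordinal \<alpha> \<Longrightarrow> val (hump \<alpha>) (point x) = indicator (ladder \<alpha>) x"
  by (simp add: hump_def val_indicator indicator_def image_Pt_rung) (auto simp: Rep_omega1_inject)

lemma val_hump_limit_of: "limit_ordinal \<alpha> \<Longrightarrow> limit_ordinal \<delta> \<Longrightarrow> val (hump \<alpha>) (limit_of \<delta>) = (if \<delta> = \<alpha> then 1 else 0)"
  by (auto simp: hump_def val_indicator indicator_def dest: rung_inject)

lemma val_hump_outside:
  assumes "p \<notin> upto \<alpha>"
  shows "val (hump \<alpha>) p = 0"
proof (cases "limit_ordinal \<alpha>")
  case True
  have "limit_of \<alpha> \<in> upto \<alpha>" using limit_of_in_upto[OF True] by simp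
  moreover have "Pt ` rung \<alpha> \<subseteq> upto \<alpha>" unfolding image_Pt_rung using ladder(1)[OF True] by auto
  ultimately show ?thesis using assms True by (auto simp: hump_def val_indicator indicator_def)
qed (simp add: hump_def)

lemma norm_hump_le: "norm (hump \<alpha>) \<le> 1"
  by (rule norm_le_val) (auto simp: hump_def val_indicator indicator_def)

lemma proj_below_in_C_below:
  assumes "f \<in> C_ladder"
  shows "proj_below \<alpha> f \<in> C_below \<alpha>"
  unfolding const_off_def
proof (intro CollectI conjI ballI)
  show "proj_below \<alpha> f \<in> C_ladder" unfolding proj_below_def
    by (rule subspace_diff[OF subspace_C_space cutoff_in_C_ladder[OF assms] subspace_scale[OF subspace_C_space hump_in_C_ladder]])
  fix p assume p: "p \<in> ladder_space - below \<alpha>"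
  show "val (proj_below \<alpha> f) p = val (proj_below \<alpha> f) Infty"
  proof (cases "p \<in> upto \<alpha>")
    case True
    then have "limit_ordinal \<alpha>" "p = limit_of \<alpha>" using upto_minus_below p by auto
    then show ?thesis using p True Infty_in_ladder_space by (simp add: proj_below_def cutoff_def val_truncate val_hump_limit_of)
  next
    case False
    then show ?thesis using p Infty_in_ladder_space by (simp add: proj_below_def cutoff_def val_truncate val_hump_outside)
  qed
qed

lemma proj_below_fixes_C_below:
  assumes "f \<in> C_below \<alpha>"
  shows "proj_below \<alpha> f = f"
proof (rule val_eqI)
  fix p
  have "(val f (limit_of \<alpha>) - val f Infty) *\<^sub>R hump \<alpha> = 0"
  proof (cases "limit_ordinal \<alpha>")
    case True
    then have "val f (limit_of \<alpha>) = val f Infty"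
      using const_offD(2)[OF assms limit_of_in_ladder_space[OF True]] limit_of_in_below[OF True] by simp
    then show ?thesis by simp
  qed (simp add: hump_def)
  then have "val (proj_below \<alpha> f) p = val (cutoff \<alpha> f) p" by (simp only: proj_below_def diff_zero)
  also have "\<dots> = val f p"
    using val_outside_kspace[OF const_offD(1)[OF assms], of p] const_offD(2)[OF assms, of p]
      subsetD[OF below_subset_upto, of p \<alpha>]
    by (cases "p \<in> below \<alpha>") (simp_all add: cutoff_def val_truncate)
  finally show "val (proj_below \<alpha> f) p = val f p" .
qed

lemma bounded_linear_on_proj_below: "bounded_linear_on C_ladder (proj_below \<alpha>)"
  unfolding bounded_linear_on_def
proof (intro conjI ballI allI exI[of _ 3])
  show "proj_below \<alpha> (f + g) = proj_below \<alpha> f + proj_below \<alpha> g" for f g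
    by (rule val_eqI) (simp add: proj_below_def cutoff_def val_truncate algebra_simps)
  show "proj_below \<alpha> (c *\<^sub>R f) = c *\<^sub>R proj_below \<alpha> f" for c f
    by (rule val_eqI) (simp add: proj_below_def cutoff_def val_truncate algebra_simps)
  fix f
  have "norm (cutoff \<alpha> f) \<le> norm f"
    by (rule norm_le_val) (simp add: cutoff_def val_truncate abs_val_le_norm)
  moreover have "\<bar>val f (limit_of \<alpha>) - val f Infty\<bar> \<le> 2 * norm f"
    using abs_val_le_norm[of f "limit_of \<alpha>"] abs_val_le_norm[of f Infty] by linarith
  then have "norm ((val f (limit_of \<alpha>) - val f Infty) *\<^sub>R hump \<alpha>) \<le> 2 * norm f * 1"
    unfolding norm_scaleR using norm_hump_le by (intro mult_mono) auto
  ultimately show "norm (proj_below \<alpha> f) \<le> norm f * 3"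
    unfolding proj_below_def using norm_triangle_ineq4[of "cutoff \<alpha> f" "(val f (limit_of \<alpha>) - val f Infty) *\<^sub>R hump \<alpha>"] by linarith
qed

lemma projection_proj_below: "projection_on C_ladder (proj_below \<alpha>)" "proj_below \<alpha> ` C_ladder = C_below \<alpha>"
proof -
  have C_below_subset: "C_below \<alpha> \<subseteq> C_ladder" by (auto simp: const_off_def)
  show "projection_on C_ladder (proj_below \<alpha>)"
    unfolding projection_on_def using bounded_linear_on_proj_below proj_below_in_C_below proj_below_fixes_C_below C_below_subset by blast
  show "proj_below \<alpha> ` C_ladder = C_below \<alpha>"
  proof
    show "proj_below \<alpha> ` C_ladder \<subseteq> C_below \<alpha>" using proj_below_in_C_below by blast
    show "C_below \<alpha> \<subseteq> proj_below \<alpha> ` C_ladder"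
    proof
      fix f assume f: "f \<in> C_below \<alpha>"
      then have "proj_below \<alpha> f \<in> proj_below \<alpha> ` C_ladder" using C_below_subset by blast
      then show "f \<in> proj_below \<alpha> ` C_ladder" using proj_below_fixes_C_below[OF f] by simp
    qed
  qed
qed

text \<open>
  Suprema of countable sets of ordinals exist in \<open>\<omega>\<^sub>1\<close>, and \<open>C_below\<close> is continuous there.
\<close>

lemma skeleton_C_below: "skeleton C_ladder (range C_below)"
  unfolding skeleton_def
proof (intro conjI ballI allI impI)
  show "separable_space (top_of_set F)" if "F \<in> range C_below" for F using that separable_C_below by auto
  show "complemented_in C_ladder F" if "F \<in> range C_below" for F
    using that projection_proj_below unfolding complemented_in_def by blast
  show "C_ladder = \<Union>(range C_below)"
  proof
    show "C_ladder \<subseteq> \<Union>(range C_below)" using in_some_C_below by blast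
    show "\<Union>(range C_below) \<subseteq> C_ladder" by (auto simp: const_off_def)
  qed
  show "\<exists>H\<in>range C_below. F \<subseteq> H \<and> F' \<subseteq> H" if "F \<in> range C_below" "F' \<in> range C_below" for F F'
  proof -
    obtain \<alpha> \<beta> where "F = C_below \<alpha>" "F' = C_below \<beta>" using \<open>F \<in> range C_below\<close> \<open>F' \<in> range C_below\<close> by blast
    then show ?thesis using C_below_mono[of \<alpha> "max \<alpha> \<beta>"] C_below_mono[of \<beta> "max \<alpha> \<beta>"] by auto
  qed
  fix S :: "nat \<Rightarrow> (real kpoint discrete \<Rightarrow>\<^sub>C real) set"
  assume "\<forall>n. S n \<in> range C_below \<and> S n \<subseteq> S (Suc n)"
  then have "\<forall>n. \<exists>\<alpha>. S n = C_below \<alpha>" by blast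
  then obtain a where a: "\<And>n. S n = C_below (a n)" by metis
  obtain s where s: "\<And>c. c \<in> range a \<Longrightarrow> c \<le> s" "\<And>b. b < s \<Longrightarrow> \<exists>c\<in>range a. b < c"
    using countable_lub_omega1[of "range a"] by auto
  have "closure (\<Union>c\<in>range a. C_below c) = C_below s" by (rule C_below_lub) (use s in auto)
  then show "closure (\<Union>n. S n) \<in> range C_below" by (simp add: a)
qed

section \<open>Bounded operators see only countably many points\<close>

text \<open>
  Countably many functions that vanish at \<open>\<infinity>\<close> all vanish off \<open>below \<alpha>\<close> for one \<open>\<alpha>\<close>, and a function
  that vanishes on \<open>upto \<alpha>\<close> is disjoint from all of them.
\<close>

lemma functional_supported:
  assumes "bounded_linear_on C_ladder (\<phi> :: _ \<Rightarrow> real)"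
  shows "\<exists>\<alpha>. \<forall>g\<in>C_ladder. (\<forall>p\<in>insert Infty (upto \<alpha>). val g p = 0) \<longrightarrow> \<phi> g = 0"
proof -
  define C_zero where "C_zero = {f\<in>C_ladder. val f Infty = 0}"
  have "subspace C_zero"
    using subspace_C_space[of "ktopology ladder_family"] by (simp add: C_zero_def subspace_def)
  moreover have "bounded_linear_on C_zero \<phi>"
    using assms unfolding bounded_linear_on_def C_zero_def by blast
  ultimately obtain D where D: "countable D" "D \<subseteq> C_zero"
    and kill: "\<forall>g\<in>C_zero. (\<forall>f\<in>D. \<forall>p. val f p = 0 \<or> val g p = 0) \<longrightarrow> \<phi> g = 0"
    using functional_countably_supported[of C_zero \<phi>] by blast
  have "D \<subseteq> C_ladder" using D(2) by (auto simp: C_zero_def)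
  then obtain \<alpha> where \<alpha>: "D \<subseteq> C_below \<alpha>" by (rule countable_subset_C_below[OF D(1)])
  have "\<phi> g = 0" if g: "g \<in> C_ladder" "\<forall>p\<in>insert Infty (upto \<alpha>). val g p = 0" for g
  proof (rule kill[rule_format])
    show "g \<in> C_zero" using g by (simp add: C_zero_def)
    fix f p assume "f \<in> D"
    then have f: "f \<in> C_below \<alpha>" "val f Infty = 0" using \<alpha> D(2) by (auto simp: C_zero_def)
    show "val f p = 0 \<or> val g p = 0"
    proof (cases "p \<in> upto \<alpha>")
      case True
      then show ?thesis using g(2) by simp
    next
      case False
      then have "p \<notin> below \<alpha>" using below_subset_upto by blast
      then have "val f p = 0"
        using const_offD(2)[OF f(1), of p] f(2) val_outside_kspace[OF const_offD(1)[OF f(1)], of p]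
        by (cases "p \<in> ladder_space") simp_all
      then show ?thesis ..
    qed
  qed
  then show ?thesis by blast
qed

lemma vanishing_mono:
  assumes "\<alpha> \<le> \<beta>" "\<forall>p\<in>insert Infty (upto \<beta>). val g p = 0"
  shows "\<forall>p\<in>insert Infty (upto \<alpha>). val g p = 0"
  using upto_mono[OF assms(1)] assms(2) by blast

text \<open>
  A function in \<open>C_below \<gamma>\<close> is determined by its values at the countably many points of
  \<open>below \<gamma> \<union> {\<infinity>}\<close>, so the supports of the corresponding functionals have a common bound.
\<close>

lemma operator_supported:
  assumes T: "bounded_linear_on C_ladder T" "T ` C_ladder \<subseteq> C_below \<gamma>"
  shows "\<exists>\<alpha>. \<forall>g\<in>C_ladder. (\<forall>p\<in>insert Infty (upto \<alpha>). val g p = 0) \<longrightarrow> T g = 0"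
proof -
  have "bounded_linear_on C_ladder (\<lambda>f. val (T f) p)" for p
  proof -
    obtain B where B: "\<And>f. f \<in> C_ladder \<Longrightarrow> norm (T f) \<le> norm f * B"
      using T(1) unfolding bounded_linear_on_def by blast
    have "norm (val (T f) p) \<le> norm f * B" if "f \<in> C_ladder" for f
      using abs_val_le_norm[of "T f" p] B[OF that] by simp
    then show ?thesis using bounded_linear_onD[OF T(1)] unfolding bounded_linear_on_def by auto
  qed
  then have "\<forall>p. \<exists>\<alpha>. \<forall>g\<in>C_ladder. (\<forall>q\<in>insert Infty (upto \<alpha>). val g q = 0) \<longrightarrow> val (T g) p = 0"
    using functional_supported by blast
  then obtain a where a: "\<forall>p. \<forall>g\<in>C_ladder. (\<forall>q\<in>insert Infty (upto (a p)). val g q = 0) \<longrightarrow> val (T g) p = 0"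
    by (rule choice[THEN exE])
  have "countable (a ` insert Infty (below \<gamma>))" using countable_below by simp
  then obtain b where b: "\<forall>c\<in>a ` insert Infty (below \<gamma>). c < b" using countable_bounded_omega1 by blast
  have "T g = 0" if g: "g \<in> C_ladder" "\<forall>p\<in>insert Infty (upto b). val g p = 0" for g
  proof (rule val_eqI)
    fix p
    have Tg: "T g \<in> C_below \<gamma>" using T(2) g(1) by blast
    have z: "val (T g) q = 0" if "q \<in> insert Infty (below \<gamma>)" for q
    proof -
      have "a q < b" using b that by blast
      then have "\<forall>p\<in>insert Infty (upto (a q)). val g p = 0" by (intro vanishing_mono[OF less_imp_le g(2)])
      then show ?thesis using a g(1) by blast
    qed
    have "val (T g) p = 0"
    proof (cases "p \<in> ladder_space")
      case True
      then show ?thesis using z const_offD(2)[OF Tg, of p] by (cases "p \<in> below \<gamma>") simp_all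
    next
      case False
      then show ?thesis using val_outside_kspace const_offD(1)[OF Tg] by blast
    qed
    then show "val (T g) p = val 0 p" by simp
  qed
  then show ?thesis by blast
qed

lemma minus_cutoff_vanishes:
  assumes "f \<in> C_ladder"
  shows "\<forall>p\<in>insert Infty (upto \<alpha>). val (f - cutoff \<alpha> f) p = 0"
proof
  fix p assume "p \<in> insert Infty (upto \<alpha>)"
  then show "val (f - cutoff \<alpha> f) p = 0"
    using val_outside_kspace[OF assms, of p] Infty_in_ladder_space by (auto simp: cutoff_def val_truncate)
qed

text \<open>
  At an ordinal \<open>\<alpha>\<close> without a ladder, \<open>proj_below \<alpha>\<close> is truncation to \<open>upto \<alpha>\<close>, so its adjoint fixes
  every functional that ignores functions vanishing on \<open>upto \<alpha> \<union> {\<infinity>}\<close>. At limit ordinals this fails.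
\<close>

lemma controlled_SCP_C_ladder: "controlled_SCP C_ladder"
  unfolding controlled_SCP_def
proof (intro allI impI, elim conjE)
  fix F \<Gamma>
  assume F: "F \<subseteq> C_ladder" "separable_space (top_of_set F)"
    and \<Gamma>: "dual_subspace C_ladder \<Gamma>" "dual_separable C_ladder \<Gamma>"
  have \<Gamma>D: "bounded_linear_on C_ladder \<phi>" "\<And>x. x \<notin> C_ladder \<Longrightarrow> \<phi> x = 0" "\<phi> \<in> dual_space C_ladder" if "\<phi> \<in> \<Gamma>" for \<phi>
    using \<Gamma>(1) that unfolding dual_subspace_def dual_space_def by auto
  obtain D where D: "countable D" "D \<subseteq> \<Gamma>" "\<And>\<phi> e. \<phi> \<in> \<Gamma> \<Longrightarrow> 0 < e \<Longrightarrow> \<exists>\<psi>\<in>D. dual_dist C_ladder \<phi> \<psi> < e"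
    using \<Gamma>(2) unfolding dual_separable_def by blast
  have "\<forall>\<psi>. \<exists>\<alpha>. \<psi> \<in> D \<longrightarrow> (\<forall>g\<in>C_ladder. (\<forall>p\<in>insert Infty (upto \<alpha>). val g p = 0) \<longrightarrow> \<psi> g = 0)"
    using functional_supported \<Gamma>D(1) D(2) by blast
  then obtain a where a: "\<forall>\<psi>. \<psi> \<in> D \<longrightarrow> (\<forall>g\<in>C_ladder. (\<forall>p\<in>insert Infty (upto (a \<psi>)). val g p = 0) \<longrightarrow> \<psi> g = 0)"
    by (rule choice[THEN exE])
  obtain \<gamma> where \<gamma>: "F \<subseteq> C_below \<gamma>" by (rule separable_subset_C_below[OF F(2,1)])
  have "countable (insert \<gamma> (a ` D))" using D(1) by simp
  then obtain b where b: "\<forall>c\<in>insert \<gamma> (a ` D). c < b" using countable_bounded_omega1 by blast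
  obtain \<alpha> where \<alpha>: "b < \<alpha>" "\<not> limit_ordinal \<alpha>" using ex_nonlimit_above by blast
  have proj_below: "proj_below \<alpha> f = cutoff \<alpha> f" for f using \<alpha>(2) by (simp add: proj_below_def hump_def)
  have small: "\<phi> g = 0" if \<phi>: "\<phi> \<in> \<Gamma>" and g: "g \<in> C_ladder" "\<forall>p\<in>insert Infty (upto \<alpha>). val g p = 0" for \<phi> g
  proof -
    have "\<bar>\<phi> g\<bar> \<le> e * norm g" if "0 < e" for e
    proof -
      obtain \<psi> where \<psi>: "\<psi> \<in> D" "dual_dist C_ladder \<phi> \<psi> < e" using D(3)[OF \<phi> \<open>0 < e\<close>] by blast
      have "a \<psi> < \<alpha>" using b \<psi>(1) \<alpha>(1) by auto
      then have "\<forall>p\<in>insert Infty (upto (a \<psi>)). val g p = 0" by (intro vanishing_mono[OF less_imp_le g(2)])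
      then have "\<psi> g = 0" using a \<psi>(1) g(1) by blast
      moreover have "bounded_linear_on C_ladder (\<lambda>x. \<phi> x - \<psi> x)"
      proof -
        have b: "bounded_linear_on C_ladder \<phi>" "bounded_linear_on C_ladder \<psi>" using \<Gamma>D(1) \<phi> \<psi>(1) D(2) by auto
        obtain B where B: "\<And>x. x \<in> C_ladder \<Longrightarrow> norm (\<phi> x) \<le> norm x * B"
          using b(1) unfolding bounded_linear_on_def by blast
        obtain C where C: "\<And>x. x \<in> C_ladder \<Longrightarrow> norm (\<psi> x) \<le> norm x * C"
          using b(2) unfolding bounded_linear_on_def by blast
        have "norm (\<phi> x - \<psi> x) \<le> norm x * (B + C)" if "x \<in> C_ladder" for x
          using norm_triangle_ineq4[of "\<phi> x" "\<psi> x"] B[OF that] C[OF that] by (simp add: algebra_simps)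
        then show ?thesis
          unfolding bounded_linear_on_def
          using bounded_linear_onD[OF b(1)] bounded_linear_onD[OF b(2)]
          by (intro conjI ballI allI exI[of _ "B + C"]) (simp_all add: algebra_simps)
      qed
      then have "norm (\<phi> g - \<psi> g) \<le> dual_dist C_ladder \<phi> \<psi> * norm g"
        unfolding dual_dist_def using norm_le_onorm_on g(1) by blast
      moreover have "dual_dist C_ladder \<phi> \<psi> * norm g \<le> e * norm g"
        using \<psi>(2) by (intro mult_right_mono) auto
      ultimately show ?thesis by simp
    qed
    note le = this
    show ?thesis
    proof (rule ccontr)
      assume nz: "\<phi> g \<noteq> 0"
      then have "norm g \<noteq> 0" using le[of 1] by auto
      then show False using le[of "\<bar>\<phi> g\<bar> / (2 * norm g)"] nz by (simp add: field_simps)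
    qed
  qed
  show "\<exists>P. projection_on C_ladder P \<and> F \<subseteq> P ` C_ladder \<and> \<Gamma> \<subseteq> adjoint_on C_ladder P ` dual_space C_ladder \<and>
      separable_space (top_of_set (P ` C_ladder))"
  proof (intro exI[of _ "proj_below \<alpha>"] conjI)
    show "projection_on C_ladder (proj_below \<alpha>)" by (rule projection_proj_below)
    show "F \<subseteq> proj_below \<alpha> ` C_ladder" unfolding projection_proj_below(2) using \<gamma> C_below_mono[of \<gamma> \<alpha>] b \<alpha>(1) by force
    show "separable_space (top_of_set (proj_below \<alpha> ` C_ladder))" unfolding projection_proj_below(2) by (rule separable_C_below)
    show "\<Gamma> \<subseteq> adjoint_on C_ladder (proj_below \<alpha>) ` dual_space C_ladder"
    proof
      fix \<phi> assume \<phi>: "\<phi> \<in> \<Gamma>"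
      have "\<phi> (proj_below \<alpha> f) = \<phi> f" if f: "f \<in> C_ladder" for f
      proof -
        have "\<phi> (f - cutoff \<alpha> f) = 0"
          using small[OF \<phi> _ minus_cutoff_vanishes[OF f]] subspace_diff[OF subspace_C_space f cutoff_in_C_ladder[OF f]] by blast
        then show ?thesis
          using bounded_linear_on_diff[OF \<Gamma>D(1)[OF \<phi>] subspace_C_space f cutoff_in_C_ladder[OF f]] by (simp add: proj_below)
      qed
      then have "\<phi> = adjoint_on C_ladder (proj_below \<alpha>) \<phi>" using \<Gamma>D(2)[OF \<phi>] by (auto simp: adjoint_on_def)
      then show "\<phi> \<in> adjoint_on C_ladder (proj_below \<alpha>) ` dual_space C_ladder" using \<Gamma>D(3)[OF \<phi>] by blast
    qed
  qed
qed

text \<open>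
  A neighbourhood of \<open>\<infinity>\<close> omits only finitely many of the points \<open>l\<^sub>\<delta>\<close>.
\<close>

lemma val_limit_of_tendsto:
  assumes f: "f \<in> C_ladder" and a: "\<And>n::nat. limit_ordinal (a n)" "\<And>n. a n < a (Suc n)"
  shows "(\<lambda>n. val f (limit_of (a n))) \<longlonglongrightarrow> val f Infty"
proof (rule tendstoI)
  fix e :: real assume e: "0 < e"
  have inj: "inj a" using a(2) by (intro strict_mono_imp_inj_on) (simp add: strict_mono_Suc_iff)
  obtain \<B> where \<B>: "finite \<B>" "\<B> \<subseteq> ladder_family"
    "\<forall>p\<in>ladder_space. e \<le> \<bar>val f p - val f Infty\<bar> \<longrightarrow> (\<exists>A\<in>\<B>. p = Lim A \<or> p \<in> Pt ` A)"
    by (rule far_from_Infty_covered[OF almost_disjoint_ladder_family f e])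
  have "finite {n. rung (a n) \<in> \<B>}"
  proof (rule inj_on_finite[of "\<lambda>n. rung (a n)" _ \<B>])
    show "inj_on (\<lambda>n. rung (a n)) {n. rung (a n) \<in> \<B>}"
      using rung_inject[OF a(1) a(1)] injD[OF inj] by (auto intro!: inj_onI)
  qed (use \<B>(1) in auto)
  then obtain N where N: "\<And>n. rung (a n) \<in> \<B> \<Longrightarrow> n < N" using finite_nat_set_iff_bounded by auto
  have "dist (val f (limit_of (a n))) (val f Infty) < e" if "N \<le> n" for n
  proof (rule ccontr)
    assume "\<not> ?thesis"
    then have "e \<le> \<bar>val f (limit_of (a n)) - val f Infty\<bar>" by (simp add: dist_real_def)
    then have "rung (a n) \<in> \<B>" using \<B>(3) limit_of_in_ladder_space[OF a(1)[of n]] by auto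
    then show False using N that by fastforce
  qed
  then show "\<forall>\<^sub>F n in sequentially. dist (val f (limit_of (a n))) (val f Infty) < e"
    by (auto simp: eventually_sequentially)
qed

lemma val_limit_of_eq:
  assumes f: "f \<in> C_ladder" and \<delta>: "limit_ordinal \<delta>" and fin: "finite {x\<in>ladder \<delta>. val f (point x) \<noteq> c}"
  shows "val f (limit_of \<delta>) = c"
proof (rule ccontr)
  assume "val f (limit_of \<delta>) \<noteq> c"
  then have e: "0 < \<bar>c - val f (limit_of \<delta>)\<bar>" (is "0 < ?e") by simp
  have "rung \<delta> \<in> ladder_family" using \<delta> by (simp add: ladder_family_def)
  then have "finite {y\<in>rung \<delta>. ?e \<le> \<bar>val f (Pt y) - val f (limit_of \<delta>)\<bar>}"
    using finite_far_from_Lim[OF almost_disjoint_ladder_family f _ e] by blast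
  moreover have "finite (Rep_omega1 ` {x\<in>ladder \<delta>. val f (point x) \<noteq> c})" using fin by simp
  moreover have "rung \<delta> \<subseteq> {y\<in>rung \<delta>. ?e \<le> \<bar>val f (Pt y) - val f (limit_of \<delta>)\<bar>} \<union> Rep_omega1 ` {x\<in>ladder \<delta>. val f (point x) \<noteq> c}"
    by (auto simp: rung_def)
  ultimately have "finite (rung \<delta>)" using finite_subset by blast
  then show False using infinite_rung[OF \<delta>] by blast
qed

section \<open>No projectional skeleton\<close>

text \<open>
  From here to the contradiction a projectional skeleton \<open>\<H>\<close> with projections \<open>P\<close> is assumed to exist.
\<close>

context
  fixes \<H> P
  assumes skel: "skeleton C_ladder \<H>"
    and proj: "\<forall>F\<in>\<H>. projection_on C_ladder (P F) \<and> P F ` C_ladder = F"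
    and compat: "\<forall>F\<in>\<H>. \<forall>F'\<in>\<H>. F \<subseteq> F' \<longrightarrow> (\<forall>x\<in>C_ladder. P F (P F' x) = P F x \<and> P F' (P F x) = P F x)"
begin

lemma C_below_in_skeleton_lub:
  assumes a: "\<And>n::nat. C_below (a n) \<in> \<H>" "\<And>n. a n < a (Suc n)"
    and s: "\<And>n. a n < s" "\<forall>b<s. \<exists>n. b < a n"
  shows "C_below s \<in> \<H>" "C_below s = closure (\<Union>n. C_below (a n))"
proof -
  have "closure (\<Union>c\<in>range a. C_below c) = C_below s"
    by (rule C_below_lub) (use s less_imp_le in auto)
  then show eq: "C_below s = closure (\<Union>n. C_below (a n))" by simp
  have "\<forall>n. C_below (a n) \<in> \<H> \<and> C_below (a n) \<subseteq> C_below (a (Suc n))"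
    using a C_below_mono less_imp_le by blast
  then show "C_below s \<in> \<H>" unfolding eq using skel unfolding skeleton_def by (elim conjE allE[of _ "\<lambda>n. C_below (a n)"]) simp
qed

text \<open>
  Back and forth: stages \<open>C_below \<alpha>\<^sub>n\<close> and members \<open>H\<^sub>n\<close> of the given skeleton are chosen alternately,
  each containing the previous ones. The two interleaved chains have the same union, so its closure
  is both a stage and a member of the skeleton.
\<close>

lemma C_below_in_skeleton_unbounded: "\<exists>\<alpha>>\<beta>. C_below \<alpha> \<in> \<H>"
proof -
  have sep: "separable_space (top_of_set F) \<and> F \<subseteq> C_ladder" if "F \<in> \<H>" for F
    using skel that unfolding skeleton_def by auto
  have C_below_subset: "C_below \<alpha> \<subseteq> C_ladder" for \<alpha> by (auto simp: const_off_def)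
  have "\<exists>x. \<forall>n::nat. (snd (x n) \<in> \<H> \<and> \<beta> < fst (x n)) \<and>
    (fst (x n) < fst (x (Suc n)) \<and> snd (x n) \<subseteq> snd (x (Suc n)) \<and>
     C_below (fst (x n)) \<subseteq> snd (x (Suc n)) \<and> snd (x n) \<subseteq> C_below (fst (x (Suc n))))"
  proof (rule dependent_nat_choice)
    have "0 \<in> C_ladder" using subspace_0[OF subspace_C_space] .
    then have "\<exists>F. F \<in> \<H>" using skel unfolding skeleton_def by blast
    moreover obtain \<alpha> where "\<beta> < \<alpha>" using ex_nonlimit_above by blast
    ultimately show "\<exists>x. snd x \<in> \<H> \<and> \<beta> < fst x" by auto
    fix x and n :: nat assume x: "snd x \<in> \<H> \<and> \<beta> < fst x"
    obtain H' where H': "H' \<in> \<H>" "snd x \<subseteq> H'" "C_below (fst x) \<subseteq> H'"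
      using skeleton_absorbs[OF skel _ separable_C_below C_below_subset, of "snd x"] x by blast
    obtain \<gamma> where \<gamma>: "fst x < \<gamma>" using ex_nonlimit_above by blast
    obtain \<alpha> where \<alpha>: "\<gamma> \<le> \<alpha>" "snd x \<subseteq> C_below \<alpha>"
      using separable_subset_C_below[of "snd x" \<gamma>] sep x by blast
    then have "fst x < \<alpha>" using \<gamma> by simp
    then show "\<exists>y. (snd y \<in> \<H> \<and> \<beta> < fst y) \<and>
      (fst x < fst y \<and> snd x \<subseteq> snd y \<and> C_below (fst x) \<subseteq> snd y \<and> snd x \<subseteq> C_below (fst y))"
      using H' \<alpha>(2) x by (intro exI[of _ "(\<alpha>, H')"]) auto
  qed
  then obtain x where x: "\<And>n::nat. snd (x n) \<in> \<H>" "\<And>n. \<beta> < fst (x n)" "\<And>n. fst (x n) < fst (x (Suc n))"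
    "\<And>n. snd (x n) \<subseteq> snd (x (Suc n))" "\<And>n. C_below (fst (x n)) \<subseteq> snd (x (Suc n))"
    "\<And>n. snd (x n) \<subseteq> C_below (fst (x (Suc n)))" by blast
  obtain s where s: "\<And>n. fst (x n) < s" "\<And>b. b < s \<Longrightarrow> \<exists>n. b < fst (x n)" "limit_ordinal s"
    using strict_mono_lub_omega1[of "\<lambda>n. fst (x n)"] x(3) by metis
  have "closure (\<Union>c\<in>range (\<lambda>n. fst (x n)). C_below c) = C_below s"
    by (rule C_below_lub) (use s less_imp_le in auto)
  moreover have "(\<Union>c\<in>range (\<lambda>n. fst (x n)). C_below c) = (\<Union>n. snd (x n))"
  proof
    show "(\<Union>c\<in>range (\<lambda>n. fst (x n)). C_below c) \<subseteq> (\<Union>n. snd (x n))" using x(5) by blast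
    show "(\<Union>n. snd (x n)) \<subseteq> (\<Union>c\<in>range (\<lambda>n. fst (x n)). C_below c)" using x(6) by blast
  qed
  moreover have "closure (\<Union>n. snd (x n)) \<in> \<H>"
    using skel x(1,4) unfolding skeleton_def by (elim conjE allE[of _ "\<lambda>n. snd (x n)"]) simp
  ultimately have "C_below s \<in> \<H>" by simp
  then show ?thesis using s(1)[of 0] x(2)[of 0] by (auto intro: less_trans)
qed

definition bounded_stage :: "real \<Rightarrow> omega1 \<Rightarrow> bool" where
  "bounded_stage M \<alpha> \<longleftrightarrow> C_below \<alpha> \<in> \<H> \<and> (\<forall>f\<in>C_ladder. norm (P (C_below \<alpha>) f) \<le> M * norm f)"

text \<open>
  If each of the countably many bounds \<open>n\<close> failed from some ordinal on, all would fail beyond a common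
  ordinal.
\<close>

lemma bounded_stage_unbounded: "\<exists>M\<ge>0. \<forall>\<beta>. \<exists>\<alpha>>\<beta>. bounded_stage M \<alpha>"
proof (rule ccontr)
  assume "\<not> ?thesis"
  then have "\<forall>n::nat. \<exists>\<beta>. \<forall>\<alpha>>\<beta>. \<not> bounded_stage (real n) \<alpha>" using of_nat_0_le_iff by blast
  then obtain b where b: "\<forall>n::nat. \<forall>\<alpha>>b n. \<not> bounded_stage (real n) \<alpha>" by (rule choice[THEN exE])
  obtain c where c: "\<forall>x\<in>range b. x < c" using countable_bounded_omega1[of "range b"] by auto
  obtain \<alpha> where \<alpha>: "c < \<alpha>" "C_below \<alpha> \<in> \<H>" using C_below_in_skeleton_unbounded by blast
  have "bounded_linear_on C_ladder (P (C_below \<alpha>))" using proj \<alpha>(2) by (simp add: projection_on_def)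
  then obtain B where B: "0 \<le> B" "\<And>f. f \<in> C_ladder \<Longrightarrow> norm (P (C_below \<alpha>) f) \<le> B * norm f"
    using bounded_linear_on_bound by blast
  obtain n :: nat where n: "B \<le> real n" using real_arch_simple by blast
  have "norm (P (C_below \<alpha>) f) \<le> real n * norm f" if "f \<in> C_ladder" for f
    using B(2)[OF that] mult_right_mono[OF n norm_ge_zero[of f]] by linarith
  then have "bounded_stage (real n) \<alpha>" unfolding bounded_stage_def using \<alpha>(2) by blast
  moreover have "b n < c" using c by blast
  then have "b n < \<alpha>" using \<alpha>(1) by (rule less_trans)
  ultimately show False using b by blast
qed

lemma bounded_stage_projection:
  assumes "bounded_stage M \<alpha>"
  shows "bounded_linear_on C_ladder (P (C_below \<alpha>))" "P (C_below \<alpha>) ` C_ladder = C_below \<alpha>" "\<And>f. f \<in> C_below \<alpha> \<Longrightarrow> P (C_below \<alpha>) f = f"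
    "\<And>f. f \<in> C_ladder \<Longrightarrow> norm (P (C_below \<alpha>) f) \<le> M * norm f"
proof -
  have C_below: "C_below \<alpha> \<in> \<H>" using assms by (simp add: bounded_stage_def)
  then have pr: "projection_on C_ladder (P (C_below \<alpha>))" and im: "P (C_below \<alpha>) ` C_ladder = C_below \<alpha>" using proj by simp_all
  then show "bounded_linear_on C_ladder (P (C_below \<alpha>))" "P (C_below \<alpha>) ` C_ladder = C_below \<alpha>" by (simp_all add: projection_on_def)
  show "P (C_below \<alpha>) f = f" if "f \<in> C_below \<alpha>" for f
    using projection_on_fixes_image[OF pr] that unfolding im by blast
  show "\<And>f. f \<in> C_ladder \<Longrightarrow> norm (P (C_below \<alpha>) f) \<le> M * norm f" using assms by (simp add: bounded_stage_def)
qed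

text \<open>
  On \<open>C_below s\<close> the projections converge pointwise to the identity, because they do so on a dense
  subset and are uniformly bounded. Since \<open>P\<^sub>a f = P\<^sub>a (P\<^sub>s f)\<close> for stages \<open>a < s\<close>, this gives convergence
  for all \<open>f\<close>, and the bound passes to the limit.
\<close>

lemma bounded_stage_lub:
  assumes M: "0 \<le> M" and a: "\<And>n::nat. bounded_stage M (a n)" "\<And>n. a n < a (Suc n)"
    and s: "\<And>n. a n < s" "\<forall>b<s. \<exists>n. b < a n"
  shows "bounded_stage M s" "\<And>f. f \<in> C_ladder \<Longrightarrow> (\<lambda>n. P (C_below (a n)) f) \<longlonglongrightarrow> P (C_below s) f"
proof -
  have aH: "C_below (a n) \<in> \<H>" for n using a(1) by (simp add: bounded_stage_def)
  note Gs = C_below_in_skeleton_lub[OF aH a(2) s]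
  have im: "P (C_below s) ` C_ladder = C_below s" using proj Gs(1) by blast
  have C_below_subset: "C_below \<alpha> \<subseteq> C_ladder" for \<alpha> by (auto simp: const_off_def)
  show lim: "(\<lambda>n. P (C_below (a n)) f) \<longlonglongrightarrow> P (C_below s) f" if f: "f \<in> C_ladder" for f
  proof (rule LIMSEQ_I)
    fix e :: real assume e: "0 < e"
    define g where "g = P (C_below s) f"
    have g: "g \<in> C_below s" unfolding g_def using im f by blast
    then have gE: "g \<in> C_ladder" using C_below_subset by blast
    have "C_below (a n) \<subseteq> C_below s" for n using C_below_mono[OF less_imp_le[OF s(1)]] .
    then have Pg: "P (C_below (a n)) f = P (C_below (a n)) g" for n
      unfolding g_def using compat aH Gs(1) f by metis
    have "0 < e / (M + 1)" using e M by simp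
    moreover have "g \<in> closure (\<Union>n. C_below (a n))" using g Gs(2) by simp
    ultimately have "\<exists>h\<in>(\<Union>n. C_below (a n)). dist h g < e / (M + 1)"
      unfolding closure_approachable by simp
    then obtain h where h: "h \<in> (\<Union>n. C_below (a n))" "dist h g < e / (M + 1)" ..
    then obtain m where m: "h \<in> C_below (a m)" by blast
    have hE: "h \<in> C_ladder" using m C_below_subset by blast
    have "norm (P (C_below (a n)) f - P (C_below s) f) < e" if "m \<le> n" for n
    proof -
      have "strict_mono a" using a(2) by (simp add: strict_mono_Suc_iff)
      then have "a m \<le> a n" using that by (simp add: strict_mono_less_eq)
      then have "h \<in> C_below (a n)" using m C_below_mono by blast
      then have Ph: "P (C_below (a n)) h = h" using bounded_stage_projection(3)[OF a(1)] by blast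
      have "P (C_below (a n)) (g - h) = P (C_below (a n)) g - h"
        using bounded_linear_on_diff[OF bounded_stage_projection(1)[OF a(1)] subspace_C_space gE hE] Ph by simp
      then have "P (C_below (a n)) f - P (C_below s) f = P (C_below (a n)) (g - h) - (g - h)"
        unfolding Pg g_def[symmetric] by simp
      also have "norm \<dots> \<le> norm (P (C_below (a n)) (g - h)) + norm (g - h)" by (rule norm_triangle_ineq4)
      also have "\<dots> \<le> M * norm (g - h) + norm (g - h)"
        using bounded_stage_projection(4)[OF a(1) subspace_diff[OF subspace_C_space gE hE]] by simp
      also have "\<dots> = (M + 1) * dist h g" by (simp add: algebra_simps dist_norm norm_minus_commute)
      also have "\<dots> < e" using h(2) M by (simp add: field_simps)
      finally show ?thesis .
    qed
    then show "\<exists>N. \<forall>n\<ge>N. norm (P (C_below (a n)) f - P (C_below s) f) < e" by blast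
  qed
  have "norm (P (C_below s) f) \<le> M * norm f" if f: "f \<in> C_ladder" for f
    by (rule LIMSEQ_le_const2[OF tendsto_norm[OF lim[OF f]]]) (use bounded_stage_projection(4)[OF a(1) f] in blast)
  then show "bounded_stage M s" using Gs(1) by (simp add: bounded_stage_def)
qed

definition local_stage :: "real \<Rightarrow> omega1 \<Rightarrow> bool" where
  "local_stage M \<alpha> \<longleftrightarrow> bounded_stage M \<alpha> \<and> limit_ordinal \<alpha> \<and>
    (\<forall>f\<in>C_ladder. (\<forall>p\<in>insert Infty (upto \<alpha>). val f p = 0) \<longrightarrow> P (C_below \<alpha>) f = 0)"

text \<open>
  Choose bounded stages so that \<open>P\<close> at \<open>a\<^sub>n\<close> sees only points up to \<open>a\<^sub>n\<^sub>+\<^sub>1\<close>. At the supremum \<open>s\<close> all of them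
  ignore functions vanishing on \<open>upto s \<union> {\<infinity>}\<close>, and so does their limit.
\<close>

lemma local_stage_unbounded:
  assumes M: "0 \<le> M" and unb: "\<And>\<beta>. \<exists>\<alpha>>\<beta>. bounded_stage M \<alpha>"
  shows "\<exists>\<alpha>>\<beta>. local_stage M \<alpha>"
proof -
  have "\<exists>a. \<forall>n::nat. (bounded_stage M (a n) \<and> \<beta> < a n) \<and> (a n < a (Suc n) \<and>
     (\<forall>f\<in>C_ladder. (\<forall>p\<in>insert Infty (upto (a (Suc n))). val f p = 0) \<longrightarrow> P (C_below (a n)) f = 0))"
  proof (rule dependent_nat_choice)
    show "\<exists>\<alpha>. bounded_stage M \<alpha> \<and> \<beta> < \<alpha>" using unb by blast
    fix \<alpha> and n :: nat assume \<alpha>: "bounded_stage M \<alpha> \<and> \<beta> < \<alpha>"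
    obtain \<gamma> where \<gamma>: "\<forall>f\<in>C_ladder. (\<forall>p\<in>insert Infty (upto \<gamma>). val f p = 0) \<longrightarrow> P (C_below \<alpha>) f = 0"
      using operator_supported[of "P (C_below \<alpha>)" \<alpha>] bounded_stage_projection(1,2)[of M \<alpha>] \<alpha> by auto
    obtain \<delta> where \<delta>: "max \<alpha> \<gamma> < \<delta>" "bounded_stage M \<delta>" using unb by blast
    have "P (C_below \<alpha>) f = 0" if "f \<in> C_ladder" "\<forall>p\<in>insert Infty (upto \<delta>). val f p = 0" for f
    proof -
      have "\<gamma> \<le> \<delta>" using \<delta>(1) by (simp add: less_imp_le)
      then have "\<forall>p\<in>insert Infty (upto \<gamma>). val f p = 0" using that(2) by (rule vanishing_mono)
      then show ?thesis using \<gamma> that(1) by blast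
    qed
    then show "\<exists>\<delta>. (bounded_stage M \<delta> \<and> \<beta> < \<delta>) \<and> (\<alpha> < \<delta> \<and>
        (\<forall>f\<in>C_ladder. (\<forall>p\<in>insert Infty (upto \<delta>). val f p = 0) \<longrightarrow> P (C_below \<alpha>) f = 0))"
      using \<delta> \<alpha> by (intro exI[of _ \<delta>]) auto
  qed
  then obtain a where a: "\<And>n::nat. bounded_stage M (a n)" "\<And>n. \<beta> < a n" "\<And>n. a n < a (Suc n)"
    and kill: "\<And>n. \<forall>f\<in>C_ladder. (\<forall>p\<in>insert Infty (upto (a (Suc n))). val f p = 0) \<longrightarrow> P (C_below (a n)) f = 0"
    by blast
  obtain s where s: "\<And>n. a n < s" "\<And>b. b < s \<Longrightarrow> \<exists>n. b < a n" "limit_ordinal s"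
    using strict_mono_lub_omega1[of a] a(3) by metis
  have cof: "\<forall>b<s. \<exists>n. b < a n" using s(2) by blast
  note gs = bounded_stage_lub[OF M a(1,3) s(1) cof]
  have "P (C_below s) f = 0" if f: "f \<in> C_ladder" "\<forall>p\<in>insert Infty (upto s). val f p = 0" for f
  proof -
    have "P (C_below (a n)) f = 0" for n
      using kill[of n] f(1) vanishing_mono[OF less_imp_le[OF s(1)] f(2), of "Suc n"] by blast
    then have "(\<lambda>n. 0) \<longlonglongrightarrow> P (C_below s) f" using gs(2)[OF f(1)] by simp
    then show ?thesis using tendsto_const by (rule LIMSEQ_unique)
  qed
  then have "local_stage M s" unfolding local_stage_def using gs(1) s(3) by blast
  then show ?thesis using a(2)[of 0] s(1)[of 0] by (auto intro: less_trans)
qed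

text \<open>
  Modulo functions that \<open>P\<close> ignores, \<open>f\<close> equals \<open>proj_below \<alpha> f\<close>, which is fixed by \<open>P\<close>, plus \<open>f(l\<^sub>\<alpha>) - f(\<infinity>)\<close>
  times the hump. So \<open>P f\<close> and \<open>f\<close> differ below \<open>\<alpha>\<close> by this multiple of a fixed function of norm at most
  \<open>M + 1\<close>.
\<close>

lemma local_stage_deviation:
  assumes M: "0 \<le> M" and \<alpha>: "local_stage M \<alpha>" and f: "f \<in> C_ladder" and x: "x < \<alpha>"
  shows "\<bar>val (P (C_below \<alpha>) f) (point x) - val f (point x)\<bar> \<le> \<bar>val f (limit_of \<alpha>) - val f Infty\<bar> * (M + 1)"
proof -
  let ?P = "P (C_below \<alpha>)" and ?c = "val f (limit_of \<alpha>) - val f Infty"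
  have bounded_stage: "bounded_stage M \<alpha>" using \<alpha> by (simp add: local_stage_def)
  note bl = bounded_stage_projection(1)[OF bounded_stage]
  have "f - cutoff \<alpha> f \<in> C_ladder" using subspace_diff[OF subspace_C_space f cutoff_in_C_ladder[OF f]] .
  then have "?P (f - cutoff \<alpha> f) = 0" using minus_cutoff_vanishes[OF f] \<alpha> unfolding local_stage_def by blast
  then have "?P f = ?P (cutoff \<alpha> f)" using bounded_linear_on_diff[OF bl subspace_C_space f cutoff_in_C_ladder[OF f]] by simp
  also have "cutoff \<alpha> f = proj_below \<alpha> f + ?c *\<^sub>R hump \<alpha>" by (simp add: proj_below_def)
  also have "?P \<dots> = proj_below \<alpha> f + ?c *\<^sub>R ?P (hump \<alpha>)"
  proof -
    have "proj_below \<alpha> f \<in> C_below \<alpha>" using proj_below_in_C_below[OF f] .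
    moreover then have "proj_below \<alpha> f \<in> C_ladder" by (rule const_offD)
    ultimately show ?thesis
      using bounded_linear_onD[OF bl] hump_in_C_ladder subspace_scale[OF subspace_C_space hump_in_C_ladder]
        bounded_stage_projection(3)[OF bounded_stage] by simp
  qed
  finally have eq: "?P f = proj_below \<alpha> f + ?c *\<^sub>R ?P (hump \<alpha>)" .
  have "val (?P f) (point x) - val f (point x) = ?c * (val (?P (hump \<alpha>)) (point x) - val (hump \<alpha>) (point x))"
    unfolding eq using x val_outside_kspace[OF f, of "point x"]
    by (simp add: proj_below_def cutoff_def val_truncate algebra_simps)
  then have "\<bar>val (?P f) (point x) - val f (point x)\<bar> = \<bar>?c\<bar> * \<bar>val (?P (hump \<alpha>)) (point x) - val (hump \<alpha>) (point x)\<bar>"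
    by (simp add: abs_mult)
  also have "\<dots> \<le> \<bar>?c\<bar> * (M + 1)"
  proof (rule mult_left_mono)
    have "norm (?P (hump \<alpha>)) \<le> M * norm (hump \<alpha>)" using bounded_stage_projection(4)[OF bounded_stage hump_in_C_ladder] .
    also have "\<dots> \<le> M * 1" using M norm_hump_le by (intro mult_left_mono)
    finally have "\<bar>val (?P (hump \<alpha>)) (point x)\<bar> \<le> M" using abs_val_le_norm[of "?P (hump \<alpha>)" "point x"] by simp
    moreover have "\<bar>val (hump \<alpha>) (point x)\<bar> \<le> 1"
      using abs_val_le_norm[of "hump \<alpha>" "point x"] norm_hump_le[of \<alpha>] by linarith
    ultimately show "\<bar>val (?P (hump \<alpha>)) (point x) - val (hump \<alpha>) (point x)\<bar> \<le> M + 1" by linarith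
  qed simp
  finally show ?thesis .
qed

text \<open>
  At the supremum \<open>s\<close> of a strictly increasing sequence of local stages, the deviations tend to zero, so
  the projection onto \<open>C_below s\<close> preserves all values below \<open>s\<close>. It therefore cannot remove the hump
  at \<open>s\<close>, although it must make the values at \<open>l\<^sub>s\<close> and at \<open>\<infinity>\<close> agree.
\<close>

lemma no_projectional_skeleton: False
proof -
  obtain M where M: "0 \<le> M" and unb: "\<And>\<beta>. \<exists>\<alpha>>\<beta>. bounded_stage M \<alpha>" using bounded_stage_unbounded by blast
  have "\<exists>a. \<forall>n::nat. local_stage M (a n) \<and> a n < a (Suc n)"
    using local_stage_unbounded[OF M unb] by (intro dependent_nat_choice) blast+
  then obtain a where a: "\<And>n::nat. local_stage M (a n)" "\<And>n. a n < a (Suc n)" by blast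
  obtain s where s: "\<And>n. a n < s" "\<And>b. b < s \<Longrightarrow> \<exists>n. b < a n" "limit_ordinal s"
    using strict_mono_lub_omega1[of a] a(2) by metis
  have bounded_stage: "bounded_stage M (a n)" and lp: "limit_ordinal (a n)" for n using a(1)[of n] by (simp_all add: local_stage_def)
  have cof: "\<forall>b<s. \<exists>n. b < a n" using s(2) by blast
  note gs = bounded_stage_lub[OF M bounded_stage a(2) s(1) cof]
  have fix_pt: "val (P (C_below s) f) (point x) = val f (point x)" if f: "f \<in> C_ladder" and x: "x < s" for f x
  proof -
    obtain m where m: "x < a m" using s(2)[OF x] by blast
    have sm: "strict_mono a" using a(2) by (simp add: strict_mono_Suc_iff)
    have "(\<lambda>n. val (P (C_below (a n)) f) (point x) - val f (point x)) \<longlonglongrightarrow> 0"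
    proof (rule Lim_null_comparison)
      show "\<forall>\<^sub>F n in sequentially. norm (val (P (C_below (a n)) f) (point x) - val f (point x))
          \<le> \<bar>val f (limit_of (a n)) - val f Infty\<bar> * (M + 1)"
        unfolding eventually_sequentially
      proof (intro exI[of _ m] allI impI)
        fix n assume "m \<le> n"
        then have "a m \<le> a n" using sm by (simp add: strict_mono_less_eq)
        then have "x < a n" using m by simp
        then show "norm (val (P (C_below (a n)) f) (point x) - val f (point x)) \<le> \<bar>val f (limit_of (a n)) - val f Infty\<bar> * (M + 1)"
          using local_stage_deviation[OF M a(1) f] by simp
      qed
      show "(\<lambda>n. \<bar>val f (limit_of (a n)) - val f Infty\<bar> * (M + 1)) \<longlonglongrightarrow> 0"
        using val_limit_of_tendsto[of f a, OF f lp a(2)]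
        by (intro tendsto_mult_left_zero tendsto_rabs_zero LIM_zero)
    qed
    then have "(\<lambda>n. val (P (C_below (a n)) f) (point x)) \<longlonglongrightarrow> val f (point x)" by (rule LIM_zero_cancel)
    then show ?thesis using LIMSEQ_unique tendsto_val[OF gs(2)[OF f]] by blast
  qed
  define g where "g = P (C_below s) (hump s)"
  have gG: "g \<in> C_below s" unfolding g_def using bounded_stage_projection(2)[OF gs(1)] hump_in_C_ladder by blast
  then have gE: "g \<in> C_ladder" by (rule const_offD)
  have g_pt: "val g (point x) = indicator (ladder s) x" if "x < s" for x
    unfolding g_def fix_pt[OF hump_in_C_ladder that] by (rule val_hump_point[OF s(3)])
  have "val g (point x) = 1" if "x \<in> ladder s" for x
    using g_pt[of x] ladder(1)[OF s(3)] that by auto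
  then have "{x\<in>ladder s. val g (point x) \<noteq> 1} = {}" by blast
  then have "val g (limit_of s) = 1" using val_limit_of_eq[OF gE s(3)] by (metis finite.emptyI)
  moreover have "val g (limit_of s) = val g Infty"
    using const_offD(2)[OF gG limit_of_in_ladder_space[OF s(3)]] limit_of_in_below[OF s(3)] by simp
  moreover have "val g (limit_of (a n)) = 0" for n
  proof (rule val_limit_of_eq[OF gE lp])
    have "val g (point x) = 0" if "x \<in> ladder (a n)" "x \<notin> ladder s" for x
    proof -
      have "x < s" using that(1) ladder(1)[OF lp] s(1)[of n] by (auto intro: less_trans)
      then show ?thesis using g_pt that(2) by simp
    qed
    then have "{x\<in>ladder (a n). val g (point x) \<noteq> 0} \<subseteq> ladder (a n) \<inter> ladder s" by blast
    moreover have "finite (ladder (a n) \<inter> ladder s)"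
      using finite_ladder_Int[OF lp s(3)] s(1)[of n] by simp
    ultimately show "finite {x\<in>ladder (a n). val g (point x) \<noteq> 0}" by (rule finite_subset)
  qed
  then have "val g Infty = 0"
    using val_limit_of_tendsto[of g a, OF gE lp a(2)] by (simp add: LIMSEQ_const_iff)
  ultimately show False by simp
qed

end

lemma no_projectional_skeleton_C_ladder: "\<not> has_projectional_skeleton C_ladder"
proof
  assume "has_projectional_skeleton C_ladder"
  then show False unfolding has_projectional_skeleton_def by (elim exE conjE) (rule no_projectional_skeleton)
qed

section \<open>No projectional resolution of the identity\<close>

text \<open>
  A separable space would be a single stage, which misses the humps of later ladders.
\<close>

lemma not_separable_C_ladder: "\<not> separable_space (top_of_set C_ladder)"
proof
  assume "separable_space (top_of_set C_ladder)"
  then obtain \<alpha> where \<alpha>: "C_ladder \<subseteq> C_below \<alpha>" by (rule separable_subset_C_below) simp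
  have "\<exists>a. \<forall>n::nat. (\<alpha> < a n) \<and> a n < a (Suc n)"
  proof (rule dependent_nat_choice)
    show "\<exists>\<beta>. \<alpha> < \<beta>" using ex_nonlimit_above by blast
    show "\<exists>\<gamma>. \<alpha> < \<gamma> \<and> \<beta> < \<gamma>" for \<beta>
      using ex_nonlimit_above[of "max \<alpha> \<beta>"] by auto
  qed
  then obtain a where a: "\<And>n::nat. \<alpha> < a n" "\<And>n. a n < a (Suc n)" by blast
  obtain s where s: "\<And>n. a n < s" "limit_ordinal s"
    using strict_mono_lub_omega1[of a] a(2) by metis
  have "\<not> s < \<alpha>" using a(1)[of 0] s(1)[of 0] by simp
  moreover have "hump s \<in> C_below \<alpha>" using \<alpha> hump_in_C_ladder by blast
  ultimately have "val (hump s) (limit_of s) = val (hump s) Infty"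
    using const_offD(2) limit_of_in_ladder_space[OF s(2)] limit_of_in_below[OF s(2)] by blast
  then show False using val_hump_limit_of[OF s(2,2)] by simp
qed

lemma dense_subset_C_ladder_card_le: "\<exists>D. dense_subset C_ladder D \<and> |D| \<le>o |UNIV :: omega1 set|"
proof -
  have "\<forall>\<alpha>. \<exists>D. countable D \<and> D \<subseteq> C_below \<alpha> \<and> C_below \<alpha> \<subseteq> closure D"
    using separable_C_below unfolding separable_top_of_set_iff by blast
  then obtain D where D: "\<forall>\<alpha>. countable (D \<alpha>) \<and> D \<alpha> \<subseteq> C_below \<alpha> \<and> C_below \<alpha> \<subseteq> closure (D \<alpha>)"
    by (rule choice[THEN exE])
  have "(\<Union>\<alpha>. D \<alpha>) \<subseteq> C_ladder" using D const_offD(1) by blast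
  moreover have "C_ladder \<subseteq> closure (\<Union>\<alpha>. D \<alpha>)"
  proof
    fix f assume "f \<in> C_ladder"
    then obtain \<alpha> where "f \<in> C_below \<alpha>" by (rule in_some_C_below)
    then have "f \<in> closure (D \<alpha>)" using D by blast
    moreover have "closure (D \<alpha>) \<subseteq> closure (\<Union>\<alpha>. D \<alpha>)" by (intro closure_mono) blast
    ultimately show "f \<in> closure (\<Union>\<alpha>. D \<alpha>)" by blast
  qed
  moreover have "|\<Union>\<alpha>. D \<alpha>| \<le>o |UNIV :: omega1 set|"
  proof (rule card_of_UNION_ordLeq_infinite)
    show inf: "infinite (UNIV :: omega1 set)" using uncountable_omega1 countable_finite by blast
    have "|D \<alpha>| \<le>o natLeq" for \<alpha> using D countable_card_le_natLeq by blast
    then show "\<forall>\<alpha>\<in>UNIV. |D \<alpha>| \<le>o |UNIV :: omega1 set|"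
      using infinite_iff_natLeq_ordLeq inf ordLeq_transitive by blast
    show "|UNIV :: omega1 set| \<le>o |UNIV :: omega1 set|" by (rule card_of_mono1) simp
  qed
  ultimately show ?thesis unfolding dense_subset_def by blast
qed

text \<open>
  The space is not separable but has a dense subset of cardinality at most \<open>\<omega>\<^sub>1\<close>, so its density is
  uncountable with countable proper initial segments.
\<close>

lemma no_PRI_C_ladder: "\<not> has_PRI C_ladder"
proof
  assume "has_PRI C_ladder"
  then obtain \<kappa> P where \<kappa>: "has_density C_ladder \<kappa>" and PRI: "PRI C_ladder \<kappa> P" unfolding has_PRI_def by blast
  have co: "Card_order \<kappa>" using \<kappa> by (simp add: has_density_def)
  interpret wo_rel \<kappa> using co by (simp add: card_order_on_well_order_on wo_rel_def)
  have "uncountable (Field \<kappa>)"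
  proof
    assume "countable (Field \<kappa>)"
    then have "|Field \<kappa>| \<le>o natLeq" using countable_card_le_natLeq by blast
    moreover obtain D where D: "dense_subset C_ladder D" "|D| \<le>o \<kappa>"
      using \<kappa> unfolding has_density_def density_le_def by blast
    moreover have "\<kappa> =o |Field \<kappa>|" using card_of_Field_ordIso[OF co] ordIso_symmetric by blast
    ultimately have "|D| \<le>o natLeq" using ordLeq_ordIso_trans ordLeq_transitive by blast
    then have "countable D" using countable_card_le_natLeq by blast
    then have "separable_space (top_of_set C_ladder)"
      unfolding separable_top_of_set_iff using D(1) by (auto simp: dense_subset_def)
    then show False using not_separable_C_ladder by blast
  qed
  moreover have "countable \<alpha>" if \<alpha>: "ofilter \<alpha>" "\<alpha> \<noteq> Field \<kappa>" for \<alpha>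
  proof -
    obtain a where a: "a \<in> Field \<kappa>" "\<alpha> = underS a" using \<alpha> ofilter_underS_Field by blast
    obtain D where D: "dense_subset C_ladder D" "|D| \<le>o |UNIV :: omega1 set|" using dense_subset_C_ladder_card_le by blast
    have "|\<alpha>| <o \<kappa>" unfolding a(2) using card_of_underS[OF co a(1)] .
    moreover have "\<kappa> \<le>o |D|" using \<kappa> D(1) unfolding has_density_def by blast
    ultimately have "|\<alpha>| <o |D|" by (rule ordLess_ordLeq_trans)
    then have "|\<alpha>| <o |UNIV :: omega1 set|" using D(2) by (rule ordLess_ordLeq_trans)
    then show ?thesis by (rule countable_if_card_less_omega1)
  qed
  ultimately have "has_projectional_skeleton C_ladder"
    using PRI_imp_projectional_skeleton[OF closed_C_space subspace_C_space co _ _ PRI] by blast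
  then show False using no_projectional_skeleton_C_ladder by blast
qed

theorem theorem1p6:
  shows "\<exists>\<A> :: real set set.
    almost_disjoint \<A> \<and> (\<forall>A\<in>\<A>. countable A) \<and>
    controlled_SCP (C_space (ktopology \<A>)) \<and>
    continuous_SCP (C_space (ktopology \<A>)) \<and>
    \<not> has_PRI (C_space (ktopology \<A>)) \<and>
    \<not> has_projectional_skeleton (C_space (ktopology \<A>))"
proof (intro exI conjI ballI)
  show "almost_disjoint ladder_family" by (rule almost_disjoint_ladder_family)
  show "countable A" if "A \<in> ladder_family" for A using that by (rule countable_ladder_family)
  show "controlled_SCP C_ladder" by (rule controlled_SCP_C_ladder)
  show "continuous_SCP C_ladder" unfolding continuous_SCP_def using skeleton_C_below by blast
  show "\<not> has_PRI C_ladder" by (rule no_PRI_C_ladder)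
  show "\<not> has_projectional_skeleton C_ladder" by (rule no_projectional_skeleton_C_ladder)
qed

end
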